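(* Fix $\beta\in(0,1)$ and $N\ge2$, and let $\widetilde\alpha=\sqrt{\tfrac{N}{N-1}\widehat\alpha^{\,2}}$. (i) For testing $\mathcal H_0:\theta=\theta_0$ against $\mathcal H_1:\theta\ne\theta_0$ (with $\theta_0\in\mathbb R$ given and $\alpha>0$ unknown), the test that rejects when $$\bigl|\sqrt{d_N}(\widehat\theta-\theta_0)/\widetilde\alpha\bigr|>t_{N-1,\,1-\beta/2}$$ has exact size $\beta$, whatever $\alpha>0$, and is uniformly most powerful unbiased. (ii) For testing $\mathcal H_0:\alpha^{2}=\alpha_0^{2}$ against $\mathcal H_1:\alpha^{2}\ne\alpha_0^{2}$ (with $\alpha_0>0$ given and $\theta\in\mathbb R$ unknown), the test that rejects when $N\widehat\alpha^{\,2}/\alpha_0^{2}\notin[\chi^{2}_{N-1,\beta/2},\chi^{2}_{N-1,1-\beta/2}]$ has exact size $\beta$, whatever $\theta\in\mathbb R$.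
   Context: Fix a mesh $h>0$, an integer $m\ge1$ and known Hurst parameters $H_1,\dots,H_m\in(1/2,1)$. Let $B^{H_1},\dots,B^{H_m}$ be independent fractional Brownian motions, i.e. independent centred continuous Gaussian processes with $B^{H_r}(0)=0$ and $\mathbb E[B^{H_r}(t)B^{H_r}(s)]=\frac12(t^{2H_r}+s^{2H_r}-|t-s|^{2H_r})$ for $s,t\ge0$. For unknown $\theta\in\mathbb R$ and $\alpha>0$ set $Z(t)=\theta t+\alpha\sum_{r=1}^m B^{H_r}(t)$, $t_k=kh$, $\mathbf T=(t_1,\dots,t_N)^\top$, $\mathbf Z=(Z(t_1),\dots,Z(t_N))^\top$. Let $\Gamma_H=\sum_{r=1}^m\Gamma_{H_r}$ be the $N\times N$ positive definite matrix with $(\Gamma_{H_r})_{ij}=\frac12(t_i^{2H_r}+t_j^{2H_r}-|t_i-t_j|^{2H_r})$. The statistical model is the family of laws $\mathbf Z\sim\mathcal N(\theta\mathbf T,\alpha^2\Gamma_H)$ indexed by $(\theta,\alpha^2)\in\mathbb R\times(0,\infty)$. Put $d_N=\mathbf T^\top\Gamma_H^{-1}\mathbf T>0$ and $$\widehat\theta=\frac{\mathbf T^\top\Gamma_H^{-1}\mathbf Z}{d_N},\qquad \widehat\alpha^{\,2}=\frac1N\left(\mathbf Z^\top\Gamma_H^{-1}\mathbf Z-\frac{(\mathbf T^\top\Gamma_H^{-1}\mathbf Z)^2}{d_N}\right).$$ $\chi^2_{k,p}$ and $t_{k,p}$ denote the $p$-quantiles of the chi-square and Student laws with $k$ degrees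 of freedom. "Uniformly most powerful unbiased" means uniformly most powerful among all unbiased level-$\beta$ tests based on $\mathbf Z$. *)

theory Defs
  imports
    "HOL-Probability.Probability"
    "Jordan_Normal_Form.Gauss_Jordan_Elimination"
begin

section \<open>Fractional Brownian motion\<close>

text \<open>Degenerate (constant) normal laws are included, as needed for instance at time 0.\<close>
definition normal_law :: "real \<Rightarrow> real \<Rightarrow> real measure" where
  "normal_law \<mu> \<sigma> = (if \<sigma> = 0 then return borel \<mu> else density lborel (normal_density \<mu> \<sigma>))"

definition gaussian_rv :: "'a measure \<Rightarrow> ('a \<Rightarrow> real) \<Rightarrow> bool" where
  "gaussian_rv M X \<longleftrightarrow>
     X \<in> borel_measurable M \<and> (\<exists>\<mu> \<sigma>. 0 \<le> \<sigma> \<and> distr M borel X = normal_law \<mu> \<sigma>)"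

definition gaussian_process :: "'a measure \<Rightarrow> 't set \<Rightarrow> ('t \<Rightarrow> 'a \<Rightarrow> real) \<Rightarrow> bool" where
  "gaussian_process M I X \<longleftrightarrow>
     (\<forall>J c. finite J \<and> J \<subseteq> I \<longrightarrow> gaussian_rv M (\<lambda>\<omega>. \<Sum>t\<in>J. c t * X t \<omega>))"

definition fbm_cov :: "real \<Rightarrow> real \<Rightarrow> real \<Rightarrow> real" where
  "fbm_cov H t s = (t powr (2 * H) + s powr (2 * H) - \<bar>t - s\<bar> powr (2 * H)) / 2"

definition fractional_brownian_motion ::
    "'a measure \<Rightarrow> real \<Rightarrow> (real \<Rightarrow> 'a \<Rightarrow> real) \<Rightarrow> bool" where
  "fractional_brownian_motion M H B \<longleftrightarrow>
     gaussian_process M {0..} B \<and>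
     (\<forall>t\<ge>0. prob_space.expectation M (B t) = 0) \<and>
     (\<forall>t\<ge>0. \<forall>s\<ge>0. prob_space.expectation M (\<lambda>\<omega>. B t \<omega> * B s \<omega>) = fbm_cov H t s) \<and>
     (AE \<omega> in M. B 0 \<omega> = 0 \<and> continuous_on {0..} (\<lambda>t. B t \<omega>))"

text \<open>Independence of the processes as random paths, i.e. of the sigma-algebras they generate.\<close>
definition independent_processes ::
    "'a measure \<Rightarrow> (nat \<Rightarrow> real \<Rightarrow> 'a \<Rightarrow> real) \<Rightarrow> nat set \<Rightarrow> bool" where
  "independent_processes M B R \<longleftrightarrow>
     prob_space.indep_vars M (\<lambda>_. \<Pi>\<^sub>M t\<in>{0..}. borel) (\<lambda>r \<omega>. \<lambda>t\<in>{0..}. B r t \<omega>) R"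

section \<open>The discretely observed model\<close>

definition Z_process ::
    "nat \<Rightarrow> (nat \<Rightarrow> real \<Rightarrow> 'a \<Rightarrow> real) \<Rightarrow> real \<Rightarrow> real \<Rightarrow> real \<Rightarrow> 'a \<Rightarrow> real" where
  "Z_process m B \<theta> \<alpha> t \<omega> = \<theta> * t + \<alpha> * (\<Sum>r=1..m. B r t \<omega>)"

definition grid :: "real \<Rightarrow> nat \<Rightarrow> real" where
  "grid h k = real k * h"

text \<open>
  Vectors and matrices are indexed from 0, so that coordinate \<open>i\<close> belongs to the time
  \<open>grid h (Suc i)\<close>. An observation is a function on \<open>{..<N}\<close>, and \<open>Matrix.vec N z\<close> is the
  corresponding column vector.
\<close>

definition obs_space :: "nat \<Rightarrow> (nat \<Rightarrow> real) measure" where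
  "obs_space N = (\<Pi>\<^sub>M i\<in>{..<N}. borel)"

text \<open>The law of the observed vector, with parameter \<open>(\<theta>, \<alpha>\<^sup>2)\<close>.\<close>
definition obs_law ::
    "'a measure \<Rightarrow> nat \<Rightarrow> (nat \<Rightarrow> real \<Rightarrow> 'a \<Rightarrow> real) \<Rightarrow> real \<Rightarrow> nat \<Rightarrow> real \<times> real
      \<Rightarrow> (nat \<Rightarrow> real) measure" where
  "obs_law M m B h N = (\<lambda>(\<theta>, a2). distr M (obs_space N)
     (\<lambda>\<omega>. \<lambda>i\<in>{..<N}. Z_process m B \<theta> (sqrt a2) (grid h (Suc i)) \<omega>))"

definition T_vec :: "real \<Rightarrow> nat \<Rightarrow> real Matrix.vec" where
  "T_vec h N = Matrix.vec N (\<lambda>i. grid h (Suc i))"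

definition Gamma_fbm :: "real \<Rightarrow> nat \<Rightarrow> real \<Rightarrow> real Matrix.mat" where
  "Gamma_fbm h N H =
     Matrix.mat N N (\<lambda>(i, j). fbm_cov H (grid h (Suc i)) (grid h (Suc j)))"

definition Gamma_sum :: "nat \<Rightarrow> (nat \<Rightarrow> real) \<Rightarrow> real \<Rightarrow> nat \<Rightarrow> real Matrix.mat" where
  "Gamma_sum m H h N = Matrix.mat N N (\<lambda>(i, j). \<Sum>r=1..m. Gamma_fbm h N (H r) $$ (i, j))"

text \<open>\<open>Gamma_form m H h N x y\<close> is the bilinear form of the inverse of \<open>Gamma_sum m H h N\<close>;
  this matrix is positive definite for \<open>h > 0\<close>, \<open>m \<ge> 1\<close> and Hurst parameters in \<open>(0, 1)\<close>.\<close>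
definition Gamma_form ::
    "nat \<Rightarrow> (nat \<Rightarrow> real) \<Rightarrow> real \<Rightarrow> nat \<Rightarrow> real Matrix.vec \<Rightarrow> real Matrix.vec \<Rightarrow> real" where
  "Gamma_form m H h N x y = scalar_prod x (the (mat_inverse (Gamma_sum m H h N)) *\<^sub>v y)"

definition d_N :: "nat \<Rightarrow> (nat \<Rightarrow> real) \<Rightarrow> real \<Rightarrow> nat \<Rightarrow> real" where
  "d_N m H h N = Gamma_form m H h N (T_vec h N) (T_vec h N)"

definition theta_hat ::
    "nat \<Rightarrow> (nat \<Rightarrow> real) \<Rightarrow> real \<Rightarrow> nat \<Rightarrow> (nat \<Rightarrow> real) \<Rightarrow> real" where
  "theta_hat m H h N z = Gamma_form m H h N (T_vec h N) (Matrix.vec N z) / d_N m H h N"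

definition alpha2_hat ::
    "nat \<Rightarrow> (nat \<Rightarrow> real) \<Rightarrow> real \<Rightarrow> nat \<Rightarrow> (nat \<Rightarrow> real) \<Rightarrow> real" where
  "alpha2_hat m H h N z =
     (Gamma_form m H h N (Matrix.vec N z) (Matrix.vec N z)
        - (Gamma_form m H h N (T_vec h N) (Matrix.vec N z))\<^sup>2 / d_N m H h N) / real N"

definition alpha_tilde ::
    "nat \<Rightarrow> (nat \<Rightarrow> real) \<Rightarrow> real \<Rightarrow> nat \<Rightarrow> (nat \<Rightarrow> real) \<Rightarrow> real" where
  "alpha_tilde m H h N z = sqrt (real N / (real N - 1) * alpha2_hat m H h N z)"

section \<open>Quantiles of the chi-square and Student laws\<close>

definition quantile :: "real measure \<Rightarrow> real \<Rightarrow> real" where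
  "quantile \<mu> p = Inf {x. p \<le> cdf \<mu> x}"

definition chi_square_law :: "nat \<Rightarrow> real measure" where
  "chi_square_law k =
     distr (\<Pi>\<^sub>M i\<in>{..<k}. normal_law 0 1) borel (\<lambda>w. \<Sum>i<k. (w i)\<^sup>2)"

text \<open>Coordinate \<open>k\<close> is the numerator, coordinates below \<open>k\<close> form the independent chi-square.\<close>
definition student_law :: "nat \<Rightarrow> real measure" where
  "student_law k =
     distr (\<Pi>\<^sub>M i\<in>{..k}. normal_law 0 1) borel
       (\<lambda>w. w k / sqrt ((\<Sum>i<k. (w i)\<^sup>2) / real k))"

section \<open>Tests\<close>

text \<open>Tests are randomized; a rejection region is identified with its indicator function.\<close>

definition is_test :: "'x measure \<Rightarrow> ('x \<Rightarrow> real) \<Rightarrow> bool" where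
  "is_test S \<phi> \<longleftrightarrow> \<phi> \<in> borel_measurable S \<and> (\<forall>x\<in>space S. 0 \<le> \<phi> x \<and> \<phi> x \<le> 1)"

definition power_fn :: "('p \<Rightarrow> 'x measure) \<Rightarrow> ('x \<Rightarrow> real) \<Rightarrow> 'p \<Rightarrow> real" where
  "power_fn P \<phi> p = (\<integral>x. \<phi> x \<partial>P p)"

definition unbiased_level_test ::
    "'x measure \<Rightarrow> ('p \<Rightarrow> 'x measure) \<Rightarrow> 'p set \<Rightarrow> 'p set \<Rightarrow> real \<Rightarrow> ('x \<Rightarrow> real) \<Rightarrow> bool" where
  "unbiased_level_test S P \<Theta>\<^sub>0 \<Theta>\<^sub>1 \<beta> \<phi> \<longleftrightarrow>
     is_test S \<phi> \<and> (\<forall>p\<in>\<Theta>\<^sub>0. power_fn P \<phi> p \<le> \<beta>) \<and> (\<forall>p\<in>\<Theta>\<^sub>1. \<beta> \<le> power_fn P \<phi> p)"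

definition UMP_unbiased ::
    "'x measure \<Rightarrow> ('p \<Rightarrow> 'x measure) \<Rightarrow> 'p set \<Rightarrow> 'p set \<Rightarrow> real \<Rightarrow> ('x \<Rightarrow> real) \<Rightarrow> bool" where
  "UMP_unbiased S P \<Theta>\<^sub>0 \<Theta>\<^sub>1 \<beta> \<phi> \<longleftrightarrow>
     unbiased_level_test S P \<Theta>\<^sub>0 \<Theta>\<^sub>1 \<beta> \<phi> \<and>
     (\<forall>\<psi>. unbiased_level_test S P \<Theta>\<^sub>0 \<Theta>\<^sub>1 \<beta> \<psi> \<longrightarrow> (\<forall>p\<in>\<Theta>\<^sub>1. power_fn P \<psi> p \<le> power_fn P \<phi> p))"

definition t_test_region ::
    "nat \<Rightarrow> (nat \<Rightarrow> real) \<Rightarrow> real \<Rightarrow> nat \<Rightarrow> real \<Rightarrow> real \<Rightarrow> (nat \<Rightarrow> real) set" where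
  "t_test_region m H h N \<beta> \<theta>\<^sub>0 = {z \<in> space (obs_space N).
     \<bar>sqrt (d_N m H h N) * (theta_hat m H h N z - \<theta>\<^sub>0) / alpha_tilde m H h N z\<bar>
       > quantile (student_law (N - 1)) (1 - \<beta> / 2)}"

definition chi_square_test_region ::
    "nat \<Rightarrow> (nat \<Rightarrow> real) \<Rightarrow> real \<Rightarrow> nat \<Rightarrow> real \<Rightarrow> real \<Rightarrow> (nat \<Rightarrow> real) set" where
  "chi_square_test_region m H h N \<beta> \<alpha>\<^sub>0 = {z \<in> space (obs_space N).
     real N * alpha2_hat m H h N z / \<alpha>\<^sub>0\<^sup>2 \<notin>
       {quantile (chi_square_law (N - 1)) (\<beta> / 2)..quantile (chi_square_law (N - 1)) (1 - \<beta> / 2)}}"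

end

theory Submission
  imports Defs "Jordan_Normal_Form.Determinant"
begin

text \<open>
  The matrix \<open>\<Gamma>\<close> is positive definite because
  \<open>\<bar>t\<bar>\<^sup>2\<^sup>H\<close> is a multiple of
  \<open>\<integral> (1 - cos (t x)) x\<^sup>-\<^sup>1\<^sup>-\<^sup>2\<^sup>H dx\<close>. In a basis that is orthonormal
  for the form of \<open>\<Gamma>\<^sup>-\<^sup>1\<close> and whose last vector is proportional to \<open>T\<close>, the observation
  becomes \<open>\<alpha> w + \<theta> \<surd>d e\<close> with \<open>w\<close> standard normal and \<open>e\<close> the last unit vector; both test
  statistics turn into the ones that define the Student and chi-square laws.

  For optimality put \<open>u\<close> for the last coordinate (centred at \<open>\<theta>\<^sub>0\<close>) and \<open>q\<close> for the squared norm.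
  An unbiased test \<open>\<psi>\<close> satisfies \<open>\<integral> (\<psi> - \<beta>) exp (- s q) = 0\<close> and
  \<open>\<integral> (\<psi> - \<beta>) u exp (- s q) = 0\<close> for all \<open>s > 0\<close>, hence, by differentiation in \<open>s\<close>, the same
  identities with an additional factor \<open>q\<^sup>n\<close>. The Student test \<open>\<phi>\<close> rejects for \<open>\<bar>u\<bar> > c \<surd>q\<close>, that
  is, where \<open>exp (a u)\<close> exceeds its chord \<open>k\<^sub>0 + k\<^sub>1 u\<close> over \<open>[- c \<surd>q, c \<surd>q]\<close>. Since \<open>k\<^sub>0\<close> and
  \<open>k\<^sub>1\<close> are power series in \<open>q\<close>, integrating \<open>(\<phi> - \<psi>) (exp (a u) - k\<^sub>0 - k\<^sub>1 u) \<ge> 0\<close> shows that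
  \<open>\<phi>\<close> is at least as powerful as \<open>\<psi>\<close>. This replaces completeness of the sufficient statistic
  and conditional distributions.
\<close>

section \<open>Positive definiteness of the fractional covariance\<close>

text \<open>Up to a positive constant, the density of the whitened observation is
  \<open>exp (a * u) * exp (- s * q)\<close> with \<open>s = 1 / (2 * \<alpha>\<^sup>2)\<close> and
  \<open>a = \<delta> / \<alpha>\<^sup>2\<close>, where \<delta> is the shift of the last
  coordinate. The pair (a, s) varies freely, and the null hypothesis is the line a = 0. For fixed s
  the weighted integral of \<psi> - \<beta> is at most 0 at a = 0 and at least 0 elsewhere, so a = 0
  is a minimum with value 0: this yields both identities. Freedom in s is what brings in the powers
  of q. They suffice because cosh is even and sinh is odd, so that
  \<open>cosh (a * c * sqrt q)\<close> and \<open>sinh (a * c * sqrt q) / sqrt q\<close> contain no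
  square root of q when expanded. Growth of order exp (C sqrt q) is beaten by exp (- s q) for every
  s > 0, which justifies each exchange of limit and integral. A separate obstacle is the joint law
  of the whitened noise: the Gaussian hypothesis speaks of linear combinations only. The joint law
  is obtained from one-dimensional uniqueness of characteristic functions, one coordinate at a
  time.\<close>

lemma one_minus_cos_kernel_integrable:
  fixes H t :: real
  assumes H: "0 < H" "H < 1"
  shows "set_integrable lborel {0<..} (\<lambda>x. (1 - cos (t * x)) * x powr (-1 - 2 * H))"
proof -
  let ?f = "\<lambda>x. (1 - cos (t * x)) * x powr (-1 - 2 * H)"
  have m: "?f \<in> borel_measurable borel" by measurable
  \<comment> \<open>Near 0 the kernel is of order \<open>x powr (1 - 2 * H)\<close>, integrable
    since H < 1; at infinity it is of order \<open>x powr (-1 - 2 * H)\<close>, integrable since H >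
    0. Hence the split at 1.\<close>
  have "(\<lambda>x::real. x powr (1 - 2 * H)) absolutely_integrable_on {0..1}"
    using H by (subst absolutely_integrable_on_iff_nonneg) (auto intro!: integrable_on_powr_from_0)
  then have i0: "set_integrable lebesgue {0..1} (\<lambda>x::real. x powr (1 - 2 * H))" .
  then have 1: "set_integrable lborel {0..1} (\<lambda>x::real. x powr (1 - 2 * H))"
    unfolding set_integrable_def by (subst (asm) integrable_completion) auto
  have "(\<lambda>x::real. x powr (-1 - 2 * H)) absolutely_integrable_on {1..}"
    using H by (subst absolutely_integrable_on_iff_nonneg)
      (auto simp: integrable_on_def intro!: exI has_integral_powr_to_inf)
  then have 2: "set_integrable lborel {1..} (\<lambda>x::real. x powr (-1 - 2 * H))"
    unfolding set_integrable_def by (subst (asm) integrable_completion) auto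
  have A: "set_integrable lborel {0<..1} ?f"
  proof (rule set_integrable_bound)
    show "set_integrable lborel {0<..1} (\<lambda>x. t\<^sup>2 / 2 * x powr (1 - 2 * H))"
      by (rule set_integrable_mult_right, rule set_integrable_subset[OF 1]) auto
    show "AE x in lborel. x \<in> {0<..1} \<longrightarrow> norm (?f x) \<le> norm (t\<^sup>2 / 2 * x powr (1 - 2 * H))"
    proof (intro AE_I2 impI)
      fix x :: real assume x: "x \<in> {0<..1}"
      have "1 - cos (t * x) = 2 * (sin (t * x / 2))\<^sup>2"
        using cos_double_sin[of "t * x / 2"] by simp
      also have "\<dots> \<le> 2 * (t * x / 2)\<^sup>2"
      proof -
        have "\<bar>sin (t * x / 2)\<bar>\<^sup>2 \<le> \<bar>t * x / 2\<bar>\<^sup>2"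
          by (rule power_mono[OF abs_sin_x_le_abs_x]) simp
        then show ?thesis by (simp only: power2_abs mult_left_mono zero_le_numeral)
      qed
      finally have "1 - cos (t * x) \<le> t\<^sup>2 / 2 * x\<^sup>2" by (simp add: power2_eq_square)
      then have "?f x \<le> t\<^sup>2 / 2 * x\<^sup>2 * x powr (-1 - 2 * H)"
        by (intro mult_right_mono) auto
      also have "\<dots> = t\<^sup>2 / 2 * x powr (1 - 2 * H)"
      proof -
        have "x powr (1 - 2 * H) = x powr (2 + (-1 - 2 * H))" by simp
        also have "\<dots> = x powr 2 * x powr (-1 - 2 * H)" by (rule powr_add)
        also have "x powr 2 = x\<^sup>2" using x by simp
        finally show ?thesis by simp
      qed
      finally show "norm (?f x) \<le> norm (t\<^sup>2 / 2 * x powr (1 - 2 * H))"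
        by (simp add: abs_mult)
    qed
  qed (use m in \<open>auto simp: set_borel_measurable_def\<close>)
  have B: "set_integrable lborel {1..} ?f"
  proof (rule set_integrable_bound)
    show "set_integrable lborel {1..} (\<lambda>x. 2 * x powr (-1 - 2 * H))"
      using 2 by auto
    show "AE x in lborel. x \<in> {1..} \<longrightarrow> norm (?f x) \<le> norm (2 * x powr (-1 - 2 * H))"
    proof (intro AE_I2 impI)
      fix x :: real
      have "?f x \<le> 2 * x powr (-1 - 2 * H)"
        using cos_ge_minus_one[of "t * x"] by (intro mult_right_mono) auto
      then show "norm (?f x) \<le> norm (2 * x powr (-1 - 2 * H))" by (simp add: abs_mult)
    qed
  qed (use m in \<open>auto simp: set_borel_measurable_def\<close>)
  have "{0<..} = {0<..1} \<union> {1::real..}" by auto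
  then show ?thesis using set_integrable_Un[OF A B] by simp
qed

text \<open>The normalising constant of the spectral representation. It enters only through its
  sign.\<close>

definition fbm_kernel_const :: "real \<Rightarrow> real" where
  "fbm_kernel_const H = (LBINT x:{0<..}. (1 - cos x) * x powr (-1 - 2 * H))"

lemma fbm_kernel_const_nonneg: "0 \<le> fbm_kernel_const H"
  unfolding fbm_kernel_const_def set_lebesgue_integral_def
  by (intro integral_nonneg_AE AE_I2) (auto split: split_indicator)

text \<open>Homogeneity of the kernel: substituting \<open>x / \<bar>t\<bar>\<close> for x pulls out
  the power of |t|, and evenness of the cosine disposes of the sign of t.\<close>

lemma one_minus_cos_kernel_integral:
  fixes H t :: real
  assumes "H \<noteq> 0"
  shows "(LBINT x:{0<..}. (1 - cos (t * x)) * x powr (-1 - 2 * H)) = \<bar>t\<bar> powr (2 * H) * fbm_kernel_const H"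
proof (cases "t = 0")
  case True then show ?thesis using assms by simp
next
  case False
  let ?a = "\<bar>t\<bar>"
  have a: "?a > 0" using False by simp
  let ?f = "\<lambda>x. indicator {0<..} x *\<^sub>R ((1 - cos (t * x)) * x powr (-1 - 2 * H))"
  have ca: "cos (t * x) = cos (?a * x)" for x by (cases "t \<ge> 0") auto
  have "(LBINT x:{0<..}. (1 - cos (t * x)) * x powr (-1 - 2 * H)) = (\<integral>x. ?f x \<partial>lborel)"
    by (simp add: set_lebesgue_integral_def)
  also have "\<dots> = \<bar>1 / ?a\<bar> *\<^sub>R (\<integral>x. ?f (0 + 1 / ?a * x) \<partial>lborel)"
    by (rule lborel_integral_real_affine) (use False in auto)
  also have "(\<lambda>x. ?f (0 + 1 / ?a * x)) = (\<lambda>x. ?a powr (1 + 2 * H) * (indicator {0<..} x *\<^sub>R ((1 - cos x) * x powr (-1 - 2 * H))))"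
  proof
    fix x
    show "?f (0 + 1 / ?a * x) = ?a powr (1 + 2 * H) * (indicator {0<..} x *\<^sub>R ((1 - cos x) * x powr (-1 - 2 * H)))"
    proof (cases "x > 0")
      case True
      have "?a powr (-1 - 2 * H) * ?a powr (1 + 2 * H) = 1"
        using a by (simp add: powr_add[symmetric])
      then have "(x / ?a) powr (-1 - 2 * H) = x powr (-1 - 2 * H) * ?a powr (1 + 2 * H)"
        using True a by (simp add: powr_divide field_simps)
      then show ?thesis using True a ca[of "x / ?a"] by simp
    qed (use a in \<open>auto simp: zero_less_divide_iff\<close>)
  qed
  also have "\<bar>1 / ?a\<bar> *\<^sub>R (\<integral>x. ?a powr (1 + 2 * H) * (indicator {0<..} x *\<^sub>R ((1 - cos x) * x powr (-1 - 2 * H))) \<partial>lborel)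
      = ?a powr (2 * H) * fbm_kernel_const H"
    using a by (simp add: fbm_kernel_const_def set_lebesgue_integral_def powr_add)
  finally show ?thesis .
qed

lemma
  fixes f :: "'i \<Rightarrow> 'a \<Rightarrow> real"
  assumes "\<And>i. i \<in> I \<Longrightarrow> set_integrable M A (f i)"
  shows set_integrable_sum_family: "set_integrable M A (\<lambda>x. \<Sum>i\<in>I. f i x)"
    and set_integral_sum_family: "(LINT x:A|M. (\<Sum>i\<in>I. f i x)) = (\<Sum>i\<in>I. LINT x:A|M. f i x)"
  using assms
  by (auto simp: set_integrable_def set_lebesgue_integral_def sum_distrib_left)

text \<open>The bracket combines \<open>1 - cos\<close> exactly as \<open>fbm_cov\<close> combines
  the powers of |t|, so integration against the kernel turns a squared modulus into the covariance
  form.\<close>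

lemma cmod_sum_cis_minus_one_sq:
  fixes c s :: "'i \<Rightarrow> real"
  assumes "finite I"
  shows "(cmod (\<Sum>i\<in>I. of_real (c i) * (cis (s i) - 1)))\<^sup>2 =
    (\<Sum>i\<in>I. \<Sum>j\<in>I. c i * c j * ((1 - cos (s i)) + (1 - cos (s j)) - (1 - cos (s i - s j))))"
proof -
  have "(cmod (\<Sum>i\<in>I. of_real (c i) * (cis (s i) - 1)))\<^sup>2 =
     (\<Sum>i\<in>I. c i * (cos (s i) - 1))\<^sup>2 + (\<Sum>i\<in>I. c i * sin (s i))\<^sup>2"
    by (simp add: cmod_power2)
  also have "\<dots> = (\<Sum>i\<in>I. \<Sum>j\<in>I. (c i * (cos (s i) - 1)) * (c j * (cos (s j) - 1)) + (c i * sin (s i)) * (c j * sin (s j)))"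
    by (simp add: power2_eq_square sum_product sum.distrib)
  also have "\<dots> = (\<Sum>i\<in>I. \<Sum>j\<in>I. c i * c j * ((1 - cos (s i)) + (1 - cos (s j)) - (1 - cos (s i - s j))))"
    by (intro sum.cong refl) (simp add: cos_diff algebra_simps)
  finally show ?thesis .
qed

text \<open>The spectral representation of fractional Brownian motion: the quadratic form of the
  covariance becomes the integral of a nonnegative function.\<close>

lemma fbm_cov_integral:
  fixes c t :: "'i \<Rightarrow> real"
  assumes H: "0 < H" "H < 1" and fin: "finite I" and t: "\<And>i. i \<in> I \<Longrightarrow> 0 \<le> t i"
  defines "f \<equiv> \<lambda>x. (cmod (\<Sum>i\<in>I. of_real (c i) * (cis (t i * x) - 1)))\<^sup>2 * x powr (-1 - 2 * H)"
  shows "set_integrable lborel {0<..} f"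
    and "(LBINT x:{0<..}. f x) = 2 * fbm_kernel_const H * (\<Sum>i\<in>I. \<Sum>j\<in>I. c i * c j * fbm_cov H (t i) (t j))"
proof -
  let ?k = "\<lambda>s x. (1 - cos (s * x)) * x powr (-1 - 2 * H)"
  have f: "f = (\<lambda>x. \<Sum>i\<in>I. \<Sum>j\<in>I. c i * c j * (?k (t i) x + ?k (t j) x - ?k (t i - t j) x))"
    unfolding f_def cmod_sum_cis_minus_one_sq[OF fin]
    unfolding sum_distrib_right by (intro ext sum.cong refl) (simp only: left_diff_distrib distrib_right mult.assoc)
  note I = one_minus_cos_kernel_integrable[OF H]
  have J: "set_integrable lborel {0<..} (\<lambda>x. c i * c j * (?k (t i) x + ?k (t j) x - ?k (t i - t j) x))" for i j
    by (intro set_integrable_mult_right set_integral_diff set_integral_add I)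
  have K: "(LBINT x:{0<..}. ?k a x + ?k b x - ?k d x) =
      fbm_kernel_const H * (\<bar>a\<bar> powr (2 * H) + \<bar>b\<bar> powr (2 * H) - \<bar>d\<bar> powr (2 * H))" for a b d
  proof -
    have "(LBINT x:{0<..}. ?k a x + ?k b x - ?k d x) =
        (LBINT x:{0<..}. ?k a x) + (LBINT x:{0<..}. ?k b x) - (LBINT x:{0<..}. ?k d x)"
      using set_integral_diff(2)[OF set_integral_add(1)[OF I[of a] I[of b]] I[of d]] set_integral_add(2)[OF I[of a] I[of b]]
      by simp
    also have "\<dots> = fbm_kernel_const H * (\<bar>a\<bar> powr (2 * H) + \<bar>b\<bar> powr (2 * H) - \<bar>d\<bar> powr (2 * H))"
      using H by (simp only: one_minus_cos_kernel_integral) (simp add: ring_distribs)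
    finally show ?thesis .
  qed
  show "set_integrable lborel {0<..} f" 
    unfolding f by (intro set_integrable_sum_family J)
  have "(LBINT x:{0<..}. f x) = (\<Sum>i\<in>I. \<Sum>j\<in>I. (LBINT x:{0<..}. c i * c j * (?k (t i) x + ?k (t j) x - ?k (t i - t j) x)))"
    unfolding f
    by (subst set_integral_sum_family, intro set_integrable_sum_family J)
      (intro sum.cong refl set_integral_sum_family J)
  also have "\<dots> = (\<Sum>i\<in>I. \<Sum>j\<in>I. c i * c j * (fbm_kernel_const H * (\<bar>t i\<bar> powr (2 * H) + \<bar>t j\<bar> powr (2 * H) - \<bar>t i - t j\<bar> powr (2 * H))))"
    by (intro sum.cong refl) (simp only: set_integral_mult_right K)
  also have "\<dots> = 2 * fbm_kernel_const H * (\<Sum>i\<in>I. \<Sum>j\<in>I. c i * c j * fbm_cov H (t i) (t j))"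
    unfolding sum_distrib_left using t by (intro sum.cong refl) (simp add: fbm_cov_def)
  finally show "(LBINT x:{0<..}. f x) = 2 * fbm_kernel_const H * (\<Sum>i\<in>I. \<Sum>j\<in>I. c i * c j * fbm_cov H (t i) (t j))" .
qed

text \<open>On the grid the trigonometric sum is a polynomial in \<open>cis (h * x)\<close>, which has finitely many roots.\<close>
lemma grid_trig_sum_finite_zeros:
  fixes c :: "nat \<Rightarrow> real"
  assumes h: "h > 0" and c: "i0 < N" "c i0 \<noteq> 0"
  shows "finite {x\<in>{0<..<pi / h}. (\<Sum>i<N. of_real (c i) * (cis (grid h (Suc i) * x) - 1)) = 0}"
proof -
  define p :: "complex poly" where
    "p = (\<Sum>i<N. monom (of_real (c i)) (Suc i)) - [:(\<Sum>i<N. of_real (c i)):]"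
  \<comment> \<open>The grid starts at h, not at 0, so the exponents are at least 1 and the
    subtracted constant cannot cancel this coefficient.\<close>
  have "coeff p (Suc i0) = of_real (c i0)"
    using c by (simp add: p_def coeff_sum if_distrib sum.delta cong: if_cong)
  then have "p \<noteq> 0" using c by auto
  then have fin: "finite {z. poly p z = 0}" by (rule poly_roots_finite)
  have p: "poly p (cis (h * x)) = (\<Sum>i<N. of_real (c i) * (cis (grid h (Suc i) * x) - 1))" for x
  proof -
    have "cis (grid h (Suc i) * x) = cis (h * x) ^ Suc i" for i
      by (simp only: Complex.DeMoivre grid_def) (simp add: mult_ac)
    then show ?thesis
      by (simp add: p_def poly_sum poly_monom algebra_simps sum_subtractf sum_distrib_left)
  qed
  \<comment> \<open>On this interval the angle stays in (0, pi), where already the cosine is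
    injective.\<close>
  have "inj_on (\<lambda>x. cis (h * x)) {0<..<pi / h}"
  proof (rule inj_onI)
    fix x y assume xy: "x \<in> {0<..<pi / h}" "y \<in> {0<..<pi / h}" "cis (h * x) = cis (h * y)"
    then have "cos (h * x) = cos (h * y)" by (metis cis.sel(1))
    moreover have "0 \<le> h * x" "h * x \<le> pi" "0 \<le> h * y" "h * y \<le> pi"
      using xy h by (auto simp: field_simps)
    ultimately have "h * x = h * y" using cos_inj_pi by blast
    then show "x = y" using h by simp
  qed
  then have "inj_on (\<lambda>x. cis (h * x)) {x\<in>{0<..<pi / h}. poly p (cis (h * x)) = 0}"
    by (rule inj_on_subset) auto
  moreover have "(\<lambda>x. cis (h * x)) ` {x\<in>{0<..<pi / h}. poly p (cis (h * x)) = 0} \<subseteq> {z. poly p z = 0}"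
    by auto
  ultimately have "finite {x\<in>{0<..<pi / h}. poly p (cis (h * x)) = 0}"
    using fin by (blast intro: inj_on_finite)
  then show ?thesis by (simp only: p)
qed

text \<open>The integrand of the spectral representation has only finitely many zeros in
  \<open>{0<..<pi / h}\<close>. If its integral vanished, that whole interval would be a null
  set.\<close>

theorem fbm_cov_grid_pos_def:
  fixes c :: "nat \<Rightarrow> real"
  assumes H: "0 < H" "H < 1" and h: "h > 0" and c: "\<exists>i<N. c i \<noteq> 0"
  shows "0 < (\<Sum>i<N. \<Sum>j<N. c i * c j * fbm_cov H (grid h (Suc i)) (grid h (Suc j)))"
proof -
  define S where "S x = (\<Sum>i<N. of_real (c i) * (cis (grid h (Suc i) * x) - 1))" for x
  define f where "f x = (cmod (S x))\<^sup>2 * x powr (-1 - 2 * H)" for x :: real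
  have g: "0 \<le> grid h (Suc i)" for i using h by (simp add: grid_def)
  have int: "set_integrable lborel {0<..} f"
    and eq: "(LBINT x:{0<..}. f x) = 2 * fbm_kernel_const H *
      (\<Sum>i<N. \<Sum>j<N. c i * c j * fbm_cov H (grid h (Suc i)) (grid h (Suc j)))"
    unfolding f_def S_def by (rule fbm_cov_integral[OF H finite_lessThan g])+
  have nn: "0 \<le> indicator {0<..} x *\<^sub>R f x" for x by (simp add: f_def)
  have "(LBINT x:{0<..}. f x) \<noteq> 0"
  proof
    assume "(LBINT x:{0<..}. f x) = 0"
    then have "AE x in lborel. indicator {0<..} x *\<^sub>R f x = 0"
      unfolding set_lebesgue_integral_def
      by (subst (asm) integral_nonneg_eq_0_iff_AE) (use int nn in \<open>auto simp: set_integrable_def\<close>)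
    moreover obtain i0 where "i0 < N" "c i0 \<noteq> 0" using c by blast
    then have "finite {x\<in>{0<..<pi / h}. S x = 0}"
      unfolding S_def by (rule grid_trig_sum_finite_zeros[OF h])
    then have "{x\<in>{0<..<pi / h}. S x = 0} \<in> null_sets lborel"
      by (rule finite_imp_null_set_lborel)
    then have "AE x in lborel. x \<notin> {x\<in>{0<..<pi / h}. S x = 0}" by (rule AE_not_in)
    ultimately have "AE x in lborel. x \<notin> {0<..<pi / h}"
      by eventually_elim (auto simp: f_def)
    then have "emeasure lborel {0<..<pi / h} = 0"
      by (simp add: AE_iff_measurable[OF _ refl] del: not_less greaterThanLessThan_iff)
    then show False using h by simp
  qed
  moreover have "0 \<le> (LBINT x:{0<..}. f x)"
    unfolding set_lebesgue_integral_def by (intro integral_nonneg_AE AE_I2 nn)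
  ultimately have "0 < fbm_kernel_const H *
      (\<Sum>i<N. \<Sum>j<N. c i * c j * fbm_cov H (grid h (Suc i)) (grid h (Suc j)))"
    unfolding eq by (simp add: less_le)
  \<comment> \<open>The constant is known only to be nonnegative; positivity of the product excludes
    0 and leaves a positive form.\<close>
  then show ?thesis using fbm_kernel_const_nonneg[of H] by (simp add: zero_less_mult_iff)
qed

section \<open>Whitening\<close>

lemma scalar_prod_mult_mat_vec_symmetric:
  fixes G :: "real mat"
  assumes "G \<in> carrier_mat n n" "transpose_mat G = G" "x \<in> carrier_vec n" "y \<in> carrier_vec n"
  shows "x \<bullet> (G *\<^sub>v y) = y \<bullet> (G *\<^sub>v x)"
proof -
  have "(transpose_mat G *\<^sub>v x) \<bullet> y = x \<bullet> (G *\<^sub>v y)"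
    using assms by (intro transpose_vec_mult_scalar) auto
  then have "x \<bullet> (G *\<^sub>v y) = (G *\<^sub>v x) \<bullet> y" using assms by simp
  also have "\<dots> = y \<bullet> (G *\<^sub>v x)" using assms by (intro comm_scalar_prod) auto
  finally show ?thesis .
qed

lemma mult_mat_vec_zero:
  fixes A :: "real mat"
  shows "A \<in> carrier_mat n n \<Longrightarrow> A *\<^sub>v 0\<^sub>v n = 0\<^sub>v n"
  by (intro eq_vecI) (auto simp: scalar_prod_def)

text \<open>Extension by a determinant argument instead of projections: the matrix with rows
  \<open>G *\<^sub>v e i\<close> still has a zero row, hence a nonzero kernel vector, and that
  vector is orthogonal to the family built so far.\<close>

lemma orthonormal_family_exists:
  fixes G :: "real mat"
  assumes G: "G \<in> carrier_mat n n" "transpose_mat G = G"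
    and pd: "\<And>v. v \<in> carrier_vec n \<Longrightarrow> v \<noteq> 0\<^sub>v n \<Longrightarrow> 0 < v \<bullet> (G *\<^sub>v v)"
    and t: "t \<in> carrier_vec n" "t \<noteq> 0\<^sub>v n" and k: "Suc k \<le> n"
  shows "\<exists>e. e 0 = (1 / sqrt (t \<bullet> (G *\<^sub>v t))) \<cdot>\<^sub>v t \<and> (\<forall>i\<le>k. e i \<in> carrier_vec n) \<and>
    (\<forall>i\<le>k. \<forall>j\<le>k. e i \<bullet> (G *\<^sub>v e j) = (if i = j then 1 else 0))"
proof -
  have nrm: "((1 / sqrt (v \<bullet> (G *\<^sub>v v))) \<cdot>\<^sub>v v) \<bullet> (G *\<^sub>v ((1 / sqrt (v \<bullet> (G *\<^sub>v v))) \<cdot>\<^sub>v v)) = 1"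
    if v: "v \<in> carrier_vec n" "v \<noteq> 0\<^sub>v n" for v
  proof -
    have [simp]: "G *\<^sub>v v \<in> carrier_vec n" using G v by auto
    show ?thesis using pd[OF v] v G(1) by (simp add: mult_mat_vec divide_simps)
  qed
  show ?thesis
    using k
  proof (induction k)
    case 0
    show ?case using nrm[OF t] t by (intro exI[of _ "\<lambda>_. (1 / sqrt (t \<bullet> (G *\<^sub>v t))) \<cdot>\<^sub>v t"]) auto
  next
    case (Suc k)
    then obtain e where e0: "e 0 = (1 / sqrt (t \<bullet> (G *\<^sub>v t))) \<cdot>\<^sub>v t"
      and ec: "\<And>i. i \<le> k \<Longrightarrow> e i \<in> carrier_vec n"
      and eo: "\<And>i j. i \<le> k \<Longrightarrow> j \<le> k \<Longrightarrow> e i \<bullet> (G *\<^sub>v e j) = (if i = j then 1 else 0)"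
      by auto
    define c where "c i = (if i \<le> k then G *\<^sub>v e i else 0\<^sub>v n)" for i
    have c: "c i \<in> carrier_vec n" for i using G ec by (auto simp: c_def)
    define A where "A = mat\<^sub>r n n c"
    have A: "A \<in> carrier_mat n n" by (simp add: A_def)
    have "A = mat\<^sub>r n n (\<lambda>i. if i = Suc k then 0\<^sub>v n else c i)"
      unfolding A_def by (intro arg_cong[where f = "mat\<^sub>r n n"] ext) (simp add: c_def)
    then have "Determinant.det A = 0"
      using det_row_0[of "Suc k" n c] Suc.prems c by auto
    then obtain v where v: "v \<in> carrier_vec n" "v \<noteq> 0\<^sub>v n" "A *\<^sub>v v = 0\<^sub>v n"
      using det_0_iff_vec_prod_zero[OF A] by blast
    have orth: "e i \<bullet> (G *\<^sub>v v) = 0" if i: "i \<le> k" for i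
    proof -
      have "(A *\<^sub>v v) $ i = row A i \<bullet> v" using i Suc.prems A by simp
      also have "row A i = G *\<^sub>v e i"
        using i Suc.prems c[of i] by (simp add: A_def) (simp add: c_def)
      finally have "0 = (G *\<^sub>v e i) \<bullet> v" using v i Suc.prems by simp
      also have "\<dots> = v \<bullet> (G *\<^sub>v e i)" using v G ec[OF i] by (intro comm_scalar_prod) auto
      also have "\<dots> = e i \<bullet> (G *\<^sub>v v)"
        by (rule scalar_prod_mult_mat_vec_symmetric[OF G v(1) ec[OF i]])
      finally show ?thesis by simp
    qed
    define w where "w = (1 / sqrt (v \<bullet> (G *\<^sub>v v))) \<cdot>\<^sub>v v"
    have w: "w \<in> carrier_vec n" "w \<bullet> (G *\<^sub>v w) = 1" using nrm[OF v(1,2)] v by (auto simp: w_def)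
    have Gv: "G *\<^sub>v v \<in> carrier_vec n" using G v by auto
    have o1: "e i \<bullet> (G *\<^sub>v w) = 0" if "i \<le> k" for i
      using orth[OF that] ec[OF that] v Gv G(1) by (simp add: w_def mult_mat_vec)
    have o2: "w \<bullet> (G *\<^sub>v e i) = 0" if "i \<le> k" for i
      using scalar_prod_mult_mat_vec_symmetric[OF G w(1) ec[OF that]] o1[OF that] by simp
    show ?case
      by (rule exI[of _ "e(Suc k := w)"]) (use e0 ec eo w o1 o2 in \<open>auto simp: le_Suc_eq\<close>)
  qed
qed

lemma scalar_prod_mult_mat_vec_transpose:
  fixes A :: "real mat"
  assumes "A \<in> carrier_mat n n" "x \<in> carrier_vec n" "y \<in> carrier_vec n"
  shows "(A *\<^sub>v x) \<bullet> y = x \<bullet> (transpose_mat A *\<^sub>v y)"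
  using transpose_vec_mult_scalar[of "transpose_mat A" n n y x] assms by simp

text \<open>The rows of \<open>A\<close> are the coordinate functionals of a basis, orthonormal for the form of
  the inverse of \<open>C\<close>, whose last member is the normalisation of \<open>t\<close>.\<close>
theorem whitening_matrix_exists:
  fixes C :: "real mat"
  assumes C: "C \<in> carrier_mat n n" "transpose_mat C = C"
    and pd: "\<And>v. v \<in> carrier_vec n \<Longrightarrow> v \<noteq> 0\<^sub>v n \<Longrightarrow> 0 < v \<bullet> (C *\<^sub>v v)"
    and t: "t \<in> carrier_vec n" "t \<noteq> 0\<^sub>v n" and n: "0 < n"
  defines "G \<equiv> the (mat_inverse C)"
  obtains A E where "A \<in> carrier_mat n n" "E \<in> carrier_mat n n" "A * E = 1\<^sub>m n" "E * A = 1\<^sub>m n"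
    "\<And>x y. x \<in> carrier_vec n \<Longrightarrow> y \<in> carrier_vec n \<Longrightarrow> x \<bullet> (G *\<^sub>v y) = (A *\<^sub>v x) \<bullet> (A *\<^sub>v y)"
    "A *\<^sub>v t = sqrt (t \<bullet> (G *\<^sub>v t)) \<cdot>\<^sub>v unit_vec n (n - 1)"
    "A * C * transpose_mat A = 1\<^sub>m n" "0 < t \<bullet> (G *\<^sub>v t)"
proof -
  have "Determinant.det C \<noteq> 0"
  proof
    assume "Determinant.det C = 0"
    then obtain v where "v \<in> carrier_vec n" "v \<noteq> 0\<^sub>v n" "C *\<^sub>v v = 0\<^sub>v n"
      using det_0_iff_vec_prod_zero[OF C(1)] by blast
    then show False using pd[of v] by simp
  qed
  then obtain Ci where "Ci \<in> carrier_mat n n" "Ci * C = 1\<^sub>m n" "C * Ci = 1\<^sub>m n"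
    using det_non_zero_imp_unit[OF C(1), of "()"] by (auto simp: Units_def ring_mat_def)
  then have "C \<in> Units (ring_mat TYPE(real) n ())" using C(1) by (auto simp: Units_def ring_mat_def)
  then obtain G' where "mat_inverse C = Some G'" using mat_inverse(1)[OF C(1)] by fastforce
  with mat_inverse(2)[OF C(1) this] have G: "G \<in> carrier_mat n n" "C * G = 1\<^sub>m n" "G * C = 1\<^sub>m n"
    by (auto simp: G_def)
  have Gt: "transpose_mat G = G"
  proof -
    have 1: "transpose_mat G * C = 1\<^sub>m n"
      using arg_cong[OF G(2), of transpose_mat] by (simp add: transpose_mult[OF C(1) G(1)] C(2))
    have "transpose_mat G = transpose_mat G * (C * G)" using G by simp
    also have "\<dots> = G" using 1 G C by (subst assoc_mult_mat[symmetric, of _ n n _ n _ n]) auto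
    finally show ?thesis .
  qed
  have Gpd: "0 < v \<bullet> (G *\<^sub>v v)" if v: "v \<in> carrier_vec n" "v \<noteq> 0\<^sub>v n" for v
  proof -
    have Gv: "G *\<^sub>v v \<in> carrier_vec n" using G v by auto
    have id: "C *\<^sub>v (G *\<^sub>v v) = v"
      using G C v by (subst assoc_mult_mat_vec[symmetric, of _ n n _ n]) auto
    then have "G *\<^sub>v v \<noteq> 0\<^sub>v n" using v mult_mat_vec_zero[OF C(1)] by auto
    then have "0 < (G *\<^sub>v v) \<bullet> (C *\<^sub>v (G *\<^sub>v v))" by (rule pd[OF Gv])
    also have "\<dots> = v \<bullet> (G *\<^sub>v v)" unfolding id by (rule comm_scalar_prod[OF Gv v(1)])
    finally show ?thesis .
  qed
  define d where "d = t \<bullet> (G *\<^sub>v t)"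
  have d: "0 < d" unfolding d_def by (rule Gpd[OF t])
  obtain e where e0: "e 0 = (1 / sqrt d) \<cdot>\<^sub>v t"
    and ec: "\<And>i. i \<le> n - 1 \<Longrightarrow> e i \<in> carrier_vec n"
    and eo: "\<And>i j. i \<le> n - 1 \<Longrightarrow> j \<le> n - 1 \<Longrightarrow> e i \<bullet> (G *\<^sub>v e j) = (if i = j then 1 else 0)"
    using orthonormal_family_exists[OF G(1) Gt Gpd t, of "n - 1"] n unfolding d_def by auto
  \<comment> \<open>Reversal moves the normalised t from index 0 to the last index, the place of the
    numerator in \<open>student_law\<close>.\<close>
  define f where "f i = e (n - 1 - i)" for i
  have f: "f i \<in> carrier_vec n" for i unfolding f_def by (rule ec) simp
  have fo: "f i \<bullet> (G *\<^sub>v f j) = (if i = j then 1 else 0)" if "i < n" "j < n" for i j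
    unfolding f_def using that by (subst eo) auto
  define A where "A = mat\<^sub>r n n (\<lambda>i. G *\<^sub>v f i)"
  define E where "E = mat_of_cols n (map f [0..<n])"
  have A: "A \<in> carrier_mat n n" and E: "E \<in> carrier_mat n n" 
    using mat_of_cols_carrier(1)[of n "map f [0..<n]"] by (simp_all add: A_def E_def)
  have rowA: "row A i = G *\<^sub>v f i" if "i < n" for i using that G(1) f[of i] by (simp add: A_def)
  have colE: "col E i = f i" if "i < n" for i using that f by (simp add: E_def)
  have AE: "A * E = 1\<^sub>m n"
  proof (rule eq_matI)
    fix i j assume "i < dim_row (1\<^sub>m n)" "j < dim_col (1\<^sub>m n)"
    then have ij: "i < n" "j < n" by auto
    have "(A * E) $$ (i, j) = (G *\<^sub>v f i) \<bullet> f j" using ij A E by (simp add: rowA colE)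
    also have "\<dots> = f j \<bullet> (G *\<^sub>v f i)" using G f by (intro comm_scalar_prod) auto
    finally show "(A * E) $$ (i, j) = 1\<^sub>m n $$ (i, j)" using ij by (simp add: fo)
  qed (use A E in auto)
  then have EA: "E * A = 1\<^sub>m n" by (rule mat_mult_left_right_inverse[OF A E])
  have A_eq: "A = transpose_mat E * G"
  proof (rule eq_matI)
    fix i j assume "i < dim_row (transpose_mat E * G)" "j < dim_col (transpose_mat E * G)"
    then have ij: "i < n" "j < n" using E G by auto
    have "A $$ (i, j) = (G *\<^sub>v f i) $ j" using ij A rowA[OF ij(1)] by (metis index_row(1) carrier_matD)
    also have "\<dots> = row G j \<bullet> f i" using ij G by simp
    also have "row G j = col G j" using Gt ij G by (metis carrier_matD(2) row_transpose)
    also have "col G j \<bullet> f i = f i \<bullet> col G j"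
      by (rule comm_scalar_prod[OF _ f]) (use G in \<open>auto intro: col_carrier_vec\<close>)
    also have "\<dots> = (transpose_mat E * G) $$ (i, j)" using ij E G by (simp add: colE)
    finally show "A $$ (i, j) = (transpose_mat E * G) $$ (i, j)" .
  qed (use A E G in auto)
  have G_eq: "G = transpose_mat A * A"
  proof -
    have "transpose_mat A * transpose_mat E = 1\<^sub>m n"
      using EA by (simp add: transpose_mult[OF E A, symmetric])
    then have "transpose_mat A * transpose_mat E * G = G" using G by simp
    then show ?thesis
      using A E G assoc_mult_mat[of "transpose_mat A" n n "transpose_mat E" n G n] A_eq by auto
  qed
  have form: "x \<bullet> (G *\<^sub>v y) = (A *\<^sub>v x) \<bullet> (A *\<^sub>v y)" if "x \<in> carrier_vec n" "y \<in> carrier_vec n" for x y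
  proof -
    have "G *\<^sub>v y = transpose_mat A *\<^sub>v (A *\<^sub>v y)"
      unfolding G_eq using A that by (subst assoc_mult_mat_vec[of _ n n _ n]) auto
    then show ?thesis
      using scalar_prod_mult_mat_vec_transpose[OF A that(1), of "A *\<^sub>v y"] A that by auto
  qed
  have At: "A *\<^sub>v t = sqrt d \<cdot>\<^sub>v unit_vec n (n - 1)"
  proof -
    have tE: "t = sqrt d \<cdot>\<^sub>v (E *\<^sub>v unit_vec n (n - 1))"
    proof -
      have "E *\<^sub>v unit_vec n (n - 1) = col E (n - 1)" 
        using E n by (intro eq_vecI) auto
      also have "\<dots> = (1 / sqrt d) \<cdot>\<^sub>v t" using n by (simp add: colE f_def e0)
      finally show ?thesis using d t by (simp add: smult_smult_assoc)
    qed
    have "A *\<^sub>v t = sqrt d \<cdot>\<^sub>v (A *\<^sub>v (E *\<^sub>v unit_vec n (n - 1)))"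
      by (subst tE) (use A E in \<open>simp add: mult_mat_vec[of _ n n]\<close>)
    also have "A *\<^sub>v (E *\<^sub>v unit_vec n (n - 1)) = unit_vec n (n - 1)"
      using A E AE by (subst assoc_mult_mat_vec[symmetric, of _ n n _ n]) auto
    finally show ?thesis .
  qed
  \<comment> \<open>As \<open>A = transpose_mat E * G\<close> and G inverts C, the product
    \<open>A * C\<close> is \<open>transpose_mat E\<close>. In probabilistic terms, A maps noise of
    covariance C to noise of identity covariance.\<close>
  have "A * C * transpose_mat A = 1\<^sub>m n"
  proof -
    have "A * C = transpose_mat E"
      unfolding A_eq using E G C by (subst assoc_mult_mat[of _ n n _ n _ n]) auto
    then show ?thesis using AE by (simp add: transpose_mult[OF A E, symmetric])
  qed
  with that[OF A E AE EA form] At d show ?thesis unfolding d_def by blast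
qed

section \<open>Uniqueness of the standard normal vector\<close>

lemma normal_law_standard: "normal_law 0 1 = std_normal_distribution"
  by (simp add: normal_law_def)

lemma (in prob_space) integral_iexp_weighted:
  fixes G Y :: "'a \<Rightarrow> real"
  assumes [measurable]: "G \<in> borel_measurable M" "Y \<in> borel_measurable M" and G: "\<And>x. \<bar>G x\<bar> \<le> C"
  shows "(CLINT x|M. of_real (G x) * iexp (Y x)) =
    Complex (\<integral>x. G x * cos (Y x) \<partial>M) (\<integral>x. G x * sin (Y x) \<partial>M)"
proof (rule complex_eqI)
  have i: "integrable M (\<lambda>x. of_real (G x) * iexp (Y x))"
    by (rule integrable_const_bound[where B = C]) (use G in \<open>auto simp: norm_mult\<close>)
  show "Re (CLINT x|M. of_real (G x) * iexp (Y x)) =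
      Re (Complex (\<integral>x. G x * cos (Y x) \<partial>M) (\<integral>x. G x * sin (Y x) \<partial>M))"
    using i by (simp add: integral_Re[symmetric] Re_exp)
  show "Im (CLINT x|M. of_real (G x) * iexp (Y x)) =
      Im (Complex (\<integral>x. G x * cos (Y x) \<partial>M) (\<integral>x. G x * sin (Y x) \<partial>M))"
    using i by (simp add: integral_Im[symmetric] Im_exp)
qed

text \<open>Tilting the measure by the positive weight \<open>2 + G\<close> leaves the characteristic function of
  \<open>X\<close> unchanged, so one-dimensional uniqueness applies.\<close>
lemma (in prob_space) uncorrelated_with_characters_imp_uncorrelated:
  fixes X G :: "'a \<Rightarrow> real"
  assumes X[measurable]: "X \<in> borel_measurable M" and Gm[measurable]: "G \<in> borel_measurable M"
    and G: "\<And>x. \<bar>G x\<bar> \<le> 1"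
    and c: "\<And>u. expectation (\<lambda>x. G x * cos (u * X x)) = expectation G * expectation (\<lambda>x. cos (u * X x))"
    and s: "\<And>u. expectation (\<lambda>x. G x * sin (u * X x)) = expectation G * expectation (\<lambda>x. sin (u * X x))"
    and A[measurable]: "A \<in> sets borel"
  shows "expectation (\<lambda>x. G x * indicator A (X x)) = expectation G * prob (X -` A \<inter> space M)"
proof -
  have bdd: "integrable M f" if "f \<in> borel_measurable M" "\<And>x. \<bar>f x\<bar> \<le> C" for f :: "'a \<Rightarrow> real" and C
    using that by (intro integrable_const_bound[where B = C]) auto
  have iG: "integrable M G" using G by (intro bdd) auto
  define m where "m = 2 + expectation G"
  have "\<bar>expectation G\<bar> \<le> expectation (\<lambda>x. \<bar>G x\<bar>)" by (rule integral_abs_bound)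
  also have "\<dots> \<le> expectation (\<lambda>_. 1)" using iG G by (intro integral_mono) auto
  finally have "\<bar>expectation G\<bar> \<le> 1" by (simp add: prob_space)
  then have m: "1 \<le> m" by (simp add: m_def)
  define w where "w x = (2 + G x) / m" for x
  have [measurable]: "w \<in> borel_measurable M" unfolding w_def by measurable
  have w0: "0 \<le> w x" for x using m G[of x] by (simp add: w_def)
  have iw: "integrable M w" unfolding w_def using iG by auto
  have w1: "expectation w = 1" unfolding w_def using iG m by (simp add: m_def prob_space)
  define M' where "M' = density M w"
  have M': "prob_space M'"
  proof
    have "emeasure M' (space M') = \<integral>\<^sup>+x. w x \<partial>M"
      unfolding M'_def by (simp add: emeasure_density nn_set_integral_space)
    also have "\<dots> = 1" using iw w0 w1 by (simp add: nn_integral_eq_integral)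
    finally show "emeasure M' (space M') = 1" .
  qed
  have dist: "real_distribution (distr M' borel X)"
    by (rule prob_space.real_distribution_distr[OF M']) (simp add: M'_def)
  have "char (distr M' borel X) = char (distr M borel X)"
  proof
    fix u
    \<comment> \<open>For f a cosine or sine of \<open>u * X\<close>, the hypotheses
      \<open>c\<close> and \<open>s\<close> turn the numerator into
      \<open>m * expectation f\<close>, so the tilt cancels.\<close>
    have e: "expectation (\<lambda>x. w x * f x) = (2 * expectation f + expectation (\<lambda>x. G x * f x)) / m"
      if f: "f \<in> borel_measurable M" "\<And>x. \<bar>f x\<bar> \<le> 1" for f
    proof -
      have 1: "integrable M f" by (rule bdd[OF f])
      have 2: "integrable M (\<lambda>x. G x * f x)"
        by (rule bdd[of _ 1]) (use f G in \<open>auto simp: abs_mult intro!: mult_le_one\<close>)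
      have "expectation (\<lambda>x. w x * f x) = expectation (\<lambda>x. 2 / m * f x + 1 / m * (G x * f x))"
        by (intro Bochner_Integration.integral_cong refl) (simp add: w_def add_divide_distrib algebra_simps)
      then show ?thesis using 1 2 by (simp add: add_divide_distrib)
    qed
    have "char (distr M' borel X) u = (CLINT x|M'. iexp (u * X x))"
      unfolding char_def by (subst integral_distr) (auto simp: M'_def)
    also have "\<dots> = (CLINT x|M. of_real (w x) * iexp (u * X x))"
      unfolding M'_def using w0 by (subst integral_density) (auto simp: scaleR_conv_of_real)
    also have "\<dots> = Complex (expectation (\<lambda>x. w x * cos (u * X x))) (expectation (\<lambda>x. w x * sin (u * X x)))"
    proof (rule integral_iexp_weighted)
      fix x show "\<bar>w x\<bar> \<le> 3" using m G[of x] by (simp add: w_def abs_le_iff divide_le_eq)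
    qed auto
    also have "\<dots> = Complex (expectation (\<lambda>x. cos (u * X x))) (expectation (\<lambda>x. sin (u * X x)))"
      using m by (simp add: e c s m_def divide_eq_eq algebra_simps)
    also have "\<dots> = (CLINT x|M. of_real 1 * iexp (u * X x))"
      by (subst integral_iexp_weighted[where C = 1]) auto
    also have "\<dots> = char (distr M borel X) u"
      unfolding char_def by (subst integral_distr) auto
    finally show "char (distr M' borel X) u = char (distr M borel X) u" .
  qed
  then have "distr M' borel X = distr M borel X"
    by (intro Levy_uniqueness dist real_distribution_distr X)
  then have "measure (distr M' borel X) A = measure (distr M borel X) A" by simp
  then have "measure M' (X -` A \<inter> space M) = prob (X -` A \<inter> space M)"
    by (simp add: measure_distr M'_def)
  moreover have "measure M' (X -` A \<inter> space M) = expectation (\<lambda>x. w x * indicator A (X x))"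
  proof -
    have "measure M' (X -` A \<inter> space M) = (\<integral>x. indicator (X -` A \<inter> space M) x \<partial>M')"
      by (simp add: M'_def)
    also have "\<dots> = expectation (\<lambda>x. w x * indicator (X -` A \<inter> space M) x)"
      unfolding M'_def using w0 by (subst integral_density) auto
    also have "\<dots> = expectation (\<lambda>x. w x * indicator A (X x))"
      by (intro Bochner_Integration.integral_cong refl) (auto split: split_indicator)
    finally show ?thesis .
  qed
  moreover have "expectation (\<lambda>x. w x * indicator A (X x)) =
      (2 * prob (X -` A \<inter> space M) + expectation (\<lambda>x. G x * indicator A (X x))) / m"
  proof -
    have 1: "integrable M (\<lambda>x. indicator A (X x) :: real)" by (rule bdd[of _ 1]) (auto split: split_indicator)
    have 2: "integrable M (\<lambda>x. G x * indicator A (X x) :: real)"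
      by (rule bdd[of _ 1]) (use G in \<open>auto split: split_indicator\<close>)
    have "expectation (\<lambda>x. w x * indicator A (X x)) =
        expectation (\<lambda>x. 2 / m * indicator A (X x) + 1 / m * (G x * indicator A (X x)))"
      by (intro Bochner_Integration.integral_cong refl) (simp add: w_def add_divide_distrib algebra_simps)
    moreover have "expectation (\<lambda>x. indicator A (X x) :: real) = expectation (indicator (X -` A \<inter> space M))"
      by (intro Bochner_Integration.integral_cong refl) (auto split: split_indicator)
    then have "expectation (\<lambda>x. indicator A (X x) :: real) = prob (X -` A \<inter> space M)" by simp
    ultimately show ?thesis using 1 2 by (simp add: add_divide_distrib)
  qed
  ultimately show ?thesis using m by (simp add: m_def field_simps)
qed

text \<open>The free phase \<open>a\<close> lets identities between cosines carry the sines too,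
  since a phase shift by a quarter period exchanges them.\<close>

lemma (in prob_space) expectation_cos_std_normal_vector:
  fixes W :: "nat \<Rightarrow> 'a \<Rightarrow> real"
  assumes W[measurable]: "\<And>j. W j \<in> borel_measurable M"
    and ch: "\<And>u. (CLINT x|M. iexp (\<Sum>j<n. u j * W j x)) = of_real (exp (- (\<Sum>j<n. (u j)\<^sup>2) / 2))"
  shows "expectation (\<lambda>x. cos (a + (\<Sum>j<n. u j * W j x))) = cos a * exp (- (\<Sum>j<n. (u j)\<^sup>2) / 2)"
proof -
  let ?S = "\<lambda>x. \<Sum>j<n. u j * W j x"
  let ?e = "exp (- (\<Sum>j<n. (u j)\<^sup>2) / 2)"
  have "Complex (expectation (\<lambda>x. 1 * cos (?S x))) (expectation (\<lambda>x. 1 * sin (?S x))) = of_real ?e"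
    using ch[of u] integral_iexp_weighted[of "\<lambda>_. 1" ?S 1] by simp
  then have "expectation (\<lambda>x. cos (?S x)) = ?e" "expectation (\<lambda>x. sin (?S x)) = 0"
    by (auto simp: complex_eq_iff)
  moreover have "integrable M (\<lambda>x. cos (?S x))" "integrable M (\<lambda>x. sin (?S x))"
    by (rule integrable_const_bound[where B = 1]; simp)+
  ultimately show ?thesis by (simp add: cos_add)
qed

text \<open>An interpolation between the characteristic function (k = 0) and the probabilities of
  boxes (k = n). Each induction step converts one coordinate from a character into an
  indicator.\<close>

lemma (in prob_space) std_normal_vector_boxes:
  fixes W :: "nat \<Rightarrow> 'a \<Rightarrow> real" and A :: "nat \<Rightarrow> real set"
  assumes W[measurable]: "\<And>j. W j \<in> borel_measurable M"
    and ch: "\<And>u. (CLINT x|M. iexp (\<Sum>j<n. u j * W j x)) = of_real (exp (- (\<Sum>j<n. (u j)\<^sup>2) / 2))"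
    and A[measurable]: "\<And>j. A j \<in> sets borel" and k: "k \<le> n"
  shows "expectation (\<lambda>x. (\<Prod>j<k. indicator (A j) (W j x)) * cos (a + (\<Sum>j=k..<n. u j * W j x))) =
    (\<Prod>j<k. measure std_normal_distribution (A j)) * cos a * exp (- (\<Sum>j=k..<n. (u j)\<^sup>2) / 2)"
  using k
proof (induction k arbitrary: a u)
  case 0
  show ?case using expectation_cos_std_normal_vector[OF W ch] by (simp add: atLeast0LessThan)
next
  case (Suc k)
  then have kn: "k < n" by simp
  let ?P = "\<lambda>x. \<Prod>j<k. indicator (A j) (W j x) :: real"
  let ?p = "\<Prod>j<k. measure std_normal_distribution (A j)"
  let ?S = "\<lambda>x. \<Sum>j=Suc k..<n. u j * W j x"
  let ?e = "exp (- (\<Sum>j=Suc k..<n. (u j)\<^sup>2) / 2)"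
  define G where "G x = ?P x * cos (a + ?S x)" for x
  \<comment> \<open>The frequency of the coordinate about to be converted is replaced by a free
    \<open>v\<close>; letting v vary shows that \<open>G\<close> is uncorrelated with all characters
    of \<open>W k\<close>.\<close>
  have IH: "expectation (\<lambda>x. ?P x * cos (b + (?S x + v * W k x))) = ?p * cos b * ?e * exp (- v\<^sup>2 / 2)" for b v
  proof -
    have 1: "(\<Sum>j=k..<n. (u(k := v)) j * W j x) = ?S x + v * W k x" for x
      using kn by (simp add: sum.atLeast_Suc_lessThan)
    have 2: "(\<Sum>j=k..<n. ((u(k := v)) j)\<^sup>2) = (\<Sum>j=Suc k..<n. (u j)\<^sup>2) + v\<^sup>2"
      using kn by (simp add: sum.atLeast_Suc_lessThan)
    show ?thesis using Suc.IH[of b "u(k := v)"] kn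
      unfolding 1 2 by (simp add: exp_add[symmetric] add_divide_distrib)
  qed
  have P: "\<bar>?P x\<bar> \<le> 1" for x by (simp add: abs_prod prod_le_1)
  have int: "integrable M (\<lambda>x. ?P x * cos (b + (?S x + v * W k x)))" for b v
    by (rule integrable_const_bound[where B = 1]) (use P in \<open>auto simp: abs_mult intro!: mult_le_one\<close>)
  have EG: "expectation G = ?p * cos a * ?e" using IH[of a 0] by (simp add: G_def[abs_def])
  have cW: "expectation (\<lambda>x. cos (v * W k x)) = exp (- v\<^sup>2 / 2)" 
    and sW: "expectation (\<lambda>x. sin (v * W k x)) = 0" for v
  proof -
    have "(\<Sum>j<n. (if j = k then v else 0) * W j x) = v * W k x" for x
      using kn by (simp add: if_distrib[where f = "\<lambda>c. c * _"] sum.delta cong: if_cong)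
    moreover have "(\<Sum>j<n. (if j = k then v else 0)\<^sup>2) = v\<^sup>2"
      using kn by (simp add: if_distrib[where f = "\<lambda>c. c ^ 2"] sum.delta cong: if_cong)
    ultimately have "expectation (\<lambda>x. cos (b + v * W k x)) = cos b * exp (- v\<^sup>2 / 2)" for b
      using expectation_cos_std_normal_vector[OF W ch, of b "\<lambda>j. if j = k then v else 0"] by simp
    from this[of 0] this[of "-pi/2"] show "expectation (\<lambda>x. cos (v * W k x)) = exp (- v\<^sup>2 / 2)"
      "expectation (\<lambda>x. sin (v * W k x)) = 0" by (simp_all add: cos_add cos_diff)
  qed
  have cG: "expectation (\<lambda>x. G x * cos (v * W k x)) = ?p * cos a * ?e * exp (- v\<^sup>2 / 2)" for v
  proof -
    have "expectation (\<lambda>x. G x * cos (v * W k x)) = expectation (\<lambda>x. 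
        1/2 * (?P x * cos (a + (?S x + v * W k x))) + 1/2 * (?P x * cos (a + (?S x + (- v) * W k x))))"
      by (intro Bochner_Integration.integral_cong refl) (simp add: G_def cos_add cos_diff sin_add sin_diff algebra_simps)
    also have "\<dots> = ?p * cos a * ?e * exp (- v\<^sup>2 / 2)"
      using int[of a v] int[of a "- v"] IH[of a v] IH[of a "- v"] by simp
    finally show ?thesis .
  qed
  \<comment> \<open>As for the cosine, a product-to-sum formula; the phase \<open>a - pi/2\<close>
    makes sines out of the cosines that \<open>IH\<close> provides.\<close>
  have sG: "expectation (\<lambda>x. G x * sin (v * W k x)) = 0" for v
  proof -
    have "expectation (\<lambda>x. G x * sin (v * W k x)) = expectation (\<lambda>x. 
        1/2 * (?P x * cos ((a - pi/2) + (?S x + v * W k x))) - 1/2 * (?P x * cos ((a - pi/2) + (?S x + (- v) * W k x))))"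
      by (intro Bochner_Integration.integral_cong refl) (simp add: G_def cos_add cos_diff sin_add sin_diff algebra_simps)
    also have "\<dots> = 0"
      using int[of "a - pi/2" v] int[of "a - pi/2" "- v"] IH[of "a - pi/2" v] IH[of "a - pi/2" "- v"] by simp
    finally show ?thesis .
  qed
  have W_law: "distr M borel (W k) = std_normal_distribution"
  proof (rule Levy_uniqueness)
    show "real_distribution std_normal_distribution" by (rule real_dist_normal_dist)
    show "char (distr M borel (W k)) = char std_normal_distribution"
    proof
      fix v
      have "char (distr M borel (W k)) v = (CLINT x|M. of_real 1 * iexp (v * W k x))"
        unfolding char_def by (subst integral_distr) auto
      also have "\<dots> = of_real (exp (- v\<^sup>2 / 2))"
        by (subst integral_iexp_weighted[where C = 1]) (auto simp: cW sW complex_eq_iff)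
      finally show "char (distr M borel (W k)) v = char std_normal_distribution v"
        by (simp add: char_std_normal_distribution)
    qed
  qed (intro real_distribution_distr W)
  have "expectation (\<lambda>x. G x * indicator (A k) (W k x)) = expectation G * prob (W k -` A k \<inter> space M)"
  proof (rule uncorrelated_with_characters_imp_uncorrelated)
    show "G \<in> borel_measurable M" unfolding G_def by measurable
    show "\<bar>G x\<bar> \<le> 1" for x unfolding G_def using P[of x] by (auto simp: abs_mult intro!: mult_le_one)
  qed (auto simp: EG cW sW cG sG)
  also have "prob (W k -` A k \<inter> space M) = measure std_normal_distribution (A k)"
    by (simp add: W_law[symmetric] measure_distr)
  finally have "expectation (\<lambda>x. G x * indicator (A k) (W k x)) =
      ?p * cos a * ?e * measure std_normal_distribution (A k)"
    unfolding EG .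
  then show ?case unfolding G_def by (simp add: mult_ac)
qed

text \<open>With every coordinate converted and phase 0, the box lemma gives the probabilities of
  all rectangles, which determine a finite product measure.\<close>

theorem (in prob_space) distr_std_normal_vector:
  fixes W :: "nat \<Rightarrow> 'a \<Rightarrow> real"
  assumes W[measurable]: "\<And>j. W j \<in> borel_measurable M"
    and ch: "\<And>u. (CLINT x|M. iexp (\<Sum>j<n. u j * W j x)) = of_real (exp (- (\<Sum>j<n. (u j)\<^sup>2) / 2))"
  shows "distr M (\<Pi>\<^sub>M i\<in>{..<n}. borel) (\<lambda>x. \<lambda>i\<in>{..<n}. W i x) = (\<Pi>\<^sub>M i\<in>{..<n}. normal_law 0 1)"
proof -
  interpret N: prob_space "normal_law 0 1"
    unfolding normal_law_standard by (rule prob_space_normal_density) simp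
  interpret P: product_prob_space "\<lambda>_. normal_law 0 1" "{..<n}" by unfold_locales
  have sets_eq: "sets (normal_law 0 1) = sets borel" by (simp add: normal_law_standard)
  show ?thesis
  proof (rule P.PiM_eqI)
    show "sets (distr M (\<Pi>\<^sub>M i\<in>{..<n}. borel) (\<lambda>x. \<lambda>i\<in>{..<n}. W i x)) = sets (\<Pi>\<^sub>M i\<in>{..<n}. normal_law 0 1)"
      by (simp add: sets_eq cong: sets_PiM_cong)
    fix A :: "nat \<Rightarrow> real set" assume A: "\<And>i. i \<in> {..<n} \<Longrightarrow> A i \<in> sets (normal_law 0 1)"
    \<comment> \<open>The box lemma takes a Borel set for every natural number, whereas
      \<open>A\<close> is constrained only below n.\<close>
    define A' where "A' i = (if i < n then A i else UNIV)" for i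
    have A'[measurable]: "A' i \<in> sets borel" for i using A[of i] by (auto simp: A'_def sets_eq)
    have "emeasure (distr M (\<Pi>\<^sub>M i\<in>{..<n}. borel) (\<lambda>x. \<lambda>i\<in>{..<n}. W i x)) (Pi\<^sub>E {..<n} A)
       = emeasure M ((\<lambda>x. \<lambda>i\<in>{..<n}. W i x) -` Pi\<^sub>E {..<n} A \<inter> space M)"
      by (rule emeasure_distr) (use A in \<open>auto simp: sets_eq intro!: sets_PiM_I_finite\<close>)
    also have "\<dots> = ennreal (expectation (\<lambda>x. \<Prod>j<n. indicator (A' j) (W j x)))"
    proof -
      have "expectation (\<lambda>x. \<Prod>j<n. indicator (A' j) (W j x) :: real) =
          expectation (indicator ((\<lambda>x. \<lambda>i\<in>{..<n}. W i x) -` Pi\<^sub>E {..<n} A \<inter> space M))"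
      proof (intro Bochner_Integration.integral_cong refl)
        fix x assume "x \<in> space M"
        then show "(\<Prod>j<n. indicator (A' j) (W j x)) = (indicator ((\<lambda>x. \<lambda>i\<in>{..<n}. W i x) -` Pi\<^sub>E {..<n} A \<inter> space M) x :: real)"
          by (cases "\<forall>i<n. W i x \<in> A i") (auto simp: A'_def indicator_def PiE_iff)
      qed
      then show ?thesis by (simp add: emeasure_eq_measure)
    qed
    also have "expectation (\<lambda>x. \<Prod>j<n. indicator (A' j) (W j x)) = (\<Prod>j<n. measure std_normal_distribution (A' j))"
      using std_normal_vector_boxes[OF W ch A', where k = n and a = 0] by simp
    also have "ennreal \<dots> = (\<Prod>i<n. emeasure (normal_law 0 1) (A i))"
      by (subst prod_ennreal[symmetric])
        (auto simp: N.emeasure_eq_measure normal_law_standard[symmetric] A'_def intro!: prod.cong)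
    finally show "emeasure (distr M (\<Pi>\<^sub>M i\<in>{..<n}. borel) (\<lambda>x. \<lambda>i\<in>{..<n}. W i x)) (Pi\<^sub>E {..<n} A)
       = (\<Prod>i<n. emeasure (normal_law 0 1) (A i))" .
  qed simp
qed

section \<open>Optimality of two-sided tests\<close>

lemma exp_sqrt_le_exp:
  fixes c s x :: real
  assumes "0 < s" "0 \<le> x"
  shows "exp (c * sqrt x) \<le> exp (c\<^sup>2 / (4 * s)) * exp (s * x)"
proof -
  \<comment> \<open>Completing the square: \<open>c * r - s * r\<^sup>2\<close> has maximum
    \<open>c\<^sup>2 / (4 * s)\<close> over real r.\<close>
  have "0 \<le> (2 * s * sqrt x - c)\<^sup>2" by simp
  also have "\<dots> = 4 * s\<^sup>2 * x - 4 * s * (c * sqrt x) + c\<^sup>2"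
    using assms by (simp add: power2_diff power_mult_distrib)
  finally have "c * sqrt x \<le> c\<^sup>2 / (4 * s) + s * x"
    using assms by (simp add: field_simps power2_eq_square)
  then show ?thesis by (simp add: exp_add[symmetric])
qed

text \<open>Applied to \<open>y * u\<close> with |y| \<le> 1 and divided by |y|, this dominates the
  difference quotients of \<open>exp (y * u)\<close> by
  \<open>\<bar>u\<bar> * exp \<bar>u\<bar>\<close>, uniformly in y.\<close>

lemma abs_exp_minus_one_le:
  fixes x :: real
  shows "\<bar>exp x - 1\<bar> \<le> \<bar>x\<bar> * exp \<bar>x\<bar>"
proof (cases "0 \<le> x")
  case True
  have "1 - x \<le> exp (- x)" using exp_ge_add_one_self[of "- x"] by simp
  then have "(1 - x) * exp x \<le> exp (- x) * exp x" by (intro mult_right_mono) auto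
  then have "exp x - 1 \<le> x * exp x" by (simp add: exp_minus left_diff_distrib)
  then show ?thesis using True by simp
next
  case False
  then have "exp x \<le> 1" by simp
  then have "\<bar>exp x - 1\<bar> \<le> \<bar>x\<bar>" using False exp_ge_add_one_self[of x] by linarith
  also have "\<dots> \<le> \<bar>x\<bar> * exp \<bar>x\<bar>" by (simp add: mult_le_cancel_left1)
  finally show ?thesis .
qed

text \<open>The derivative of \<open>exp (x * a)\<close> at x = 0 along a sequence, the form that
  dominated convergence takes. The sign of \<open>b\<close> selects the side of approach.\<close>

lemma diff_quotient_exp_LIMSEQ:
  fixes b :: real
  assumes "b \<noteq> 0"
  shows "(\<lambda>n. (exp (b / real (Suc n) * a) - 1) / (b / real (Suc n))) \<longlonglongrightarrow> a"
proof -
  have "((\<lambda>x. exp (x * a)) has_real_derivative a) (at 0)"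
    by (auto intro!: derivative_eq_intros)
  then have "((\<lambda>x. (exp (x * a) - 1) / x) \<longlongrightarrow> a) (at 0)"
    by (simp add: has_field_derivative_iff)
  moreover have "filterlim (\<lambda>n. b / real (Suc n)) (at 0) sequentially"
  proof (rule filterlim_atI)
    show "(\<lambda>n. b / real (Suc n)) \<longlonglongrightarrow> 0"
      using LIMSEQ_Suc[OF lim_const_over_n[of b]] by simp
  qed (use assms in simp)
  ultimately show ?thesis by (rule filterlim_compose)
qed

text \<open>The right-hand side is the chord of \<open>exp (a * x)\<close> through the points with
  abscissae - v and v; a convex function lies below its chord between them.\<close>

lemma exp_affine_chord_le:
  fixes a v x :: real
  assumes v: "0 < v" and x: "\<bar>x\<bar> \<le> v"
  shows "exp (a * x) \<le> cosh (a * v) + sinh (a * v) / v * x"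
proof -
  have "convex_on UNIV (\<lambda>x. exp (a * x))"
    by (rule f''_ge0_imp_convex[where f' = "\<lambda>x. a * exp (a * x)" and f'' = "\<lambda>x. a * a * exp (a * x)"])
      (auto intro!: derivative_eq_intros)
  then have "exp (a * ((1 - (x + v) / (2 * v)) *\<^sub>R (- v) + ((x + v) / (2 * v)) *\<^sub>R v)) \<le>
      (1 - (x + v) / (2 * v)) * exp (a * (- v)) + (x + v) / (2 * v) * exp (a * v)"
    by (rule convex_onD) (use assms in \<open>auto simp: divide_le_eq\<close>)
  also have "(1 - (x + v) / (2 * v)) *\<^sub>R (- v) + ((x + v) / (2 * v)) *\<^sub>R v = x"
    using v by (simp add: field_simps)
  also have "(1 - (x + v) / (2 * v)) * exp (a * (- v)) + (x + v) / (2 * v) * exp (a * v) =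
      cosh (a * v) + sinh (a * v) / v * x"
    using v by (simp add: cosh_def sinh_def field_simps)
  finally show ?thesis .
qed

text \<open>For \<open>x > v\<close> the point \<open>v\<close> lies between \<open>- v\<close> and \<open>x\<close>, so convexity is used on \<open>[- v, x]\<close>.\<close>
lemma exp_affine_chord_ge:
  fixes a v x :: real
  assumes v: "0 < v" and x: "v \<le> \<bar>x\<bar>"
  shows "cosh (a * v) + sinh (a * v) / v * x \<le> exp (a * x)"
proof -
  have *: "cosh (a * v) + sinh (a * v) / v * x \<le> exp (a * x)" if x: "v \<le> x" for a x
  proof -
    have "convex_on UNIV (\<lambda>x. exp (a * x))"
      by (rule f''_ge0_imp_convex[where f' = "\<lambda>x. a * exp (a * x)" and f'' = "\<lambda>x. a * a * exp (a * x)"])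
        (auto intro!: derivative_eq_intros)
    then have "exp (a * ((1 - 2 * v / (x + v)) *\<^sub>R (- v) + (2 * v / (x + v)) *\<^sub>R x)) \<le>
        (1 - 2 * v / (x + v)) * exp (a * (- v)) + 2 * v / (x + v) * exp (a * x)"
      by (rule convex_onD) (use v x in \<open>auto simp: divide_le_eq\<close>)
    also have "(1 - 2 * v / (x + v)) *\<^sub>R (- v) + (2 * v / (x + v)) *\<^sub>R x = v"
      using v x by (simp add: divide_simps) (simp add: algebra_simps)
    finally have "(x + v) * exp (a * v) \<le>
        (x + v) * ((1 - 2 * v / (x + v)) * exp (a * (- v)) + 2 * v / (x + v) * exp (a * x))"
      using v x by (intro mult_left_mono) auto
    also have "\<dots> = (x + v - (x + v) * (2 * v / (x + v))) * exp (- (a * v)) + (x + v) * (2 * v / (x + v)) * exp (a * x)"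
      by (simp add: algebra_simps)
    also have "(x + v) * (2 * v / (x + v)) = 2 * v" using v x by simp
    finally have "(x + v) * exp (a * v) \<le> (x - v) * exp (- (a * v)) + 2 * v * exp (a * x)"
      by simp
    then show ?thesis using v by (simp add: cosh_def sinh_def field_simps)
  qed
  show ?thesis
  proof (cases "0 \<le> x")
    case True then show ?thesis using * x by simp
  next
    case False
    then show ?thesis using *[of "- x" "- a"] x by simp
  qed
qed

text \<open>cosh is even, so only even powers of the square root survive and the series is one in x
  itself.\<close>

lemma cosh_sqrt_sums:
  fixes a x :: real
  assumes "0 \<le> x"
  shows "(\<lambda>n. a ^ (2 * n) / fact (2 * n) * x ^ n) sums cosh (a * sqrt x)"
proof -
  have "(\<lambda>n. if even n then (a * sqrt x) ^ n /\<^sub>R fact n else 0) sums cosh (a * sqrt x)"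
    by (rule cosh_converges)
  then have "(\<lambda>n. (a * sqrt x) ^ (2 * n) /\<^sub>R fact (2 * n)) sums cosh (a * sqrt x)"
    by (subst (asm) sums_mono_reindex[of "\<lambda>n. 2 * n", symmetric])
      (auto simp: strict_mono_def elim!: evenE)
  moreover have "(a * sqrt x) ^ (2 * n) = a ^ (2 * n) * x ^ n" for n
    using assms by (simp add: power_mult_distrib power_mult[of "sqrt x"])
  ultimately show ?thesis by (simp add: divide_inverse mult_ac)
qed

text \<open>Division by \<open>sqrt x\<close> lowers the odd powers to even ones, which again
  removes the square root.\<close>

lemma sinh_sqrt_sums:
  fixes a x :: real
  assumes "0 < x"
  shows "(\<lambda>n. a ^ (2 * n + 1) / fact (2 * n + 1) * x ^ n) sums (sinh (a * sqrt x) / sqrt x)"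
proof -
  have "(\<lambda>n. if even n then 0 else (a * sqrt x) ^ n /\<^sub>R fact n) sums sinh (a * sqrt x)"
    by (rule sinh_converges)
  then have "(\<lambda>n. (a * sqrt x) ^ (2 * n + 1) /\<^sub>R fact (2 * n + 1)) sums sinh (a * sqrt x)"
    by (subst (asm) sums_mono_reindex[of "\<lambda>n. 2 * n + 1", symmetric])
      (auto simp: strict_mono_def elim!: oddE)
  then have "(\<lambda>n. (a * sqrt x) ^ (2 * n + 1) /\<^sub>R fact (2 * n + 1) / sqrt x) sums (sinh (a * sqrt x) / sqrt x)"
    by (rule sums_divide)
  moreover have "(a * sqrt x) ^ (2 * n + 1) /\<^sub>R fact (2 * n + 1) / sqrt x = a ^ (2 * n + 1) / fact (2 * n + 1) * x ^ n" for n
  proof -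
    have "(a * sqrt x) ^ (2 * n + 1) = a ^ (2 * n + 1) * x ^ n * sqrt x"
      using assms by (simp add: power_mult_distrib power_add power_mult[of "sqrt x"])
    then show ?thesis unfolding \<open>(a * sqrt x) ^ (2 * n + 1) = _\<close> using assms by (simp add: divide_inverse mult_ac)
  qed
  ultimately show ?thesis by simp
qed

lemma abs_le_exp_sqrt:
  fixes t x :: real
  assumes "t\<^sup>2 \<le> x"
  shows "\<bar>t\<bar> \<le> exp (sqrt x)" "exp \<bar>t\<bar> \<le> exp (sqrt x)"
proof -
  have *: "\<bar>t\<bar> \<le> sqrt x" using assms by (intro real_le_rsqrt) simp
  then show "exp \<bar>t\<bar> \<le> exp (sqrt x)" by simp
  show "\<bar>t\<bar> \<le> exp (sqrt x)" using * exp_ge_add_one_self[of "sqrt x"] by linarith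
qed

section \<open>Laplace transforms in the statistic q\<close>

locale gaussian_weight =
  fixes L :: "'x measure" and q :: "'x \<Rightarrow> real"
  assumes q_meas[measurable]: "q \<in> borel_measurable L"
    and q_nonneg: "\<And>x. 0 \<le> q x"
    and integrable_weight: "\<And>s. 0 < s \<Longrightarrow> integrable L (\<lambda>x. exp (- s * q x))"
begin

text \<open>Half of the decay is spent on absorbing \<open>g\<close>, by
  \<open>exp_sqrt_le_exp\<close> with s / 2; the other half stays integrable.\<close>

lemma integrable_weight_mult:
  assumes g[measurable]: "g \<in> borel_measurable L" and s: "0 < s"
    and le: "\<And>x. x \<in> space L \<Longrightarrow> \<bar>g x\<bar> \<le> K * exp (c * sqrt (q x))"
  shows "integrable L (\<lambda>x. g x * exp (- s * q x))"
proof (rule Bochner_Integration.integrable_bound)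
  show "integrable L (\<lambda>x. \<bar>K\<bar> * exp (c\<^sup>2 / (4 * (s / 2))) * exp (- (s / 2) * q x))"
    by (intro integrable_mult_right integrable_weight) (use s in simp)
  show "AE x in L. norm (g x * exp (- s * q x)) \<le>
      norm (\<bar>K\<bar> * exp (c\<^sup>2 / (4 * (s / 2))) * exp (- (s / 2) * q x))"
  proof (rule AE_I2)
    fix x assume x: "x \<in> space L"
    have "\<bar>g x\<bar> \<le> \<bar>K\<bar> * (exp (c\<^sup>2 / (4 * (s / 2))) * exp (s / 2 * q x))"
    proof (rule order_trans[OF le[OF x]])
      have "K * exp (c * sqrt (q x)) \<le> \<bar>K\<bar> * exp (c * sqrt (q x))" by (intro mult_right_mono) auto
      also have "\<dots> \<le> \<bar>K\<bar> * (exp (c\<^sup>2 / (4 * (s / 2))) * exp (s / 2 * q x))"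
        by (intro mult_left_mono exp_sqrt_le_exp) (use s q_nonneg in auto)
      finally show "K * exp (c * sqrt (q x)) \<le> \<dots>" .
    qed
    then have "\<bar>g x\<bar> * exp (- s * q x) \<le> \<bar>K\<bar> * (exp (c\<^sup>2 / (4 * (s / 2))) * exp (s / 2 * q x)) * exp (- s * q x)"
      by (intro mult_right_mono) auto
    also have "\<dots> = \<bar>K\<bar> * exp (c\<^sup>2 / (4 * (s / 2))) * (exp (s / 2 * q x) * exp (- s * q x))" by simp
    also have "exp (s / 2 * q x) * exp (- s * q x) = exp (- (s / 2) * q x)"
      by (simp add: exp_add[symmetric] field_simps)
    finally show "norm (g x * exp (- s * q x)) \<le> norm (\<bar>K\<bar> * exp (c\<^sup>2 / (4 * (s / 2))) * exp (- (s / 2) * q x))"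
      by (simp add: abs_mult)
  qed
qed measurable

text \<open>Differentiation of the Laplace transform \<open>s \<mapsto> \<integral> g exp (- s q)\<close>.\<close>
lemma integral_weight_mult_q_eq_0:
  assumes g[measurable]: "g \<in> borel_measurable L"
    and int: "\<And>s. 0 < s \<Longrightarrow> integrable L (\<lambda>x. g x * exp (- s * q x))"
    and zero: "\<And>s. 0 < s \<Longrightarrow> (\<integral>x. g x * exp (- s * q x) \<partial>L) = 0"
    and s: "0 < s"
  shows "integrable L (\<lambda>x. g x * q x * exp (- s * q x))"
    and "(\<integral>x. g x * q x * exp (- s * q x) \<partial>L) = 0"
proof -
  show int_q: "integrable L (\<lambda>x. g x * q x * exp (- s * q x))"
  proof (rule Bochner_Integration.integrable_bound)
    \<comment> \<open>The same halving: \<open>q \<le> 2 / s * exp (s / 2 * q)\<close>, and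
      integrability of \<open>g\<close> is known at s / 2 too.\<close>
    show "integrable L (\<lambda>x. 2 / s * (g x * exp (- (s / 2) * q x)))"
      by (intro integrable_mult_right int) (use s in simp)
    show "AE x in L. norm (g x * q x * exp (- s * q x)) \<le> norm (2 / s * (g x * exp (- (s / 2) * q x)))"
    proof (rule AE_I2)
      fix x
      have "s / 2 * q x \<le> exp (s / 2 * q x)" using exp_ge_add_one_self[of "s / 2 * q x"] by linarith
      then have "q x \<le> 2 / s * exp (s / 2 * q x)" using s by (simp add: field_simps)
      then have "q x * exp (- s * q x) \<le> 2 / s * exp (s / 2 * q x) * exp (- s * q x)"
        by (intro mult_right_mono) auto
      also have "\<dots> = 2 / s * exp (- (s / 2) * q x)"
        by (simp add: exp_add[symmetric] field_simps)
      finally have "\<bar>g x\<bar> * (q x * exp (- s * q x)) \<le> \<bar>g x\<bar> * (2 / s * exp (- (s / 2) * q x))"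
        by (intro mult_left_mono) auto
      then show "norm (g x * q x * exp (- s * q x)) \<le> norm (2 / s * (g x * exp (- (s / 2) * q x)))"
        using s q_nonneg[of x] by (simp add: abs_mult mult_ac)
    qed
  qed measurable
  \<comment> \<open>The difference quotient for the increment 1 / (n + 1) of s, with its sign
    reversed. A positive increment keeps the parameter positive, so \<open>zero\<close> applies at
    both ends, and the quotient is bounded by \<open>q\<close> uniformly in n.\<close>
  define h where "h n x = g x * exp (- s * q x) * ((exp (- 1 / real (Suc n) * q x) - 1) / (- 1 / real (Suc n)))" for n x
  have "(\<lambda>n. \<integral>x. h n x \<partial>L) \<longlonglongrightarrow> (\<integral>x. g x * q x * exp (- s * q x) \<partial>L)"
  proof (rule integral_dominated_convergence[where w = "\<lambda>x. \<bar>g x * q x * exp (- s * q x)\<bar>"])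
    show "integrable L (\<lambda>x. \<bar>g x * q x * exp (- s * q x)\<bar>)" using int_q by simp
    show "AE x in L. (\<lambda>n. h n x) \<longlonglongrightarrow> g x * q x * exp (- s * q x)"
    proof (rule AE_I2)
      fix x
      have "(\<lambda>n. h n x) \<longlonglongrightarrow> g x * exp (- s * q x) * q x"
        unfolding h_def by (intro tendsto_mult_left diff_quotient_exp_LIMSEQ) simp
      then show "(\<lambda>n. h n x) \<longlonglongrightarrow> g x * q x * exp (- s * q x)" by (simp add: mult_ac)
    qed
    show "AE x in L. norm (h n x) \<le> \<bar>g x * q x * exp (- s * q x)\<bar>" for n
    proof (rule AE_I2)
      fix x
      have e: "\<bar>(exp (- 1 / real (Suc n) * q x) - 1) / (- 1 / real (Suc n))\<bar> \<le> q x"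
      proof -
        define y where "y = 1 / real (Suc n)"
        have y: "0 < y" "- 1 / real (Suc n) = - y" by (simp_all add: y_def)
        have "0 \<le> 1 - exp (- y * q x)" "1 - exp (- y * q x) \<le> y * q x"
          using exp_ge_add_one_self[of "- y * q x"] q_nonneg[of x] y by auto
        then show ?thesis unfolding y using \<open>0 < y\<close> by (simp add: abs_le_iff field_simps)
      qed
      have "norm (h n x) = \<bar>g x * exp (- s * q x)\<bar> * \<bar>(exp (- 1 / real (Suc n) * q x) - 1) / (- 1 / real (Suc n))\<bar>"
        unfolding h_def by (simp add: abs_mult)
      also have "\<dots> \<le> \<bar>g x * exp (- s * q x)\<bar> * q x" using e by (intro mult_left_mono) auto
      finally show "norm (h n x) \<le> \<bar>g x * q x * exp (- s * q x)\<bar>"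
        using q_nonneg[of x] by (simp add: abs_mult mult_ac)
    qed
  qed (unfold h_def, measurable)
  moreover have "(\<integral>x. h n x \<partial>L) = 0" for n
  proof -
    have "h n x = (- real (Suc n)) * (g x * exp (- (s + 1 / real (Suc n)) * q x) - g x * exp (- s * q x))" for x
      by (simp add: h_def exp_add[symmetric] algebra_simps)
    moreover have "0 < s + 1 / real (Suc n)" using s by (simp add: add_pos_pos)
    note int[OF this] zero[OF this]
    ultimately show ?thesis using int[OF s] zero[OF s] by (simp del: of_nat_Suc minus_add_distrib mult_minus_left)
  qed
  ultimately show "(\<integral>x. g x * q x * exp (- s * q x) \<partial>L) = 0"
    by (simp add: LIMSEQ_const_iff)
qed

lemma integral_weight_mult_power_eq_0:
  assumes g[measurable]: "g \<in> borel_measurable L"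
    and int: "\<And>s. 0 < s \<Longrightarrow> integrable L (\<lambda>x. g x * exp (- s * q x))"
    and zero: "\<And>s. 0 < s \<Longrightarrow> (\<integral>x. g x * exp (- s * q x) \<partial>L) = 0"
    and s: "0 < s"
  shows "integrable L (\<lambda>x. g x * q x ^ n * exp (- s * q x)) \<and> (\<integral>x. g x * q x ^ n * exp (- s * q x) \<partial>L) = 0"
  using s
proof (induction n arbitrary: s)
  case 0 then show ?case using int zero by simp
next
  case (Suc n)
  have [measurable]: "(\<lambda>x. g x * q x ^ n) \<in> borel_measurable L" by measurable
  show ?case
    using integral_weight_mult_q_eq_0[of "\<lambda>x. g x * q x ^ n" s] Suc by (simp add: mult_ac)
qed

text \<open>Partial sums integrate to 0 by the power case. Every partial sum is bounded by the
  series of absolute values \<open>f'\<close>, which is why integrability is asked for with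
  \<open>f'\<close> in place of \<open>f\<close>.\<close>

lemma integral_weight_mult_series_eq_0:
  assumes g[measurable]: "g \<in> borel_measurable L" and f[measurable]: "f \<in> borel_measurable L"
    and int: "\<And>s. 0 < s \<Longrightarrow> integrable L (\<lambda>x. g x * exp (- s * q x))"
    and zero: "\<And>s. 0 < s \<Longrightarrow> (\<integral>x. g x * exp (- s * q x) \<partial>L) = 0"
    and s: "0 < s"
    and sums: "\<And>x. (\<lambda>n. a n * q x ^ n) sums f x" and abs_sums: "\<And>x. (\<lambda>n. \<bar>a n\<bar> * q x ^ n) sums f' x"
    and dom: "integrable L (\<lambda>x. g x * f' x * exp (- s * q x))"
  shows "(\<integral>x. g x * f x * exp (- s * q x) \<partial>L) = 0"
proof -
  note P = integral_weight_mult_power_eq_0[OF g int zero s]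
  let ?h = "\<lambda>n x. \<Sum>i<n. a i * (g x * q x ^ i * exp (- s * q x))"
  have "(\<lambda>n. \<integral>x. ?h n x \<partial>L) \<longlonglongrightarrow> (\<integral>x. g x * f x * exp (- s * q x) \<partial>L)"
  proof (rule integral_dominated_convergence[where w = "\<lambda>x. \<bar>g x * f' x * exp (- s * q x)\<bar>"])
    show "integrable L (\<lambda>x. \<bar>g x * f' x * exp (- s * q x)\<bar>)" using dom by simp
    show "AE x in L. (\<lambda>n. ?h n x) \<longlonglongrightarrow> g x * f x * exp (- s * q x)"
    proof (rule AE_I2)
      fix x
      have "(\<lambda>n. a n * q x ^ n * (g x * exp (- s * q x))) sums (f x * (g x * exp (- s * q x)))"
        by (intro sums_mult2 sums)
      then show "(\<lambda>n. ?h n x) \<longlonglongrightarrow> g x * f x * exp (- s * q x)" by (simp add: sums_def mult_ac)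
    qed
    show "AE x in L. norm (?h n x) \<le> \<bar>g x * f' x * exp (- s * q x)\<bar>" for n
    proof (rule AE_I2)
      fix x
      have nn: "0 \<le> \<bar>a i\<bar> * q x ^ i" for i using q_nonneg by simp
      have "norm (?h n x) = \<bar>(\<Sum>i<n. a i * q x ^ i)\<bar> * \<bar>g x * exp (- s * q x)\<bar>"
        unfolding real_norm_def abs_mult[symmetric] sum_distrib_right by (simp add: mult_ac)
      also have "\<bar>(\<Sum>i<n. a i * q x ^ i)\<bar> \<le> (\<Sum>i<n. \<bar>a i\<bar> * q x ^ i)"
        by (rule order_trans[OF sum_abs]) (simp add: abs_mult q_nonneg)
      also have "\<dots> \<le> f' x"
        using sum_le_suminf[OF sums_summable[OF abs_sums], of "{..<n}" x] nn sums_unique[OF abs_sums[of x]] by simp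
      also have "\<dots> \<le> \<bar>f' x\<bar>" by simp
      finally show "norm (?h n x) \<le> \<bar>g x * f' x * exp (- s * q x)\<bar>"
        by (simp add: abs_mult mult_ac mult_right_mono)
    qed
  qed measurable
  moreover have "(\<integral>x. ?h n x \<partial>L) = 0" for n
    using P by (subst Bochner_Integration.integral_sum) auto
  ultimately show ?thesis by (simp add: LIMSEQ_const_iff)
qed

text \<open>Unbiasedness makes the power equal to \<open>\<beta>\<close> with vanishing derivative on the boundary \<open>a = 0\<close>.\<close>
lemma unbiased_boundary_conditions:
  fixes u w :: "'x \<Rightarrow> real"
  assumes u[measurable]: "u \<in> borel_measurable L" and uq: "\<And>x. (u x)\<^sup>2 \<le> q x"
    and w[measurable]: "w \<in> borel_measurable L" and wC: "\<And>x. x \<in> space L \<Longrightarrow> \<bar>w x\<bar> \<le> C"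
    and w0: "\<And>s. 0 < s \<Longrightarrow> (\<integral>x. w x * exp (- s * q x) \<partial>L) \<le> 0"
    and w1: "\<And>s a. 0 < s \<Longrightarrow> a \<noteq> 0 \<Longrightarrow> 0 \<le> (\<integral>x. w x * exp (a * u x) * exp (- s * q x) \<partial>L)"
    and s: "0 < s"
  shows "(\<integral>x. w x * exp (- s * q x) \<partial>L) = 0" and "(\<integral>x. w x * u x * exp (- s * q x) \<partial>L) = 0"
proof -
  have C: "\<bar>w x\<bar> \<le> \<bar>C\<bar>" if "x \<in> space L" for x using wC[OF that] by simp
  have eau: "exp (a * u x) \<le> exp \<bar>u x\<bar>" if "\<bar>a\<bar> \<le> 1" for a x
  proof -
    have "a * u x \<le> \<bar>a\<bar> * \<bar>u x\<bar>" by (metis abs_ge_self abs_mult)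
    also have "\<dots> \<le> 1 * \<bar>u x\<bar>" using that by (intro mult_right_mono) auto
    finally show ?thesis by simp
  qed
  have i_exp: "integrable L (\<lambda>x. w x * exp \<bar>u x\<bar> * exp (- s * q x))"
  proof (rule integrable_weight_mult[OF _ s, where K = "\<bar>C\<bar>" and c = 1])
    fix x assume x: "x \<in> space L"
    show "\<bar>w x * exp \<bar>u x\<bar>\<bar> \<le> \<bar>C\<bar> * exp (1 * sqrt (q x))"
      using C[OF x] abs_le_exp_sqrt(2)[OF uq[of x]] by (simp add: abs_mult mult_mono)
  qed measurable
  have i_expu: "integrable L (\<lambda>x. w x * (\<bar>u x\<bar> * exp \<bar>u x\<bar>) * exp (- s * q x))"
  proof (rule integrable_weight_mult[OF _ s, where K = "\<bar>C\<bar>" and c = 2])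
    fix x assume x: "x \<in> space L"
    have "\<bar>u x\<bar> * exp \<bar>u x\<bar> \<le> exp (sqrt (q x)) * exp (sqrt (q x))"
      using abs_le_exp_sqrt[OF uq[of x]] by (intro mult_mono) auto
    then show "\<bar>w x * (\<bar>u x\<bar> * exp \<bar>u x\<bar>)\<bar> \<le> \<bar>C\<bar> * exp (2 * sqrt (q x))"
      using C[OF x] by (simp add: abs_mult exp_add[symmetric] mult_mono)
  qed measurable
  have i_a: "integrable L (\<lambda>x. w x * exp (a * u x) * exp (- s * q x))" if "\<bar>a\<bar> \<le> 1" for a
    by (rule Bochner_Integration.integrable_bound[OF i_exp])
      (measurable, auto simp only: real_norm_def abs_mult abs_exp_cancel
        intro!: AE_I2 mult_left_mono mult_right_mono eau[OF that] exp_ge_zero)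
  have lim0: "(\<lambda>n. \<integral>x. w x * exp (1 / real (Suc n) * u x) * exp (- s * q x) \<partial>L) \<longlonglongrightarrow>
      (\<integral>x. w x * exp (- s * q x) \<partial>L)"
  proof (rule integral_dominated_convergence[where w = "\<lambda>x. \<bar>w x * exp \<bar>u x\<bar> * exp (- s * q x)\<bar>"])
    show "AE x in L. (\<lambda>n. w x * exp (1 / real (Suc n) * u x) * exp (- s * q x)) \<longlonglongrightarrow> w x * exp (- s * q x)"
    proof (rule AE_I2)
      fix x
      have "(\<lambda>n. w x * exp (1 / real (Suc n) * u x) * exp (- s * q x)) \<longlonglongrightarrow> w x * exp (0 * u x) * exp (- s * q x)"
        by (intro tendsto_intros LIMSEQ_Suc[OF lim_const_over_n])
      then show "(\<lambda>n. w x * exp (1 / real (Suc n) * u x) * exp (- s * q x)) \<longlonglongrightarrow> w x * exp (- s * q x)" by simp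
    qed
    show "AE x in L. norm (w x * exp (1 / real (Suc n) * u x) * exp (- s * q x)) \<le>
        \<bar>w x * exp \<bar>u x\<bar> * exp (- s * q x)\<bar>" for n
      by (auto simp only: real_norm_def abs_mult abs_exp_cancel
        intro!: AE_I2 mult_left_mono mult_right_mono eau exp_ge_zero) simp
    show "integrable L (\<lambda>x. \<bar>w x * exp \<bar>u x\<bar> * exp (- s * q x)\<bar>)" using i_exp by simp
  qed measurable
  have "0 \<le> (\<integral>x. w x * exp (- s * q x) \<partial>L)"
    by (rule LIMSEQ_le_const[OF lim0], rule exI[of _ 0], intro allI impI w1 s) simp
  with w0[OF s] show zero: "(\<integral>x. w x * exp (- s * q x) \<partial>L) = 0" by simp
  \<comment> \<open>Difference quotients in a at 0, from the right for b = 1 and from the left for b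
    = - 1.\<close>
  define d where "d b n x = (exp (b / real (Suc n) * u x) - 1) / (b / real (Suc n))" for b :: real and n x
  have lim1: "(\<lambda>n. \<integral>x. w x * d b n x * exp (- s * q x) \<partial>L) \<longlonglongrightarrow> (\<integral>x. w x * u x * exp (- s * q x) \<partial>L)"
    if b: "\<bar>b\<bar> = 1" for b
  proof (rule integral_dominated_convergence[where w = "\<lambda>x. \<bar>w x * (\<bar>u x\<bar> * exp \<bar>u x\<bar>) * exp (- s * q x)\<bar>"])
    show "integrable L (\<lambda>x. \<bar>w x * (\<bar>u x\<bar> * exp \<bar>u x\<bar>) * exp (- s * q x)\<bar>)" using i_expu by simp
    show "AE x in L. (\<lambda>n. w x * d b n x * exp (- s * q x)) \<longlonglongrightarrow> w x * u x * exp (- s * q x)"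
      unfolding d_def by (intro AE_I2 tendsto_intros diff_quotient_exp_LIMSEQ) (use b in auto)
    show "AE x in L. norm (w x * d b n x * exp (- s * q x)) \<le> \<bar>w x * (\<bar>u x\<bar> * exp \<bar>u x\<bar>) * exp (- s * q x)\<bar>" for n
    proof (rule AE_I2)
      fix x
      define y where "y = b / real (Suc n)"
      have y: "0 < \<bar>y\<bar>" "\<bar>y\<bar> \<le> 1" using b by (auto simp: y_def)
      have "\<bar>d b n x\<bar> = \<bar>exp (y * u x) - 1\<bar> / \<bar>y\<bar>" unfolding d_def y_def by (rule abs_divide)
      also have "\<dots> \<le> \<bar>y * u x\<bar> * exp \<bar>y * u x\<bar> / \<bar>y\<bar>"
        by (intro divide_right_mono abs_exp_minus_one_le) simp
      also have "\<dots> = \<bar>u x\<bar> * exp \<bar>y * u x\<bar>" using y by (simp add: abs_mult)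
      also have "\<dots> \<le> \<bar>u x\<bar> * exp \<bar>u x\<bar>"
        using y by (intro mult_left_mono) (auto simp: abs_mult mult_le_cancel_right1 mult_left_le_one_le)
      finally have "\<bar>d b n x\<bar> \<le> \<bar>u x\<bar> * exp \<bar>u x\<bar>" .
      then show "norm (w x * d b n x * exp (- s * q x)) \<le> \<bar>w x * (\<bar>u x\<bar> * exp \<bar>u x\<bar>) * exp (- s * q x)\<bar>"
        by (auto simp only: real_norm_def abs_mult abs_exp_cancel abs_abs
          intro!: mult_left_mono mult_right_mono exp_ge_zero abs_ge_zero)
    qed
  qed (unfold d_def, measurable)
  \<comment> \<open>The integral is 0 at a = 0 by \<open>zero\<close> and nonnegative elsewhere, so
    each quotient has the sign of its increment; the two sides then pin the derivative to 0.\<close>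
  have dval: "b * (\<integral>x. w x * d b n x * exp (- s * q x) \<partial>L) \<ge> 0" if b: "\<bar>b\<bar> = 1" for b n
  proof -
    define y where "y = b / real (Suc n)"
    have y: "y \<noteq> 0" "\<bar>y\<bar> \<le> 1" "0 \<le> b / y" using b by (auto simp: y_def)
    have i0: "integrable L (\<lambda>x. w x * exp (- s * q x))" using i_a[of 0] by simp
    have "w x * d b n x * exp (- s * q x) =
        1 / y * (w x * exp (y * u x) * exp (- s * q x) - w x * exp (- s * q x))" for x
      unfolding d_def y_def[symmetric] by (simp add: diff_divide_distrib algebra_simps)
    then have "b * (\<integral>x. w x * d b n x * exp (- s * q x) \<partial>L) =
        b * (\<integral>x. 1 / y * (w x * exp (y * u x) * exp (- s * q x) - w x * exp (- s * q x)) \<partial>L)"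
      by simp
    also have "\<dots> = b / y * (\<integral>x. w x * exp (y * u x) * exp (- s * q x) \<partial>L)"
      using i_a[OF y(2)] i0 zero by simp
    also have "\<dots> \<ge> 0" using y w1[OF s y(1)] by (intro mult_nonneg_nonneg) auto
    finally show ?thesis .
  qed
  have "0 \<le> (\<integral>x. w x * u x * exp (- s * q x) \<partial>L)"
    by (rule LIMSEQ_le_const[OF lim1[of 1]]) (use dval[of 1] in auto)
  moreover have "(\<integral>x. w x * u x * exp (- s * q x) \<partial>L) \<le> 0"
    by (rule LIMSEQ_le_const2[OF lim1[of "- 1"]]) (use dval[of "- 1"] in auto)
  ultimately show "(\<integral>x. w x * u x * exp (- s * q x) \<partial>L) = 0" by simp
qed

text \<open>The generalised Neyman--Pearson lemma: on each level set of \<open>q\<close> the optimal test compares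
  \<open>exp (a * u)\<close> with an affine function of \<open>u\<close>, the chord of \<open>exp\<close> over the acceptance interval.
  Both coefficients of the chord are power series in \<open>q\<close>.\<close>
lemma two_sided_test_optimal:
  fixes u \<phi> \<psi> :: "'x \<Rightarrow> real"
  assumes u[measurable]: "u \<in> borel_measurable L" and uq: "\<And>x. (u x)\<^sup>2 \<le> q x"
    and \<phi>m[measurable]: "\<phi> \<in> borel_measurable L" and \<psi>m[measurable]: "\<psi> \<in> borel_measurable L"
    and \<phi>01: "\<And>x. x \<in> space L \<Longrightarrow> 0 \<le> \<phi> x \<and> \<phi> x \<le> 1" and \<psi>01: "\<And>x. x \<in> space L \<Longrightarrow> 0 \<le> \<psi> x \<and> \<psi> x \<le> 1"
    and c: "0 < c" and \<phi>: "AE x in L. \<phi> x = indicator {x. c * sqrt (q x) < \<bar>u x\<bar>} x"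
    and eq0: "\<And>s. 0 < s \<Longrightarrow> (\<integral>x. (\<phi> x - \<psi> x) * exp (- s * q x) \<partial>L) = 0"
    and eq1: "\<And>s. 0 < s \<Longrightarrow> (\<integral>x. (\<phi> x - \<psi> x) * u x * exp (- s * q x) \<partial>L) = 0"
    and s: "0 < s"
  shows "0 \<le> (\<integral>x. (\<phi> x - \<psi> x) * exp (a * u x) * exp (- s * q x) \<partial>L)"
proof -
  define w where "w x = \<phi> x - \<psi> x" for x
  have [measurable]: "w \<in> borel_measurable L" unfolding w_def by measurable
  have w1: "\<bar>w x\<bar> \<le> 1" if "x \<in> space L" for x using \<phi>01[OF that] \<psi>01[OF that] by (auto simp: w_def)
  define k0 where "k0 b x = cosh (b * c * sqrt (q x))" for b x
  \<comment> \<open>\<open>k1 b / c\<close> is the slope of the chord. The value at q = 0 is the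
    limit, and also the constant term of the power series, so that the series is valid
    everywhere.\<close>
  define k1 where "k1 b x = (if q x = 0 then b * c else sinh (b * c * sqrt (q x)) / sqrt (q x))" for b x
  have [measurable]: "k0 b \<in> borel_measurable L" "k1 b \<in> borel_measurable L" for b
    unfolding k0_def k1_def cosh_def sinh_def by measurable
  have k0_le: "\<bar>k0 b x\<bar> \<le> exp (\<bar>b * c\<bar> * sqrt (q x))" for b x
  proof -
    have "b * c * sqrt (q x) \<le> \<bar>b * c\<bar> * sqrt (q x)" "- (b * c) * sqrt (q x) \<le> \<bar>b * c\<bar> * sqrt (q x)"
      using q_nonneg[of x] by (intro mult_right_mono; simp)+
    then have "exp (b * c * sqrt (q x)) \<le> exp (\<bar>b * c\<bar> * sqrt (q x))"
      "exp (- (b * c * sqrt (q x))) \<le> exp (\<bar>b * c\<bar> * sqrt (q x))" by simp_all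
    moreover have "\<bar>k0 b x\<bar> = (exp (b * c * sqrt (q x)) + exp (- (b * c * sqrt (q x)))) / 2"
      by (simp add: k0_def cosh_def)
    moreover have "(y + z) / 2 \<le> t" if "y \<le> t" "z \<le> t" for y z t :: real using that by simp
    ultimately show ?thesis by metis
  qed
  have i0: "integrable L (\<lambda>x. w x * exp (- s * q x))" if "0 < s" for s
    by (rule integrable_weight_mult[OF _ that, where K = 1 and c = 0]) (use w1 in auto)
  have i1: "integrable L (\<lambda>x. w x * u x * exp (- s * q x))" if s: "0 < s" for s
  proof (rule integrable_weight_mult[OF _ s, where K = 1 and c = 1])
    fix x assume x: "x \<in> space L"
    have "\<bar>w x\<bar> * \<bar>u x\<bar> \<le> 1 * exp (sqrt (q x))"
      using w1[OF x] abs_le_exp_sqrt(1)[OF uq[of x]] by (intro mult_mono) auto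
    then show "\<bar>w x * u x\<bar> \<le> 1 * exp (1 * sqrt (q x))" by (simp add: abs_mult)
  qed measurable
  have ik0: "integrable L (\<lambda>x. w x * k0 b x * exp (- s * q x))" for b
  proof (rule integrable_weight_mult[OF _ s, where K = 1])
    fix x assume x: "x \<in> space L"
    have "\<bar>w x\<bar> * \<bar>k0 b x\<bar> \<le> 1 * exp (\<bar>b * c\<bar> * sqrt (q x))"
      using w1[OF x] k0_le by (intro mult_mono) auto
    then show "\<bar>w x * k0 b x\<bar> \<le> 1 * exp (\<bar>b * c\<bar> * sqrt (q x))" by (simp add: abs_mult)
  qed measurable
  \<comment> \<open>The bound is taken for the product with \<open>u\<close> because
    \<open>\<bar>u\<bar> \<le> sqrt q\<close> cancels the denominator of \<open>k1\<close>.\<close>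
  have k1_le: "\<bar>u x * k1 b x\<bar> \<le> exp (\<bar>b * c\<bar> * sqrt (q x))" for b x
  proof (cases "q x = 0")
    case True
    then have "u x = 0" using uq[of x] by simp
    then show ?thesis by simp
  next
    case False
    then have qp: "0 < sqrt (q x)" using q_nonneg[of x] by simp
    have "\<bar>u x\<bar> \<le> sqrt (q x)" using uq[of x] by (intro real_le_rsqrt) simp
    moreover have "\<bar>k1 b x\<bar> = \<bar>sinh (b * c * sqrt (q x))\<bar> / sqrt (q x)"
      using False qp by (simp add: k1_def)
    ultimately have "\<bar>u x * k1 b x\<bar> \<le> sqrt (q x) * (\<bar>sinh (b * c * sqrt (q x))\<bar> / sqrt (q x))"
      unfolding abs_mult using qp by (simp only:) (intro mult_right_mono; simp)
    also have "\<dots> = \<bar>sinh (b * c * sqrt (q x))\<bar>" using qp by simp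
    also have "\<dots> \<le> cosh (b * c * sqrt (q x))"
      by (simp add: sinh_def cosh_def abs_le_iff)
    also have "\<dots> \<le> exp (\<bar>b * c\<bar> * sqrt (q x))" using k0_le[of b x] by (simp add: k0_def)
    finally show ?thesis .
  qed
  have ik1: "integrable L (\<lambda>x. w x * u x * k1 b x * exp (- s * q x))" for b
  proof (rule integrable_weight_mult[OF _ s, where K = 1])
    fix x assume x: "x \<in> space L"
    have "\<bar>w x\<bar> * \<bar>u x * k1 b x\<bar> \<le> 1 * exp (\<bar>b * c\<bar> * sqrt (q x))"
      using w1[OF x] k1_le by (intro mult_mono) auto
    then show "\<bar>w x * u x * k1 b x\<bar> \<le> 1 * exp (\<bar>b * c\<bar> * sqrt (q x))" by (simp add: abs_mult)
  qed measurable
  have z0: "(\<integral>x. w x * k0 a x * exp (- s * q x) \<partial>L) = 0"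
  proof (rule integral_weight_mult_series_eq_0[where a = "\<lambda>n. (a * c) ^ (2 * n) / fact (2 * n)" and f' = "k0 a"])
    show "(\<lambda>n. (a * c) ^ (2 * n) / fact (2 * n) * q x ^ n) sums k0 a x" for x
      unfolding k0_def by (rule cosh_sqrt_sums[OF q_nonneg])
    then show "(\<lambda>n. \<bar>(a * c) ^ (2 * n) / fact (2 * n)\<bar> * q x ^ n) sums k0 a x" for x by simp
  qed (use s i0 ik0 eq0 in \<open>auto simp: w_def\<close>)
  \<comment> \<open>The coefficients are odd powers of \<open>a * c\<close> and may be negative; as
    c > 0, their absolute values are the coefficients for |a|, hence the majorant
    \<open>k1 \<bar>a\<bar>\<close>.\<close>
  have z1: "(\<integral>x. w x * u x * k1 a x * exp (- s * q x) \<partial>L) = 0"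
  proof (rule integral_weight_mult_series_eq_0[where a = "\<lambda>n. (a * c) ^ (2 * n + 1) / fact (2 * n + 1)" and f' = "k1 \<bar>a\<bar>"])
    show sums: "(\<lambda>n. (b * c) ^ (2 * n + 1) / fact (2 * n + 1) * q x ^ n) sums k1 b x" for x b
    proof (cases "q x = 0")
      case True
      have "(\<lambda>n. (b * c) ^ (2 * n + 1) / fact (2 * n + 1) * 0 ^ n) sums ((b * c) ^ (2 * 0 + 1) / fact (2 * 0 + 1))"
        by (rule powser_sums_zero)
      then show ?thesis using True by (simp add: k1_def)
    next
      case False
      then show ?thesis
        using sinh_sqrt_sums[of "q x" "b * c"] q_nonneg[of x] by (simp add: k1_def less_le)
    qed
    show "(\<lambda>n. \<bar>(a * c) ^ (2 * n + 1) / fact (2 * n + 1)\<bar> * q x ^ n) sums k1 \<bar>a\<bar> x" for x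
      using sums[of "\<bar>a\<bar>" x] c by (simp add: power_abs abs_mult)
  qed (use s i1 ik1 eq1 in \<open>auto simp: w_def\<close>)
  have ie: "integrable L (\<lambda>x. w x * exp (a * u x) * exp (- s * q x))"
  proof (rule integrable_weight_mult[OF _ s, where K = 1])
    fix x assume x: "x \<in> space L"
    have "\<bar>u x\<bar> \<le> sqrt (q x)" using uq[of x] by (intro real_le_rsqrt) simp
    then have "\<bar>a\<bar> * \<bar>u x\<bar> \<le> \<bar>a\<bar> * sqrt (q x)" by (intro mult_left_mono) auto
    then have "a * u x \<le> \<bar>a\<bar> * sqrt (q x)" by (metis abs_ge_self abs_mult order_trans)
    then have "\<bar>w x\<bar> * exp (a * u x) \<le> 1 * exp (\<bar>a\<bar> * sqrt (q x))"
      using w1[OF x] by (intro mult_mono) auto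
    then show "\<bar>w x * exp (a * u x)\<bar> \<le> 1 * exp (\<bar>a\<bar> * sqrt (q x))" by (simp add: abs_mult)
  qed measurable
  \<comment> \<open>Both factors change sign on the boundary of the region: outside the acceptance
    interval \<phi> = 1 and exp is above its chord, inside \<phi> = 0 and exp is below. For q = 0
    also u = 0, and the second factor vanishes.\<close>
  have "AE x in L. 0 \<le> w x * (exp (a * u x) - k0 a x - u x * k1 a x / c) * exp (- s * q x)"
    using \<phi>
  proof (rule AE_mp, intro AE_I2 impI)
    fix x assume x: "x \<in> space L" and \<phi>x: "\<phi> x = indicator {x. c * sqrt (q x) < \<bar>u x\<bar>} x"
    have "0 \<le> w x * (exp (a * u x) - k0 a x - u x * k1 a x / c)"
    proof (cases "q x = 0")
      case True
      then have "u x = 0" using uq[of x] by simp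
      then show ?thesis using True by (simp add: k0_def)
    next
      case False
      then have v: "0 < c * sqrt (q x)" using q_nonneg[of x] c by simp
      have e: "k0 a x + u x * k1 a x / c = cosh (a * (c * sqrt (q x))) + sinh (a * (c * sqrt (q x))) / (c * sqrt (q x)) * u x"
        using False by (simp add: k0_def k1_def mult_ac)
      show ?thesis
      proof (cases "c * sqrt (q x) < \<bar>u x\<bar>")
        case True
        then have "0 \<le> w x" using \<phi>x \<psi>01[OF x] by (simp add: w_def)
        moreover have "0 \<le> exp (a * u x) - k0 a x - u x * k1 a x / c"
          using exp_affine_chord_ge[OF v, of "u x" a] True e by simp
        ultimately show ?thesis by simp
      next
        case nT: False
        then have "w x \<le> 0" using \<phi>x \<psi>01[OF x] by (simp add: w_def)
        moreover have "exp (a * u x) - k0 a x - u x * k1 a x / c \<le> 0"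
          using exp_affine_chord_le[OF v, of "u x" a] nT e by simp
        ultimately show ?thesis by (rule mult_nonpos_nonpos)
      qed
    qed
    then show "0 \<le> w x * (exp (a * u x) - k0 a x - u x * k1 a x / c) * exp (- s * q x)" by simp
  qed
  then have "0 \<le> (\<integral>x. w x * (exp (a * u x) - k0 a x - u x * k1 a x / c) * exp (- s * q x) \<partial>L)"
    by (rule integral_nonneg_AE)
  also have "\<dots> = (\<integral>x. w x * exp (a * u x) * exp (- s * q x) - w x * k0 a x * exp (- s * q x)
      - 1 / c * (w x * u x * k1 a x * exp (- s * q x)) \<partial>L)"
    by (intro Bochner_Integration.integral_cong refl) (simp add: algebra_simps)
  also have "\<dots> = (\<integral>x. w x * exp (a * u x) * exp (- s * q x) \<partial>L)"
    using ie ik0[of a] ik1[of a] z0 z1 by simp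
  finally show ?thesis unfolding w_def .
qed

end

section \<open>Normal vectors, Student and chi-square laws\<close>

lemma prob_space_normal_law: "0 < \<sigma> \<Longrightarrow> prob_space (normal_law \<mu> \<sigma>)"
  unfolding normal_law_def by (simp add: prob_space_normal_density)

lemma sets_normal_law[simp, measurable_cong]: "sets (normal_law \<mu> \<sigma>) = sets borel"
  by (simp add: normal_law_def)

lemma space_normal_law[simp]: "space (normal_law \<mu> \<sigma>) = UNIV"
  by (simp add: normal_law_def)

lemma normal_law_affine:
  assumes "0 < \<alpha>"
  shows "distr (normal_law 0 1) borel (\<lambda>x. \<alpha> * x + \<mu>) = density lborel (normal_density \<mu> \<alpha>)"
proof -
  interpret prob_space std_normal_distribution by (rule prob_space_normal_density) simp
  have "distributed std_normal_distribution lborel (\<lambda>x. x) std_normal_density"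
    by (auto simp: distributed_def distr_id2)
  then have "distributed std_normal_distribution lborel (\<lambda>x. \<mu> + \<alpha> * x) (normal_density (\<mu> + \<alpha> * 0) (\<bar>\<alpha>\<bar> * 1))"
    by (rule normal_density_affine) (use assms in auto)
  then have "distr std_normal_distribution lborel (\<lambda>x. \<alpha> * x + \<mu>) = density lborel (normal_density \<mu> \<alpha>)"
    using assms by (simp add: distributed_def add.commute)
  moreover have "distr std_normal_distribution lborel (\<lambda>x. \<alpha> * x + \<mu>) = distr std_normal_distribution borel (\<lambda>x. \<alpha> * x + \<mu>)"
    by (rule distr_cong) auto
  ultimately show ?thesis by (simp add: normal_law_def)
qed

lemma normal_law_reflect: "distr (normal_law 0 1) borel uminus = normal_law 0 1"
proof -
  interpret prob_space std_normal_distribution by (rule prob_space_normal_density) simp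
  have "distributed std_normal_distribution lborel (\<lambda>x. x) std_normal_density"
    by (auto simp: distributed_def distr_id2)
  then have "distributed std_normal_distribution lborel (\<lambda>x. 0 + (- 1) * x) (normal_density (0 + (- 1) * 0) (\<bar>- 1\<bar> * 1))"
    by (rule normal_density_affine) auto
  then have "distr std_normal_distribution lborel uminus = std_normal_distribution"
    by (simp add: distributed_def)
  moreover have "distr std_normal_distribution lborel uminus = distr std_normal_distribution borel uminus"
    by (rule distr_cong) auto
  ultimately show ?thesis by (simp add: normal_law_def)
qed

lemma AE_normal_law_not_in_finite:
  assumes "finite F" shows "AE x in normal_law 0 1. x \<notin> F"
proof -
  have "AE x in lborel. x \<notin> F" by (rule AE_not_in[OF finite_imp_null_set_lborel[OF assms]])
  then show ?thesis unfolding normal_law_def by (auto simp: AE_density)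
qed

lemma distr_PiM_coordinatewise:
  assumes I: "finite I" and M: "\<And>i. prob_space (M i)" and M': "\<And>i. sigma_finite_measure (distr (M i) (M' i) (f i))"
    and f[measurable]: "\<And>i. f i \<in> measurable (M i) (M' i)"
  shows "distr (PiM I M) (PiM I M') (\<lambda>w. \<lambda>i\<in>I. f i (w i)) = PiM I (\<lambda>i. distr (M i) (M' i) (f i))"
proof -
  interpret M: product_prob_space M I by (rule product_prob_spaceI) (rule M)
  interpret D: product_sigma_finite "\<lambda>i. distr (M i) (M' i) (f i)"
    by (simp add: product_sigma_finite_def M')
  show ?thesis
  proof (rule D.PiM_eqI[OF I])
    show "sets (distr (PiM I M) (PiM I M') (\<lambda>w. \<lambda>i\<in>I. f i (w i))) = sets (PiM I (\<lambda>i. distr (M i) (M' i) (f i)))"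
      by (simp cong: sets_PiM_cong)
    fix A assume A: "\<And>i. i \<in> I \<Longrightarrow> A i \<in> sets (distr (M i) (M' i) (f i))"
    have "emeasure (distr (PiM I M) (PiM I M') (\<lambda>w. \<lambda>i\<in>I. f i (w i))) (Pi\<^sub>E I A) =
        emeasure (PiM I M) ((\<lambda>w. \<lambda>i\<in>I. f i (w i)) -` Pi\<^sub>E I A \<inter> space (PiM I M))"
      by (rule emeasure_distr) (use A I in \<open>auto intro!: sets_PiM_I_finite measurable_restrict\<close>)
    also have "(\<lambda>w. \<lambda>i\<in>I. f i (w i)) -` Pi\<^sub>E I A \<inter> space (PiM I M) = Pi\<^sub>E I (\<lambda>i. f i -` A i \<inter> space (M i))"
      by (auto simp: space_PiM PiE_iff extensional_def)
    also have "emeasure (PiM I M) \<dots> = (\<Prod>i\<in>I. emeasure (M i) (f i -` A i \<inter> space (M i)))"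
      by (rule M.emeasure_PiM[OF I]) (use A in auto)
    also have "\<dots> = (\<Prod>i\<in>I. emeasure (distr (M i) (M' i) (f i)) (A i))"
      using A by (intro prod.cong refl) (simp add: emeasure_distr)
    finally show "emeasure (distr (PiM I M) (PiM I M') (\<lambda>w. \<lambda>i\<in>I. f i (w i))) (Pi\<^sub>E I A) =
      (\<Prod>i\<in>I. emeasure (distr (M i) (M' i) (f i)) (A i))" .
  qed
qed

lemma density_PiM:
  fixes f :: "'i \<Rightarrow> 'a \<Rightarrow> real"
  assumes I: "finite I" and M: "\<And>i. sigma_finite_measure (M i)"
    and f[measurable]: "\<And>i. f i \<in> borel_measurable (M i)" and f0: "\<And>i x. 0 \<le> f i x"
    and D: "\<And>i. sigma_finite_measure (density (M i) (f i))"
  shows "PiM I (\<lambda>i. density (M i) (f i)) = density (PiM I M) (\<lambda>x. \<Prod>i\<in>I. f i (x i))"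
proof -
  interpret M: product_sigma_finite M by (simp add: product_sigma_finite_def M)
  interpret D: product_sigma_finite "\<lambda>i. density (M i) (f i)" by (simp add: product_sigma_finite_def D)
  have fm: "(\<lambda>x. \<Prod>i\<in>I. f i (x i)) \<in> borel_measurable (PiM I M)" by measurable
  show ?thesis
  proof (rule D.PiM_eqI[OF I, symmetric])
    show "sets (density (PiM I M) (\<lambda>x. \<Prod>i\<in>I. f i (x i))) = sets (PiM I (\<lambda>i. density (M i) (f i)))"
      by (simp cong: sets_PiM_cong)
    fix A assume A: "\<And>i. i \<in> I \<Longrightarrow> A i \<in> sets (density (M i) (f i))"
    have "emeasure (density (PiM I M) (\<lambda>x. \<Prod>i\<in>I. f i (x i))) (Pi\<^sub>E I A) =
        (\<integral>\<^sup>+x. ennreal (\<Prod>i\<in>I. f i (x i)) * indicator (Pi\<^sub>E I A) x \<partial>PiM I M)"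
      by (rule emeasure_density) (use A I fm in \<open>auto intro!: sets_PiM_I_finite\<close>)
    also have "\<dots> = (\<integral>\<^sup>+x. (\<Prod>i\<in>I. ennreal (f i (x i)) * indicator (A i) (x i)) \<partial>PiM I M)"
    proof (rule nn_integral_cong)
      fix x assume "x \<in> space (PiM I M)"
      then have "indicator (Pi\<^sub>E I A) x = (\<Prod>i\<in>I. indicator (A i) (x i) :: ennreal)"
        using I by (cases "\<forall>i\<in>I. x i \<in> A i") (auto simp: space_PiM PiE_iff indicator_def)
      then show "ennreal (\<Prod>i\<in>I. f i (x i)) * indicator (Pi\<^sub>E I A) x =
          (\<Prod>i\<in>I. ennreal (f i (x i)) * indicator (A i) (x i))"
        using f0 by (simp add: prod_ennreal prod.distrib)
    qed
    also have "\<dots> = (\<Prod>i\<in>I. \<integral>\<^sup>+x. ennreal (f i x) * indicator (A i) x \<partial>M i)"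
      by (rule M.product_nn_integral_prod[OF I]) (use A in auto)
    also have "\<dots> = (\<Prod>i\<in>I. emeasure (density (M i) (f i)) (A i))"
      using A by (intro prod.cong refl) (simp add: emeasure_density)
    finally show "emeasure (density (PiM I M) (\<lambda>x. \<Prod>i\<in>I. f i (x i))) (Pi\<^sub>E I A) =
      (\<Prod>i\<in>I. emeasure (density (M i) (f i)) (A i))" .
  qed
qed

text \<open>Fubini with the integral over coordinate i innermost: a set whose fibres in that
  direction are all null is null.\<close>

lemma (in product_sigma_finite) AE_PiM_fibre:
  assumes I: "finite I" "i \<in> I" and P[measurable]: "Measurable.pred (PiM I M) P"
    and AE: "\<And>x. AE y in M i. P (x(i := y))"
  shows "AE x in PiM I M. P x"
proof -
  have I_eq: "insert i (I - {i}) = I" using I by auto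
  have [measurable]: "(\<lambda>x. indicator {x. \<not> P x} x :: ennreal) \<in> borel_measurable (PiM I M)"
    by measurable
  have "(\<integral>\<^sup>+x. indicator {x. \<not> P x} x \<partial>PiM I M) =
      (\<integral>\<^sup>+x. (\<integral>\<^sup>+y. indicator {x. \<not> P x} (x(i := y)) \<partial>M i) \<partial>PiM (I - {i}) M)"
    using product_nn_integral_insert[of "I - {i}" i "\<lambda>x. indicator {x. \<not> P x} x"] I unfolding I_eq by simp
  also have "\<dots> = (\<integral>\<^sup>+x. 0 \<partial>PiM (I - {i}) M)"
  proof (rule nn_integral_cong)
    fix x
    have "(\<integral>\<^sup>+y. indicator {x. \<not> P x} (x(i := y)) \<partial>M i) = (\<integral>\<^sup>+y. 0 \<partial>M i)"
      by (rule nn_integral_cong_AE) (use AE[of x] in eventually_elim, simp)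
    then show "(\<integral>\<^sup>+y. indicator {x. \<not> P x} (x(i := y)) \<partial>M i) = 0" by simp
  qed
  finally have "(\<integral>\<^sup>+x. indicator {x. \<not> P x} x \<partial>PiM I M) = 0" by simp
  then have "AE x in PiM I M. indicator {x. \<not> P x} x = (0 :: ennreal)"
    by (subst (asm) nn_integral_0_iff_AE) auto
  then show ?thesis by eventually_elim (auto simp: indicator_def split: if_splits)
qed

section \<open>Quantiles of atomless laws\<close>

lemma (in real_distribution) cdf_quantile:
  assumes atom: "\<And>x. measure M {x} = 0" and p: "0 < p" "p < 1"
  shows "cdf M (quantile M p) = p"
proof -
  \<comment> \<open>Continuity serves twice: the value p is attained, and the set in
    \<open>quantile\<close> is closed, so its infimum belongs to it.\<close>
  have cont: "isCont (cdf M) x" for x using atom by (simp add: isCont_cdf)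
  obtain a where a: "cdf M a < p"
    using eventually_happens[OF order_tendstoD(2)[OF cdf_lim_at_bot p(1)]] by auto
  obtain b where b: "p < cdf M b"
    using eventually_happens[OF order_tendstoD(1)[OF cdf_lim_at_top_prob p(2)]] by auto
  have "a \<le> b" using a b cdf_nondecreasing[of b a] by (cases "a \<le> b") auto
  then obtain x where x: "cdf M x = p"
    using IVT[of "cdf M" a p b] a b cont by auto
  let ?S = "{x. p \<le> cdf M x}"
  have bdd: "bdd_below ?S"
  proof (rule bdd_belowI)
    fix y assume "y \<in> ?S"
    then show "a \<le> y" using a cdf_nondecreasing[of y a] by (cases "a \<le> y") auto
  qed
  have "closed ?S"
    using cont by (intro closed_Collect_le continuous_on_const continuous_at_imp_continuous_on) auto
  then have "Inf ?S \<in> ?S" using x bdd by (intro closed_contains_Inf) auto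
  moreover have "cdf M (Inf ?S) \<le> cdf M x"
    by (intro cdf_nondecreasing cInf_lower) (use x bdd in auto)
  ultimately show ?thesis using x by (simp add: quantile_def)
qed

lemma (in real_distribution) measure_greaterThan_cdf: "measure M {x<..} = 1 - cdf M x"
proof -
  have "{x<..} = space M - {..x}" by auto
  then show ?thesis using prob_compl[of "{..x}"] by (simp add: cdf_def)
qed

lemma (in real_distribution) measure_outside_quantiles:
  assumes atom: "\<And>x. measure M {x} = 0" and p: "0 < p" "p < 1"
  shows "measure M {x. x \<notin> {quantile M (p / 2)..quantile M (1 - p / 2)}} = p"
proof -
  let ?a = "quantile M (p / 2)" and ?b = "quantile M (1 - p / 2)"
  have a: "cdf M ?a = p / 2" and b: "cdf M ?b = 1 - p / 2"
    using p cdf_quantile[OF atom, of "p / 2"] cdf_quantile[OF atom, of "1 - p / 2"] by simp_all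
  have "?a \<le> ?b" using a b p cdf_nondecreasing[of ?b ?a] by (cases "?a \<le> ?b") auto
  then have "{x. x \<notin> {?a..?b}} = {..<?a} \<union> {?b<..}" "{..<?a} \<inter> {?b<..} = {}" by auto
  then have "measure M {x. x \<notin> {?a..?b}} = measure M {..<?a} + measure M {?b<..}"
    by (simp add: finite_measure_Union)
  moreover have "measure M {..?a} = measure M {..<?a} + measure M {?a}"
    by (subst finite_measure_Union[symmetric]) (auto intro!: arg_cong[where f = "measure M"])
  ultimately show ?thesis using a b atom measure_greaterThan_cdf[of ?b] by (simp add: cdf_def)
qed

text \<open>Symmetry gives \<open>cdf M 0 = 1 / 2\<close>, which is less than 1 - p / 2, so the
  quantile is positive. The two tails are then disjoint and of equal mass p / 2.\<close>

lemma (in real_distribution) symmetric_two_sided: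
  assumes atom: "\<And>x. measure M {x} = 0" and sym: "distr M borel uminus = M" and p: "0 < p" "p < 1"
  shows "0 < quantile M (1 - p / 2)" and "measure M {x. quantile M (1 - p / 2) < \<bar>x\<bar>} = p"
proof -
  let ?b = "quantile M (1 - p / 2)"
  have b: "cdf M ?b = 1 - p / 2" using p by (auto intro!: cdf_quantile atom)
  have refl: "measure M A = measure M (uminus -` A)" if "A \<in> sets borel" for A
  proof -
    have "measure (distr M borel uminus) A = measure M (uminus -` A \<inter> space M)"
      using that by (intro measure_distr) auto
    then show ?thesis by (simp add: sym)
  qed
  have "uminus -` {..<- x} = {x<..}" for x :: real by auto
  then have lt: "measure M {..<- x} = measure M {x<..}" for x using refl[of "{..<- x}"] by simp
  have "measure M {..0} = measure M {..<0} + measure M {0}"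
    by (subst finite_measure_Union[symmetric]) (auto intro!: arg_cong[where f = "measure M"])
  then have "cdf M 0 = 1 / 2" using lt[of 0] measure_greaterThan_cdf[of 0] atom by (simp add: cdf_def)
  then show b0: "0 < ?b" using b p cdf_nondecreasing[of ?b 0] by (cases "0 < ?b") auto
  then have "{x. ?b < \<bar>x\<bar>} = {..<- ?b} \<union> {?b<..}" "{..<- ?b} \<inter> {?b<..} = {}" by auto
  then have "measure M {x. ?b < \<bar>x\<bar>} = measure M {..<- ?b} + measure M {?b<..}"
    by (simp add: finite_measure_Union)
  then show "measure M {x. ?b < \<bar>x\<bar>} = p" using b lt measure_greaterThan_cdf[of ?b] by simp
qed

section \<open>Null sets of the standard normal vector\<close>

abbreviation std_normal_vector :: "nat \<Rightarrow> (nat \<Rightarrow> real) measure" where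
  "std_normal_vector n \<equiv> (\<Pi>\<^sub>M i\<in>{..<n}. normal_law 0 1)"

lemma prob_space_std_normal_vector: "prob_space (std_normal_vector n)"
  by (intro prob_space_PiM prob_space_normal_law) simp

lemma std_normal_vector_reflect:
  assumes "k < n"
  shows "distr (std_normal_vector n) (obs_space n) (\<lambda>w. \<lambda>i\<in>{..<n}. if i = k then - w i else w i) = std_normal_vector n"
proof -
  have d: "distr (normal_law 0 1) borel (if i = k then uminus else (\<lambda>x. x)) = normal_law 0 1" for i
    by (simp add: normal_law_reflect distr_id2)
  have "(\<lambda>w::nat \<Rightarrow> real. \<lambda>i\<in>{..<n}. if i = k then - w i else w i) = (\<lambda>w. \<lambda>i\<in>{..<n}. (if i = k then uminus else (\<lambda>x. x)) (w i))"
    by (intro ext) (simp add: restrict_def)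
  moreover have "distr (std_normal_vector n) (obs_space n) (\<lambda>w. \<lambda>i\<in>{..<n}. (if i = k then uminus else (\<lambda>x. x)) (w i)) =
      (\<Pi>\<^sub>M i\<in>{..<n}. distr (normal_law 0 1) borel (if i = k then uminus else (\<lambda>x. x)))"
    unfolding obs_space_def
    by (rule distr_PiM_coordinatewise)
      (auto simp: d prob_space_normal_law intro: prob_space_imp_sigma_finite)
  ultimately show ?thesis by (simp add: d)
qed

text \<open>With the other coordinates fixed, failure at finitely many values of coordinate k is a
  null event, as the normal law charges no finite set.\<close>

lemma AE_std_normal_vector_fibre:
  assumes "k < n" "Measurable.pred (std_normal_vector n) P" "\<And>x. finite {y. \<not> P (x(k := y))}"
  shows "AE w in std_normal_vector n. P w"
proof -
  interpret product_sigma_finite "\<lambda>_::nat. normal_law 0 1"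
    by (simp add: product_sigma_finite_def prob_space_imp_sigma_finite prob_space_normal_law)
  show ?thesis
  proof (rule AE_PiM_fibre)
    fix x show "AE y in normal_law 0 1. P (x(k := y))"
      using AE_normal_law_not_in_finite[OF assms(3)[of x]] by simp
  qed (use assms in auto)
qed

lemma AE_sum_squares_neq:
  assumes "0 < k" "k \<le> n"
  shows "AE w in std_normal_vector n. (\<Sum>i<k. (w i)\<^sup>2) \<noteq> x"
proof (rule AE_std_normal_vector_fibre[of 0])
  fix w :: "nat \<Rightarrow> real"
  let ?r = "\<Sum>i\<in>{..<k} - {0}. (w i)\<^sup>2"
  have "(\<Sum>i<k. ((w(0 := y)) i)\<^sup>2) = y\<^sup>2 + ?r" for y
    using assms by (subst sum.remove[of _ 0]) (auto intro!: sum.cong)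
  then have "{y. \<not> (\<Sum>i<k. ((w(0 := y)) i)\<^sup>2) \<noteq> x} \<subseteq> {sqrt (x - ?r), - sqrt (x - ?r)}"
    by (auto simp: real_sqrt_unique)
  then show "finite {y. \<not> (\<Sum>i<k. ((w(0 := y)) i)\<^sup>2) \<noteq> x}" by (rule finite_subset) simp
qed (use assms in auto)

text \<open>Clearing the denominator leaves an equation linear in \<open>w k\<close>, with a single
  root. A zero sum of squares has to be excluded separately, because division by 0 gives the value 0
  and would produce equality for x = 0.\<close>

lemma AE_student_neq:
  assumes "0 < k"
  shows "AE w in std_normal_vector (Suc k). w k / sqrt ((\<Sum>i<k. (w i)\<^sup>2) / real k) \<noteq> x"
proof -
  have "AE w in std_normal_vector (Suc k). w k - x * sqrt ((\<Sum>i<k. (w i)\<^sup>2) / real k) \<noteq> 0"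
  proof (rule AE_std_normal_vector_fibre[of k])
    show "Measurable.pred (std_normal_vector (Suc k)) (\<lambda>w. w k - x * sqrt ((\<Sum>i<k. (w i)\<^sup>2) / real k) \<noteq> 0)"
      by measurable
  qed auto
  moreover have "AE w in std_normal_vector (Suc k). (\<Sum>i<k. (w i)\<^sup>2) \<noteq> 0"
    by (rule AE_sum_squares_neq) (use assms in auto)
  ultimately show ?thesis
    by eventually_elim (use assms in \<open>auto simp: divide_eq_eq\<close>)
qed

section \<open>Exact probabilities of the two critical regions\<close>

lemma student_law_eq:
  "student_law k = distr (std_normal_vector (Suc k)) borel (\<lambda>w. w k / sqrt ((\<Sum>i<k. (w i)\<^sup>2) / real k))"
  by (simp add: student_law_def lessThan_Suc_atMost)

lemma student_statistic_measurable[measurable]: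
  "(\<lambda>w. w k / sqrt ((\<Sum>i<k. (w i)\<^sup>2) / real k)) \<in> borel_measurable (std_normal_vector (Suc k))"
  by measurable

lemma chi_square_statistic_measurable[measurable]:
  "k \<le> n \<Longrightarrow> (\<lambda>w. \<Sum>i<k. (w i)\<^sup>2) \<in> borel_measurable (std_normal_vector n)"
  by measurable

lemma real_distribution_student_law: "real_distribution (student_law k)"
  unfolding student_law_eq
  by (intro prob_space.real_distribution_distr prob_space_std_normal_vector student_statistic_measurable)

lemma real_distribution_chi_square_law: "real_distribution (chi_square_law k)"
  unfolding chi_square_law_def
  by (intro prob_space.real_distribution_distr prob_space_std_normal_vector chi_square_statistic_measurable) simp

lemma student_law_no_atoms:
  assumes "0 < k" shows "measure (student_law k) {x} = 0"
proof -
  have "AE t in student_law k. t \<noteq> x"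
    unfolding student_law_eq by (subst AE_distr_iff) (use AE_student_neq[OF assms] in auto)
  then have "emeasure (student_law k) {x} = 0"
    by (subst (asm) AE_iff_measurable[of "{x}"])
      (auto simp: real_distribution.axioms student_law_def)
  then show ?thesis by (simp add: measure_def)
qed

lemma chi_square_law_no_atoms:
  assumes "0 < k" shows "measure (chi_square_law k) {x} = 0"
proof -
  have "AE t in chi_square_law k. t \<noteq> x"
    unfolding chi_square_law_def by (subst AE_distr_iff) (use AE_sum_squares_neq[OF assms] in auto)
  then have "emeasure (chi_square_law k) {x} = 0"
    by (subst (asm) AE_iff_measurable[of "{x}"]) (auto simp: chi_square_law_def)
  then show ?thesis by (simp add: measure_def)
qed

lemma student_law_symmetric: "distr (student_law k) borel uminus = student_law k"
proof -
  let ?T = "\<lambda>w. w k / sqrt ((\<Sum>i<k. (w i)\<^sup>2) / real k)"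
  let ?R = "\<lambda>w. \<lambda>i\<in>{..<Suc k}. if i = k then - w i else w i :: real"
  have R[measurable]: "?R \<in> measurable (std_normal_vector (Suc k)) (obs_space (Suc k))"
    unfolding obs_space_def by (rule measurable_restrict) simp
  have T[measurable]: "?T \<in> borel_measurable (obs_space (Suc k))"
    unfolding obs_space_def by measurable
  have "distr (student_law k) borel uminus = distr (std_normal_vector (Suc k)) borel (\<lambda>w. - ?T w)"
    unfolding student_law_eq by (subst distr_distr) (auto simp: comp_def)
  also have "(\<lambda>w. - ?T w) = ?T \<circ> ?R" by (auto simp: fun_eq_iff)
  also have "distr (std_normal_vector (Suc k)) borel (?T \<circ> ?R) = distr (distr (std_normal_vector (Suc k)) (obs_space (Suc k)) ?R) borel ?T"
    by (rule distr_distr[symmetric]) auto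
  also have "\<dots> = student_law k" by (subst std_normal_vector_reflect) (auto simp: student_law_eq)
  finally show ?thesis .
qed

lemma student_two_sided:
  assumes "0 < k" "0 < \<beta>" "\<beta> < 1"
  defines "t \<equiv> quantile (student_law k) (1 - \<beta> / 2)"
  shows "0 < t"
    and "measure (std_normal_vector (Suc k)) {w \<in> space (obs_space (Suc k)). t < \<bar>w k / sqrt ((\<Sum>i<k. (w i)\<^sup>2) / real k)\<bar>} = \<beta>"
proof -
  interpret real_distribution "student_law k" by (rule real_distribution_student_law)
  note ts = symmetric_two_sided[OF student_law_no_atoms[OF assms(1)] student_law_symmetric assms(2,3)]
  show "0 < t" unfolding t_def by (rule ts)
  have "measure (student_law k) {x. t < \<bar>x\<bar>} = \<beta>" unfolding t_def by (rule ts)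
  then show "measure (std_normal_vector (Suc k)) {w \<in> space (obs_space (Suc k)). t < \<bar>w k / sqrt ((\<Sum>i<k. (w i)\<^sup>2) / real k)\<bar>} = \<beta>"
    unfolding student_law_eq
    by (subst (asm) measure_distr) (auto simp: obs_space_def space_PiM vimage_def Int_def conj_commute)
qed

lemma chi_square_two_sided:
  assumes "0 < k" "k \<le> n" "0 < \<beta>" "\<beta> < 1"
  shows "measure (std_normal_vector n) {w \<in> space (obs_space n). (\<Sum>i<k. (w i)\<^sup>2) \<notin>
    {quantile (chi_square_law k) (\<beta> / 2)..quantile (chi_square_law k) (1 - \<beta> / 2)}} = \<beta>"
proof -
  interpret real_distribution "chi_square_law k" by (rule real_distribution_chi_square_law)
  interpret P: product_prob_space "\<lambda>_::nat. normal_law 0 1" "{..<n}"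
    by (rule product_prob_spaceI) (simp add: prob_space_normal_law)
  let ?A = "{x. x \<notin> {quantile (chi_square_law k) (\<beta> / 2)..quantile (chi_square_law k) (1 - \<beta> / 2)}}"
  have A[measurable]: "?A \<in> sets borel" by measurable
  \<comment> \<open>\<open>chi_square_law\<close> lives on k coordinates while the sample has n; the
    marginal of a product of probability measures is the smaller product.\<close>
  have "distr (std_normal_vector n) borel (\<lambda>w. \<Sum>i<k. (w i)\<^sup>2) =
      distr (distr (std_normal_vector n) (std_normal_vector k) (\<lambda>w. restrict w {..<k})) borel (\<lambda>w. \<Sum>i<k. (w i)\<^sup>2)"
    using assms by (subst distr_distr) (auto simp: comp_def intro!: measurable_restrict_subset)
  also have "distr (std_normal_vector n) (std_normal_vector k) (\<lambda>w. restrict w {..<k}) = std_normal_vector k"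
    by (rule P.distr_PiM_restrict_finite) (use assms in auto)
  finally have D: "distr (std_normal_vector n) borel (\<lambda>w. \<Sum>i<k. (w i)\<^sup>2) = chi_square_law k"
    by (simp add: chi_square_law_def)
  have "measure (distr (std_normal_vector n) borel (\<lambda>w. \<Sum>i<k. (w i)\<^sup>2)) ?A = \<beta>"
    unfolding D by (rule measure_outside_quantiles[OF chi_square_law_no_atoms[OF assms(1)] assms(3,4)])
  then show ?thesis
    using assms by (subst (asm) measure_distr) (auto simp: obs_space_def space_PiM vimage_def Int_def conj_commute)
qed

section \<open>The law of the observations\<close>

text \<open>The characteristic function at frequency 1 is enough, since any frequency can be
  absorbed into the coefficients of a linear combination. For a centred degenerate law both sides
  are 1.\<close>

lemma (in prob_space) gaussian_rv_moments:
  assumes X: "gaussian_rv M X"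
  shows "integrable M X" "integrable M (\<lambda>x. (X x)\<^sup>2)"
    and "expectation X = 0 \<Longrightarrow> char (distr M borel X) 1 = of_real (exp (- expectation (\<lambda>x. (X x)\<^sup>2) / 2))"
proof -
  from X obtain \<mu> \<sigma> where Xm[measurable]: "X \<in> borel_measurable M" and \<sigma>: "0 \<le> \<sigma>"
    and law: "distr M borel X = normal_law \<mu> \<sigma>" by (auto simp: gaussian_rv_def)
  have "integrable M X \<and> integrable M (\<lambda>x. (X x)\<^sup>2) \<and> (expectation X = 0 \<longrightarrow>
      char (distr M borel X) 1 = of_real (exp (- expectation (\<lambda>x. (X x)\<^sup>2) / 2)))"
  proof (cases "\<sigma> = 0")
    case True
    then have "AE x in distr M borel X. x = \<mu>" unfolding law normal_law_def by (simp add: AE_return)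
    then have ae: "AE x in M. X x = \<mu>" by (subst (asm) AE_distr_iff) auto
    then have ae2: "AE x in M. (X x)\<^sup>2 = \<mu>\<^sup>2" by eventually_elim simp
    have 1: "integrable M X" using ae by (subst integrable_cong_AE[of _ _ "\<lambda>_. \<mu>"]) auto
    have 2: "integrable M (\<lambda>x. (X x)\<^sup>2)" using ae2 by (subst integrable_cong_AE[of _ _ "\<lambda>_. \<mu>\<^sup>2"]) auto
    have "expectation X = expectation (\<lambda>_. \<mu>)" using ae by (intro integral_cong_AE) auto
    then have eX: "expectation X = \<mu>" by (simp add: prob_space)
    have "expectation (\<lambda>x. (X x)\<^sup>2) = expectation (\<lambda>_. \<mu>\<^sup>2)" using ae2 by (intro integral_cong_AE) auto
    then have eX2: "expectation (\<lambda>x. (X x)\<^sup>2) = \<mu>\<^sup>2" by (simp add: prob_space)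
    have "char (distr M borel X) 1 = 1" if "\<mu> = 0"
      unfolding law char_def using True that by (simp add: normal_law_def integral_return)
    then show ?thesis using 1 2 eX eX2 by auto
  next
    case False
    then have \<sigma>0: "0 < \<sigma>" using \<sigma> by simp
    have "distr M lborel X = distr M borel X" by (rule distr_cong) auto
    then have D: "distributed M lborel X (normal_density \<mu> \<sigma>)"
      using law False by (simp add: distributed_def normal_law_def)
    have eX: "expectation X = \<mu>" by (rule normal_distributed_expectation[OF \<sigma>0 D])
    have 1: "integrable M X"
      using integrable_normal_moment_nz_1[OF \<sigma>0, of \<mu>] distributed_integrable[OF D, of "\<lambda>x. x"] by simp
    have "integrable M (\<lambda>x. (X x - \<mu>)\<^sup>2)"
      using integrable_normal_moment[OF \<sigma>0, of \<mu> 2] distributed_integrable[OF D, of "\<lambda>x. (x - \<mu>)\<^sup>2"] by simp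
    then have "integrable M (\<lambda>x. (X x - \<mu>)\<^sup>2 + 2 * \<mu> * X x - \<mu>\<^sup>2)" using 1 by auto
    then have 2: "integrable M (\<lambda>x. (X x)\<^sup>2)" by (simp add: power2_diff algebra_simps)
    have "char (distr M borel X) 1 = of_real (exp (- expectation (\<lambda>x. (X x)\<^sup>2) / 2))" if "\<mu> = 0"
    proof -
      have v: "expectation (\<lambda>x. (X x)\<^sup>2) = \<sigma>\<^sup>2"
        using normal_distributed_variance[OF \<sigma>0 D] eX that by simp
      have "distributed M lborel (\<lambda>x. (X x - \<mu>) / \<sigma>) std_normal_density"
        using D normal_standard_normal_convert[OF \<sigma>0] by blast
      then have "distr M lborel (\<lambda>x. X x / \<sigma>) = std_normal_distribution"
        using that by (simp add: distributed_def)
      moreover have "distr M lborel (\<lambda>x. X x / \<sigma>) = distr M borel (\<lambda>x. X x / \<sigma>)" by (rule distr_cong) auto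
      ultimately have "char (distr M borel (\<lambda>x. X x / \<sigma>)) \<sigma> = of_real (exp (- \<sigma>\<^sup>2 / 2))"
        by (simp add: char_std_normal_distribution)
      moreover have "char (distr M borel (\<lambda>x. X x / \<sigma>)) \<sigma> = char (distr M borel X) 1"
        using \<sigma>0 unfolding char_def by (simp add: integral_distr)
      ultimately show ?thesis using v by simp
    qed
    then show ?thesis using 1 2 eX by auto
  qed
  then show "integrable M X" "integrable M (\<lambda>x. (X x)\<^sup>2)"
    "expectation X = 0 \<Longrightarrow> char (distr M borel X) 1 = of_real (exp (- expectation (\<lambda>x. (X x)\<^sup>2) / 2))"
    by auto
qed

lemma (in prob_space) fbm_grid_combination:
  assumes B: "fractional_brownian_motion M H B" and h: "0 < h"
  shows "B (grid h (Suc i)) \<in> borel_measurable M"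
    and "char (distr M borel (\<lambda>\<omega>. \<Sum>j<N. a j * B (grid h (Suc j)) \<omega>)) 1 =
      of_real (exp (- (\<Sum>i<N. \<Sum>j<N. a i * a j * fbm_cov H (grid h (Suc i)) (grid h (Suc j))) / 2))"
proof -
  let ?t = "\<lambda>j. grid h (Suc j)"
  have t0: "0 \<le> ?t j" for j using h by (simp add: grid_def)
  have inj: "inj_on ?t {..<N}" for N using h by (auto simp: inj_on_def grid_def)
  have G: "gaussian_process M {0..} B" and E: "expectation (B (?t j)) = 0"
    and C: "expectation (\<lambda>\<omega>. B (?t i) \<omega> * B (?t j) \<omega>) = fbm_cov H (?t i) (?t j)" for i j
    using B t0 by (auto simp: fractional_brownian_motion_def)
  have G1: "gaussian_rv M (\<lambda>\<omega>. \<Sum>j<N. a j * B (?t j) \<omega>)" for a N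
  proof -
    \<comment> \<open>\<open>gaussian_process\<close> sums over sets of times with coefficients
      indexed by time; grid times are distinct because h > 0, so coefficients indexed by position
      can be transported.\<close>
    let ?c = "\<lambda>t. a (inv_into {..<N} ?t t)"
    have "gaussian_rv M (\<lambda>\<omega>. \<Sum>t\<in>?t ` {..<N}. ?c t * B t \<omega>)"
      using G[unfolded gaussian_process_def, rule_format, of "?t ` {..<N}" ?c] t0 by blast
    also have "(\<lambda>\<omega>. \<Sum>t\<in>?t ` {..<N}. ?c t * B t \<omega>) = (\<lambda>\<omega>. \<Sum>j<N. a j * B (?t j) \<omega>)"
      by (intro ext) (simp add: sum.reindex[OF inj] inv_into_f_f[OF inj])
    finally show ?thesis .
  qed
  have Gi: "gaussian_rv M (B (?t j))" for j
  proof -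
    have "gaussian_rv M (\<lambda>\<omega>. \<Sum>l<Suc j. (if l = j then 1 else 0) * B (?t l) \<omega>)" by (rule G1)
    then show ?thesis by (simp add: if_distrib[where f = "\<lambda>c. c * _"] cong: if_cong)
  qed
  show m: "B (?t i) \<in> borel_measurable M" for i using Gi by (simp add: gaussian_rv_def)
  note [measurable] = m
  note int = gaussian_rv_moments(1,2)[OF Gi]
  have int2: "integrable M (\<lambda>\<omega>. B (?t i) \<omega> * B (?t j) \<omega>)" for i j
  proof (rule Bochner_Integration.integrable_bound)
    show "integrable M (\<lambda>\<omega>. (B (?t i) \<omega>)\<^sup>2 + (B (?t j) \<omega>)\<^sup>2)" using int by auto
    have "\<bar>x * y\<bar> \<le> x\<^sup>2 + y\<^sup>2" for x y :: real
    proof -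
      have "0 \<le> (\<bar>x\<bar> - \<bar>y\<bar>)\<^sup>2" "0 \<le> \<bar>x\<bar> * \<bar>y\<bar>" by simp_all
      then show ?thesis unfolding power2_diff power2_abs abs_mult by linarith
    qed
    then show "AE \<omega> in M. norm (B (?t i) \<omega> * B (?t j) \<omega>) \<le> norm ((B (?t i) \<omega>)\<^sup>2 + (B (?t j) \<omega>)\<^sup>2)"
      by simp
  qed measurable
  have "expectation (\<lambda>\<omega>. \<Sum>j<N. a j * B (?t j) \<omega>) = 0"
    using int E by (subst Bochner_Integration.integral_sum) auto
  then have "char (distr M borel (\<lambda>\<omega>. \<Sum>j<N. a j * B (?t j) \<omega>)) 1 =
      of_real (exp (- expectation (\<lambda>\<omega>. (\<Sum>j<N. a j * B (?t j) \<omega>)\<^sup>2) / 2))"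
    by (rule gaussian_rv_moments(3)[OF G1])
  also have "expectation (\<lambda>\<omega>. (\<Sum>j<N. a j * B (?t j) \<omega>)\<^sup>2) =
      expectation (\<lambda>\<omega>. \<Sum>i<N. \<Sum>j<N. a i * a j * (B (?t i) \<omega> * B (?t j) \<omega>))"
    by (simp add: power2_eq_square sum_product mult_ac)
  also have "\<dots> = (\<Sum>i<N. \<Sum>j<N. a i * a j * fbm_cov H (?t i) (?t j))"
    using int2 by (simp add: C)
  finally show "char (distr M borel (\<lambda>\<omega>. \<Sum>j<N. a j * B (?t j) \<omega>)) 1 =
    of_real (exp (- (\<Sum>i<N. \<Sum>j<N. a i * a j * fbm_cov H (?t i) (?t j)) / 2))" .
qed

locale fbm_mixture = prob_space M for M :: "'a measure" +
  fixes m N :: nat and H :: "nat \<Rightarrow> real" and B :: "nat \<Rightarrow> real \<Rightarrow> 'a \<Rightarrow> real" and h :: real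
  assumes h: "0 < h" and m: "1 \<le> m" and H: "\<forall>r\<in>{1..m}. 1/2 < H r \<and> H r < 1"
    and fbm: "\<forall>r\<in>{1..m}. fractional_brownian_motion M (H r) (B r)"
    and indep: "independent_processes M B {1..m}" and N: "2 \<le> N"
begin

definition X :: "nat \<Rightarrow> 'a \<Rightarrow> real" where
  "X i \<omega> = (\<Sum>r=1..m. B r (grid h (Suc i)) \<omega>)"

lemma X_measurable[measurable]: "X i \<in> borel_measurable M"
  unfolding X_def using fbm by (intro borel_measurable_sum fbm_grid_combination(1)[OF _ h]) auto

lemma Gamma_sum_index: "i < N \<Longrightarrow> j < N \<Longrightarrow>
    Gamma_sum m H h N $$ (i, j) = (\<Sum>r=1..m. fbm_cov (H r) (grid h (Suc i)) (grid h (Suc j)))"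
  by (simp add: Gamma_sum_def Gamma_fbm_def)

lemma Gamma_sum_carrier: "Gamma_sum m H h N \<in> carrier_mat N N"
  by (simp add: Gamma_sum_def)

lemma Gamma_sum_symmetric: "transpose_mat (Gamma_sum m H h N) = Gamma_sum m H h N"
  by (rule eq_matI) (auto simp: Gamma_sum_def Gamma_fbm_def fbm_cov_def abs_minus_commute add.commute)

lemma Gamma_sum_form:
  assumes "a \<in> carrier_vec N"
  shows "a \<bullet> (Gamma_sum m H h N *\<^sub>v a) =
    (\<Sum>r=1..m. \<Sum>i<N. \<Sum>j<N. a $ i * a $ j * fbm_cov (H r) (grid h (Suc i)) (grid h (Suc j)))"
proof -
  have "a \<bullet> (Gamma_sum m H h N *\<^sub>v a) = (\<Sum>i<N. a $ i * (\<Sum>j<N. Gamma_sum m H h N $$ (i, j) * a $ j))"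
    using assms Gamma_sum_carrier by (simp add: scalar_prod_def atLeast0LessThan)
  also have "\<dots> = (\<Sum>i<N. \<Sum>j<N. \<Sum>r=1..m. a $ i * a $ j * fbm_cov (H r) (grid h (Suc i)) (grid h (Suc j)))"
    by (intro sum.cong refl) (simp add: sum_distrib_left sum_distrib_right Gamma_sum_index mult_ac)
  also have "\<dots> = (\<Sum>i<N. \<Sum>r=1..m. \<Sum>j<N. a $ i * a $ j * fbm_cov (H r) (grid h (Suc i)) (grid h (Suc j)))"
    by (intro sum.cong refl sum.swap)
  also have "\<dots> = (\<Sum>r=1..m. \<Sum>i<N. \<Sum>j<N. a $ i * a $ j * fbm_cov (H r) (grid h (Suc i)) (grid h (Suc j)))"
    by (rule sum.swap)
  finally show ?thesis .
qed

lemma Gamma_sum_pos_def: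
  assumes a: "a \<in> carrier_vec N" "a \<noteq> 0\<^sub>v N"
  shows "0 < a \<bullet> (Gamma_sum m H h N *\<^sub>v a)"
proof -
  have "\<exists>i<N. a $ i \<noteq> 0" using a by (metis carrier_vecD eq_vecI index_zero_vec)
  then have pos: "0 < (\<Sum>i<N. \<Sum>j<N. a $ i * a $ j * fbm_cov (H r) (grid h (Suc i)) (grid h (Suc j)))" if "r \<in> {1..m}" for r
    using H that h by (intro fbm_cov_grid_pos_def) (auto simp: less_trans[of 0 "1/2"])
  show ?thesis unfolding Gamma_sum_form[OF a(1)] by (rule sum_pos[OF _ _ pos]) (use m in auto)
qed

text \<open>Independence of paths passes to the linear functionals \<open>?V r\<close>. Their
  characteristic functions multiply, so the exponents, and with them the covariance forms, add up to
  \<open>Gamma_sum\<close>.\<close>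

lemma char_linear_combination:
  assumes a: "a \<in> carrier_vec N"
  shows "(CLINT \<omega>|M. iexp (\<Sum>j<N. a $ j * X j \<omega>)) = of_real (exp (- (a \<bullet> (Gamma_sum m H h N *\<^sub>v a)) / 2))"
proof -
  let ?V = "\<lambda>r \<omega>. \<Sum>j<N. a $ j * B r (grid h (Suc j)) \<omega>"
  have g0: "grid h (Suc j) \<in> {0..}" for j using h by (simp add: grid_def)
  have "indep_vars (\<lambda>_. borel) (\<lambda>r \<omega>. \<Sum>j<N. a $ j * (\<lambda>t\<in>{0..}. B r t \<omega>) (grid h (Suc j))) {1..m}"
    using indep unfolding independent_processes_def
    by (rule indep_vars_compose2) (use g0 in measurable)
  then have iv: "indep_vars (\<lambda>_. borel) ?V {1..m}" using g0 by simp
  have Vsum: "(\<Sum>j<N. a $ j * X j \<omega>) = (\<Sum>r\<in>{1..m}. ?V r \<omega>)" for \<omega>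
    unfolding X_def sum_distrib_left by (rule sum.swap)
  have "(CLINT \<omega>|M. iexp (\<Sum>j<N. a $ j * X j \<omega>)) = char (distr M borel (\<lambda>\<omega>. \<Sum>j<N. a $ j * X j \<omega>)) 1"
    unfolding char_def by (subst integral_distr) auto
  also have "\<dots> = (\<Prod>r\<in>{1..m}. char (distr M borel (?V r)) 1)"
    unfolding Vsum by (rule char_distr_sum[OF iv])
  also have "\<dots> = (\<Prod>r\<in>{1..m}. of_real (exp (- (\<Sum>i<N. \<Sum>j<N. a $ i * a $ j * fbm_cov (H r) (grid h (Suc i)) (grid h (Suc j))) / 2)))"
    using fbm by (intro prod.cong refl fbm_grid_combination(2)[OF _ h]) auto
  also have "\<dots> = of_real (exp (- (a \<bullet> (Gamma_sum m H h N *\<^sub>v a)) / 2))"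
    unfolding of_real_prod[symmetric] exp_sum[symmetric, OF finite_atLeastAtMost] Gamma_sum_form[OF a]
    by (simp add: sum_negf sum_divide_distrib)
  finally show ?thesis .
qed

text \<open>The combination of \<open>A X\<close> with coefficients u is that of X with coefficients
  \<open>transpose_mat A *\<^sub>v u\<close>, whose variance is the squared norm of u by
  \<open>white\<close>.\<close>

lemma distr_whitened:
  assumes A: "A \<in> carrier_mat N N" and white: "A * Gamma_sum m H h N * transpose_mat A = 1\<^sub>m N"
  shows "distr M (obs_space N) (\<lambda>\<omega>. \<lambda>i\<in>{..<N}. \<Sum>j<N. A $$ (i, j) * X j \<omega>) = std_normal_vector N"
  unfolding obs_space_def
proof (rule distr_std_normal_vector)
  fix u :: "nat \<Rightarrow> real"
  let ?G = "Gamma_sum m H h N"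
  define v where "v = Matrix.vec N u"
  define a where "a = transpose_mat A *\<^sub>v v"
  have v: "v \<in> carrier_vec N" by (simp add: v_def)
  have a: "a \<in> carrier_vec N" using A v by (simp add: a_def)
  have aj: "a $ j = (\<Sum>i<N. A $$ (i, j) * u i)" if "j < N" for j
    using that A by (simp add: a_def v_def scalar_prod_def atLeast0LessThan)
  have sumeq: "(\<Sum>i<N. u i * (\<Sum>j<N. A $$ (i, j) * X j \<omega>)) = (\<Sum>j<N. a $ j * X j \<omega>)" for \<omega>
  proof -
    have "(\<Sum>i<N. u i * (\<Sum>j<N. A $$ (i, j) * X j \<omega>)) = (\<Sum>i<N. \<Sum>j<N. A $$ (i, j) * u i * X j \<omega>)"
      by (simp add: sum_distrib_left mult_ac)
    also have "\<dots> = (\<Sum>j<N. \<Sum>i<N. A $$ (i, j) * u i * X j \<omega>)" by (rule sum.swap)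
    also have "\<dots> = (\<Sum>j<N. a $ j * X j \<omega>)" by (simp add: aj sum_distrib_right)
    finally show ?thesis .
  qed
  have "a \<bullet> (?G *\<^sub>v a) = (?G *\<^sub>v a) \<bullet> a"
    using a Gamma_sum_carrier by (intro comm_scalar_prod) auto
  also have "\<dots> = (A *\<^sub>v (?G *\<^sub>v a)) \<bullet> v"
    using scalar_prod_mult_mat_vec_transpose[OF A _ v, of "?G *\<^sub>v a"] Gamma_sum_carrier a
    by (simp add: a_def)
  also have "A *\<^sub>v (?G *\<^sub>v a) = (A * ?G * transpose_mat A) *\<^sub>v v"
  proof -
    have "(A * ?G * transpose_mat A) *\<^sub>v v = (A * ?G) *\<^sub>v a"
      unfolding a_def using A Gamma_sum_carrier v by (intro assoc_mult_mat_vec[of _ N N _ N]) auto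
    also have "\<dots> = A *\<^sub>v (?G *\<^sub>v a)"
      using A Gamma_sum_carrier a by (intro assoc_mult_mat_vec[of _ N N _ N]) auto
    finally show ?thesis by simp
  qed
  also have "\<dots> \<bullet> v = (\<Sum>j<N. (u j)\<^sup>2)"
    unfolding white by (simp add: v_def scalar_prod_def atLeast0LessThan power2_eq_square)
  finally show "(CLINT \<omega>|M. iexp (\<Sum>i<N. u i * (\<Sum>j<N. A $$ (i, j) * X j \<omega>))) =
      of_real (exp (- (\<Sum>j<N. (u j)\<^sup>2) / 2))"
    unfolding sumeq using char_linear_combination[OF a] by simp
qed measurable

end

section \<open>The Student test in whitened coordinates\<close>

abbreviation lborel_vector :: "nat \<Rightarrow> (nat \<Rightarrow> real) measure" where
  "lborel_vector n \<equiv> (\<Pi>\<^sub>M i\<in>{..<n}. lborel)"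

lemma sets_std_normal_vector: "sets (std_normal_vector n) = sets (obs_space n)"
  unfolding obs_space_def by (simp cong: sets_PiM_cong)

lemma sets_lborel_vector: "sets (lborel_vector n) = sets (obs_space n)"
  unfolding obs_space_def by (simp cong: sets_PiM_cong)

section \<open>The Gaussian shift family in whitened coordinates\<close>

definition spike_vector :: "nat \<Rightarrow> nat \<Rightarrow> real \<Rightarrow> real \<Rightarrow> (nat \<Rightarrow> real) \<Rightarrow> nat \<Rightarrow> real" where
  "spike_vector n k \<alpha> \<delta> w = (\<lambda>i\<in>{..<n}. \<alpha> * w i + (if i = k then \<delta> else 0))"

lemma spike_vector_measurable[measurable]:
  "spike_vector n k \<alpha> \<delta> \<in> measurable (std_normal_vector n) (obs_space n)"
  unfolding spike_vector_def[abs_def] obs_space_def by (intro measurable_restrict) measurable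

definition spike_const :: "nat \<Rightarrow> real \<Rightarrow> real \<Rightarrow> real" where
  "spike_const n \<alpha> \<delta> = (1 / sqrt (2 * pi * \<alpha>\<^sup>2)) ^ n * exp (- \<delta>\<^sup>2 / (2 * \<alpha>\<^sup>2))"

text \<open>The factor of the density that depends on y: an exponential family with statistics
  \<open>y k\<close> and the sum of squares. The rest is \<open>spike_const\<close>.\<close>

definition spike_weight :: "nat \<Rightarrow> nat \<Rightarrow> real \<Rightarrow> real \<Rightarrow> (nat \<Rightarrow> real) \<Rightarrow> real" where
  "spike_weight n k \<alpha> \<delta> y = exp (\<delta> / \<alpha>\<^sup>2 * y k) * exp (- (1 / (2 * \<alpha>\<^sup>2)) * (\<Sum>i<n. (y i)\<^sup>2))"

lemma spike_weight_measurable[measurable]: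
  "k < n \<Longrightarrow> spike_weight n k \<alpha> \<delta> \<in> borel_measurable (lborel_vector n)"
  unfolding spike_weight_def[abs_def] by measurable

lemma spike_const_pos: "0 < \<alpha> \<Longrightarrow> 0 < spike_const n \<alpha> \<delta>"
  by (simp add: spike_const_def)

lemma prod_normal_density_spike:
  assumes "k < n" "0 < \<alpha>"
  shows "(\<Prod>i<n. normal_density (if i = k then \<delta> else 0) \<alpha> (y i)) = spike_const n \<alpha> \<delta> * spike_weight n k \<alpha> \<delta> y"
proof -
  have sq: "(\<Sum>i<n. (y i - (if i = k then \<delta> else 0))\<^sup>2) = (\<Sum>i<n. (y i)\<^sup>2) + (\<delta>\<^sup>2 - 2 * \<delta> * y k)"
  proof -
    have "(\<Sum>i<n. (y i - (if i = k then \<delta> else 0))\<^sup>2) = (\<Sum>i<n. (y i)\<^sup>2 + (if i = k then \<delta>\<^sup>2 - 2 * \<delta> * y k else 0))"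
      by (intro sum.cong refl) (simp add: power2_diff)
    then show ?thesis using assms by (simp add: sum.distrib)
  qed
  have "(\<Prod>i<n. normal_density (if i = k then \<delta> else 0) \<alpha> (y i)) =
      (1 / sqrt (2 * pi * \<alpha>\<^sup>2)) ^ n * exp (\<Sum>i<n. - (y i - (if i = k then \<delta> else 0))\<^sup>2 / (2 * \<alpha>\<^sup>2))"
    unfolding normal_density_def prod.distrib exp_sum[OF finite_lessThan] by simp
  also have "(\<Sum>i<n. - (y i - (if i = k then \<delta> else 0))\<^sup>2 / (2 * \<alpha>\<^sup>2)) =
      - ((\<Sum>i<n. (y i)\<^sup>2) + (\<delta>\<^sup>2 - 2 * \<delta> * y k)) / (2 * \<alpha>\<^sup>2)"
    unfolding sq[symmetric] by (simp add: sum_negf sum_divide_distrib)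
  also have "\<dots> = - \<delta>\<^sup>2 / (2 * \<alpha>\<^sup>2) + (\<delta> / \<alpha>\<^sup>2 * y k + - (1 / (2 * \<alpha>\<^sup>2)) * (\<Sum>i<n. (y i)\<^sup>2))"
    using assms by (simp add: field_simps)
  finally show ?thesis unfolding spike_const_def spike_weight_def by (simp only: exp_add mult.assoc)
qed

lemma distr_spike_vector:
  assumes "k < n" "0 < \<alpha>"
  shows "distr (std_normal_vector n) (obs_space n) (spike_vector n k \<alpha> \<delta>) =
    density (lborel_vector n) (\<lambda>y. spike_const n \<alpha> \<delta> * spike_weight n k \<alpha> \<delta> y)"
proof -
  let ?\<mu> = "\<lambda>i. if i = k then \<delta> else 0"
  have "distr (std_normal_vector n) (obs_space n) (spike_vector n k \<alpha> \<delta>) =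
      (\<Pi>\<^sub>M i\<in>{..<n}. distr (normal_law 0 1) borel (\<lambda>x. \<alpha> * x + ?\<mu> i))"
    unfolding spike_vector_def[abs_def] obs_space_def
    by (rule distr_PiM_coordinatewise)
      (auto simp only: normal_law_affine[OF assms(2)] intro!: assms prob_space_normal_density prob_space_imp_sigma_finite prob_space_normal_law, measurable)
  also have "\<dots> = (\<Pi>\<^sub>M i\<in>{..<n}. density lborel (normal_density (?\<mu> i) \<alpha>))"
    by (simp only: normal_law_affine[OF assms(2)])
  also have "\<dots> = density (lborel_vector n) (\<lambda>x. \<Prod>i<n. normal_density (?\<mu> i) \<alpha> (x i))"
    by (rule density_PiM) (auto intro!: assms prob_space_normal_density prob_space_imp_sigma_finite lborel.sigma_finite_measure_axioms)
  finally show ?thesis by (simp only: prod_normal_density_spike[OF assms])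
qed

lemma integral_spike_vector:
  fixes f :: "(nat \<Rightarrow> real) \<Rightarrow> real"
  assumes "k < n" "0 < \<alpha>" and f[measurable]: "f \<in> borel_measurable (obs_space n)"
  shows "(\<integral>w. f (spike_vector n k \<alpha> \<delta> w) \<partial>std_normal_vector n) =
    spike_const n \<alpha> \<delta> * (\<integral>y. f y * spike_weight n k \<alpha> \<delta> y \<partial>lborel_vector n)"
proof -
  have f': "f \<in> borel_measurable (lborel_vector n)" using f by (simp cong: measurable_cong_sets add: sets_lborel_vector)
  have "(\<integral>w. f (spike_vector n k \<alpha> \<delta> w) \<partial>std_normal_vector n) =
      (\<integral>y. f y \<partial>distr (std_normal_vector n) (obs_space n) (spike_vector n k \<alpha> \<delta>))"
    by (subst integral_distr) auto
  also have "\<dots> = (\<integral>y. (spike_const n \<alpha> \<delta> * spike_weight n k \<alpha> \<delta> y) *\<^sub>R f y \<partial>lborel_vector n)"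
    unfolding distr_spike_vector[OF assms(1,2)]
  proof (rule integral_density)
    show "(\<lambda>y. spike_const n \<alpha> \<delta> * spike_weight n k \<alpha> \<delta> y) \<in> borel_measurable (lborel_vector n)"
      using assms by measurable
    show "AE y in lborel_vector n. 0 \<le> spike_const n \<alpha> \<delta> * spike_weight n k \<alpha> \<delta> y"
      using spike_const_pos[OF assms(2), of n \<delta>] by (simp add: spike_weight_def)
  qed (rule f')
  also have "\<dots> = (\<integral>y. spike_const n \<alpha> \<delta> * (f y * spike_weight n k \<alpha> \<delta> y) \<partial>lborel_vector n)"
    by (intro Bochner_Integration.integral_cong refl) (simp add: mult_ac)
  also have "\<dots> = spike_const n \<alpha> \<delta> * (\<integral>y. f y * spike_weight n k \<alpha> \<delta> y \<partial>lborel_vector n)"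
    by (rule integral_mult_right_zero)
  finally show ?thesis .
qed

lemma gaussian_weight_lborel_vector: "gaussian_weight (lborel_vector n) (\<lambda>y. \<Sum>i<n. (y i)\<^sup>2)"
proof
  interpret product_sigma_finite "\<lambda>_::nat. lborel :: real measure"
    by (simp add: product_sigma_finite_def lborel.sigma_finite_measure_axioms)
  fix s :: real assume s: "0 < s"
  \<comment> \<open>The standard deviation for which \<open>exp (- s * x\<^sup>2)\<close> is an
    unnormalised normal density.\<close>
  define \<sigma> where "\<sigma> = 1 / sqrt (2 * s)"
  have \<sigma>: "0 < \<sigma>" "2 * \<sigma>\<^sup>2 = 1 / s" using s by (simp_all add: \<sigma>_def power_divide)
  have "exp (- s * x\<^sup>2) = sqrt (2 * pi * \<sigma>\<^sup>2) * normal_density 0 \<sigma> x" for x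
    using \<sigma> s by (simp add: normal_density_def divide_inverse mult_ac)
  then have 1: "integrable lborel (\<lambda>x::real. exp (- s * x\<^sup>2))"
    using \<sigma> by simp
  have "integrable (lborel_vector n) (\<lambda>y. \<Prod>i<n. exp (- s * (y i)\<^sup>2))"
    by (rule product_integrable_prod) (auto intro: 1[simplified])
  then show "integrable (lborel_vector n) (\<lambda>y. exp (- s * (\<Sum>i<n. (y i)\<^sup>2)))"
    by (simp add: exp_sum[symmetric] sum_distrib_left sum_negf)
qed (auto intro: sum_nonneg)

definition t_region :: "nat \<Rightarrow> real \<Rightarrow> (nat \<Rightarrow> real) set" where
  "t_region k \<beta> = {y \<in> space (obs_space (Suc k)).
    quantile (student_law k) (1 - \<beta> / 2) < \<bar>y k / sqrt ((\<Sum>i<k. (y i)\<^sup>2) / real k)\<bar>}"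

lemma t_region_measurable[measurable]: "t_region k \<beta> \<in> sets (obs_space (Suc k))"
  unfolding t_region_def obs_space_def by measurable

text \<open>Null sets pass from the normal to the Lebesgue product because the normal density is
  strictly positive.\<close>

lemma AE_lborel_vector_sum_squares_neq_0:
  assumes "0 < k" "k < n"
  shows "AE y in lborel_vector n. (\<Sum>i<k. (y i)\<^sup>2) \<noteq> 0"
proof -
  have P[measurable]: "Measurable.pred (obs_space n) (\<lambda>y. (\<Sum>i<k. (y i)\<^sup>2) \<noteq> 0)"
  proof -
    have [measurable]: "(\<lambda>y. \<Sum>i<k. (y i)\<^sup>2 :: real) \<in> borel_measurable (obs_space n)"
      using assms unfolding obs_space_def
      by (intro borel_measurable_sum borel_measurable_power measurable_component_singleton) auto
    show ?thesis by measurable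
  qed
  have "AE w in std_normal_vector n. (\<Sum>i<k. (w i)\<^sup>2) \<noteq> 0"
    by (rule AE_sum_squares_neq) (use assms in auto)
  then have "AE w in std_normal_vector n. (\<Sum>i<k. (spike_vector n k 1 0 w i)\<^sup>2) \<noteq> 0"
    using assms by (simp add: spike_vector_def)
  then have "AE y in distr (std_normal_vector n) (obs_space n) (spike_vector n k 1 0). (\<Sum>i<k. (y i)\<^sup>2) \<noteq> 0"
    by (subst AE_distr_iff) auto
  then show ?thesis
    unfolding distr_spike_vector[OF assms(2), of 1 0, simplified]
    using spike_const_pos[of 1 n 0] assms
    by (subst (asm) AE_density) (auto simp: spike_weight_def)
qed

text \<open>Up to a null set, the Student region is the region \<open>c * sqrt q < \<bar>u\<bar>\<close> of
  \<open>two_sided_test_optimal\<close>, with \<open>c\<^sup>2 = t\<^sup>2 / (k + t\<^sup>2)\<close>.\<close>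
lemma t_region_cone:
  fixes y S t :: real
  assumes "0 < S" "0 < t" "0 < k"
  shows "t < \<bar>y / sqrt (S / real k)\<bar> \<longleftrightarrow> sqrt (t\<^sup>2 / (real k + t\<^sup>2)) * sqrt (S + y\<^sup>2) < \<bar>y\<bar>"
proof -
  have k: "0 < real k" using assms by simp
  have sq: "a < \<bar>y\<bar> \<longleftrightarrow> a\<^sup>2 < y\<^sup>2" if "0 \<le> a" for a
    using power2_less_imp_less[of a "\<bar>y\<bar>"] power_strict_mono[of a "\<bar>y\<bar>" 2] that by auto
  have "t < \<bar>y / sqrt (S / real k)\<bar> \<longleftrightarrow> t * sqrt (S / real k) < \<bar>y\<bar>"
    using assms by (simp add: less_divide_eq)
  also have "\<dots> \<longleftrightarrow> (t * sqrt (S / real k))\<^sup>2 < y\<^sup>2"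
    using assms by (intro sq) simp
  also have "(t * sqrt (S / real k))\<^sup>2 = t\<^sup>2 * S / real k" using assms by (simp add: power_mult_distrib)
  \<comment> \<open>Multiply by k and add \<open>t\<^sup>2 * y\<^sup>2\<close> to both sides; this
    is the origin of the constant c.\<close>
  also have "t\<^sup>2 * S / real k < y\<^sup>2 \<longleftrightarrow> t\<^sup>2 * (S + y\<^sup>2) / (real k + t\<^sup>2) < y\<^sup>2"
    using k by (simp add: divide_less_eq add_pos_nonneg algebra_simps)
  also have "t\<^sup>2 * (S + y\<^sup>2) / (real k + t\<^sup>2) = (sqrt (t\<^sup>2 / (real k + t\<^sup>2)) * sqrt (S + y\<^sup>2))\<^sup>2"
    using assms by (simp add: power_mult_distrib add_pos_nonneg)
  also have "\<dots> < y\<^sup>2 \<longleftrightarrow> sqrt (t\<^sup>2 / (real k + t\<^sup>2)) * sqrt (S + y\<^sup>2) < \<bar>y\<bar>"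
    using assms by (intro sq[symmetric]) (simp add: add_pos_nonneg)
  finally show ?thesis .
qed

text \<open>Under the null hypothesis the Student ratio is scale invariant, so its law does not
  depend on \<alpha>.\<close>

lemma spike_power_t_region:
  assumes k: "0 < k" and \<beta>: "0 < \<beta>" "\<beta> < 1" and \<alpha>: "0 < \<alpha>"
  shows "(\<integral>w. indicator (t_region k \<beta>) (spike_vector (Suc k) k \<alpha> 0 w) \<partial>std_normal_vector (Suc k)) = \<beta>"
proof -
  let ?n = "Suc k"
  have sc: "spike_vector ?n k \<alpha> 0 w \<in> t_region k \<beta> \<longleftrightarrow> w \<in> t_region k \<beta>" if "w \<in> space (std_normal_vector ?n)" for w
  proof -
    have w: "w \<in> space (obs_space ?n)" using that by (simp add: obs_space_def space_PiM)
    have "spike_vector ?n k \<alpha> 0 w \<in> space (obs_space ?n)" by (simp add: spike_vector_def obs_space_def space_PiM)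
    moreover have "spike_vector ?n k \<alpha> 0 w k / sqrt ((\<Sum>i<k. (spike_vector ?n k \<alpha> 0 w i)\<^sup>2) / real k) =
        w k / sqrt ((\<Sum>i<k. (w i)\<^sup>2) / real k)"
    proof -
      have "(\<Sum>i<k. (spike_vector ?n k \<alpha> 0 w i)\<^sup>2) = \<alpha>\<^sup>2 * (\<Sum>i<k. (w i)\<^sup>2)"
        by (simp add: spike_vector_def power_mult_distrib sum_distrib_left)
      then have "sqrt ((\<Sum>i<k. (spike_vector ?n k \<alpha> 0 w i)\<^sup>2) / real k) = \<alpha> * sqrt ((\<Sum>i<k. (w i)\<^sup>2) / real k)"
        using \<alpha> by (simp add: real_sqrt_mult real_sqrt_divide)
      then show ?thesis using \<alpha> by (simp add: spike_vector_def)
    qed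
    ultimately show ?thesis using w by (simp only: t_region_def mem_Collect_eq)
  qed
  have "(\<integral>w. indicator (t_region k \<beta>) (spike_vector ?n k \<alpha> 0 w) \<partial>std_normal_vector ?n) =
      (\<integral>w. indicator (t_region k \<beta>) w \<partial>std_normal_vector ?n :: real)"
    by (intro Bochner_Integration.integral_cong refl) (simp add: indicator_def sc)
  also have "\<dots> = measure (std_normal_vector ?n) (t_region k \<beta> \<inter> space (std_normal_vector ?n))" by simp
  also have "t_region k \<beta> \<inter> space (std_normal_vector ?n) = t_region k \<beta>"
    by (auto simp: t_region_def obs_space_def space_PiM)
  also have "measure (std_normal_vector ?n) (t_region k \<beta>) = \<beta>"
    unfolding t_region_def by (rule student_two_sided(2)[OF k \<beta>])
  finally show ?thesis .
qed

section \<open>Comparison of an unbiased test with the Student test\<close>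

context
  fixes k :: nat and \<beta> :: real
  assumes k: "0 < k" and \<beta>: "0 < \<beta>" "\<beta> < 1"
begin

interpretation gaussian_weight "lborel_vector (Suc k)" "\<lambda>y. \<Sum>i<Suc k. (y i)\<^sup>2"
  by (rule gaussian_weight_lborel_vector)

text \<open>Solves \<open>s = 1 / (2 * \<alpha>\<^sup>2)\<close> and
  \<open>a = \<delta> / \<alpha>\<^sup>2\<close> for the original parameters, so that every pair (a,
  s) with s > 0 is realised by a member of the family.\<close>

lemma spike_weight_scale:
  assumes "0 < s"
  shows "spike_weight (Suc k) k (1 / sqrt (2 * s)) (a / (2 * s)) y = exp (a * y k) * exp (- s * (\<Sum>i<Suc k. (y i)\<^sup>2))"
  using assms by (simp add: spike_weight_def power_divide del: sum.lessThan_Suc)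

lemma space_lborel_vector: "space (lborel_vector n) = space (obs_space n)"
  by (simp add: obs_space_def space_PiM)

lemma integral_spike_vector_scale:
  fixes f :: "(nat \<Rightarrow> real) \<Rightarrow> real"
  assumes "0 < s" "f \<in> borel_measurable (obs_space (Suc k))"
  shows "(\<integral>y. f y * (exp (a * y k) * exp (- s * (\<Sum>i<Suc k. (y i)\<^sup>2))) \<partial>lborel_vector (Suc k)) =
    (\<integral>w. f (spike_vector (Suc k) k (1 / sqrt (2 * s)) (a / (2 * s)) w) \<partial>std_normal_vector (Suc k)) /
      spike_const (Suc k) (1 / sqrt (2 * s)) (a / (2 * s))"
proof -
  have "0 < spike_const (Suc k) (1 / sqrt (2 * s)) (a / (2 * s))" using assms by (intro spike_const_pos) simp
  then show ?thesis
    using integral_spike_vector[of k "Suc k" "1 / sqrt (2 * s)" f "a / (2 * s)"] assms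
    by (simp add: spike_weight_scale del: sum.lessThan_Suc)
qed

lemma integrable_test_spike_vector:
  assumes f: "is_test (obs_space n) f"
  shows "integrable (std_normal_vector n) (\<lambda>w. f (spike_vector n j \<alpha> \<delta> w))"
proof -
  interpret prob_space "std_normal_vector n" by (rule prob_space_std_normal_vector)
  have [measurable]: "f \<in> borel_measurable (obs_space n)" using f by (simp add: is_test_def)
  show ?thesis
  proof (rule integrable_const_bound[where B = 1])
    show "AE w in std_normal_vector n. norm (f (spike_vector n j \<alpha> \<delta> w)) \<le> 1"
      using f measurable_space[OF spike_vector_measurable, of _ n j \<alpha> \<delta>]
      by (intro AE_I2) (auto simp: is_test_def)
  qed measurable
qed

lemma integral_minus_const_spike_vector:
  assumes f: "is_test (obs_space n) f"
  shows "(\<integral>w. f (spike_vector n j \<alpha> \<delta> w) - b \<partial>std_normal_vector n) =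
    (\<integral>w. f (spike_vector n j \<alpha> \<delta> w) \<partial>std_normal_vector n) - b"
proof -
  interpret prob_space "std_normal_vector n" by (rule prob_space_std_normal_vector)
  show ?thesis using integrable_test_spike_vector[OF f] by (simp add: prob_space)
qed

text \<open>The weighted Lebesgue integral of a test minus \<beta> is its excess power divided by
  the positive \<open>spike_const\<close>. Conditions on power thus become the integral hypotheses
  of \<open>two_sided_test_optimal\<close>, and its conclusion becomes an inequality of
  powers.\<close>

lemma spike_power_compare:
  assumes \<psi>: "is_test (obs_space (Suc k)) \<psi>"
    and \<psi>0: "\<And>\<alpha>. 0 < \<alpha> \<Longrightarrow> (\<integral>w. \<psi> (spike_vector (Suc k) k \<alpha> 0 w) \<partial>std_normal_vector (Suc k)) \<le> \<beta>"
    and \<psi>1: "\<And>\<alpha> \<delta>. 0 < \<alpha> \<Longrightarrow> \<delta> \<noteq> 0 \<Longrightarrow> \<beta> \<le> (\<integral>w. \<psi> (spike_vector (Suc k) k \<alpha> \<delta> w) \<partial>std_normal_vector (Suc k))"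
    and \<alpha>: "0 < \<alpha>"
  shows "(\<integral>w. \<psi> (spike_vector (Suc k) k \<alpha> \<delta> w) \<partial>std_normal_vector (Suc k)) \<le>
    (\<integral>w. indicator (t_region k \<beta>) (spike_vector (Suc k) k \<alpha> \<delta> w) \<partial>std_normal_vector (Suc k))"
proof -
  let ?n = "Suc k"
  let ?L = "lborel_vector ?n" and ?P = "std_normal_vector ?n"
  let ?q = "\<lambda>y. \<Sum>i<?n. (y i)\<^sup>2 :: real"
  let ?t = "quantile (student_law k) (1 - \<beta> / 2)"
  let ?c = "sqrt (?t\<^sup>2 / (real k + ?t\<^sup>2))"
  define \<phi> :: "(nat \<Rightarrow> real) \<Rightarrow> real" where "\<phi> = indicator (t_region k \<beta>)"
  have t: "0 < ?t" by (rule student_two_sided(1)[OF k \<beta>])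
  have \<phi>m: "\<phi> \<in> borel_measurable (obs_space ?n)" unfolding \<phi>_def by measurable
  have \<psi>m: "\<psi> \<in> borel_measurable (obs_space ?n)" using \<psi> by (simp add: is_test_def)
  have \<phi>test: "is_test (obs_space ?n) \<phi>" using \<phi>m by (auto simp: is_test_def \<phi>_def indicator_def)
  note mL = measurable_cong_sets[OF sets_lborel_vector refl]
  have [measurable]: "\<phi> \<in> borel_measurable ?L" "\<psi> \<in> borel_measurable ?L" using \<phi>m \<psi>m by (simp_all add: mL)
  have um[measurable]: "(\<lambda>y. y k) \<in> borel_measurable ?L" by measurable
  have uq: "(y k)\<^sup>2 \<le> ?q y" for y :: "nat \<Rightarrow> real" by (simp add: sum_nonneg)
  have \<psi>01: "0 \<le> \<psi> y \<and> \<psi> y \<le> 1" if "y \<in> space ?L" for y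
    using \<psi> that by (simp add: is_test_def space_lborel_vector)
  have \<phi>01: "0 \<le> \<phi> y \<and> \<phi> y \<le> 1" for y by (simp add: \<phi>_def indicator_def)
  have cone: "AE y in ?L. \<phi> y = indicator {y. ?c * sqrt (?q y) < \<bar>y k\<bar>} y"
    using AE_lborel_vector_sum_squares_neq_0[OF k lessI]
  proof (rule AE_mp, intro AE_I2 impI)
    fix y assume y: "y \<in> space ?L" and S: "(\<Sum>i<k. (y i)\<^sup>2) \<noteq> 0"
    have "0 \<le> (\<Sum>i<k. (y i)\<^sup>2)" by (simp add: sum_nonneg)
    then have "0 < (\<Sum>i<k. (y i)\<^sup>2)" using S by simp
    from t_region_cone[OF this t k, of "y k"]
    show "\<phi> y = indicator {y. ?c * sqrt (?q y) < \<bar>y k\<bar>} y"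
      using y by (simp add: \<phi>_def t_region_def indicator_def space_lborel_vector)
  qed
  have shift: "(\<integral>y. (f y - \<beta>) * (exp (a * y k) * exp (- s * ?q y)) \<partial>?L) =
      ((\<integral>w. f (spike_vector ?n k (1 / sqrt (2 * s)) (a / (2 * s)) w) \<partial>?P) - \<beta>) /
        spike_const ?n (1 / sqrt (2 * s)) (a / (2 * s))"
    if "is_test (obs_space ?n) f" "0 < s" for f a s
  proof -
    have m: "(\<lambda>y. f y - \<beta>) \<in> borel_measurable (obs_space ?n)"
      using that(1) by (auto simp: is_test_def)
    show ?thesis
      unfolding integral_spike_vector_scale[OF that(2) m] integral_minus_const_spike_vector[OF that(1)] ..
  qed
  have \<phi>0: "(\<integral>y. (\<phi> y - \<beta>) * exp (- s * ?q y) \<partial>?L) = 0" if s: "0 < s" for s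
    using shift[OF \<phi>test s, of 0] spike_power_t_region[OF k \<beta>, of "1 / sqrt (2 * s)"] s
    by (simp add: \<phi>_def del: sum.lessThan_Suc)
  \<comment> \<open>Reflection of coordinate k preserves the null law and \<phi> but changes the
    sign of \<open>y k\<close>, so the integral equals its own negative.\<close>
  have \<phi>1: "(\<integral>y. (\<phi> y - \<beta>) * y k * exp (- s * ?q y) \<partial>?L) = 0" if s: "0 < s" for s
  proof -
    let ?R = "\<lambda>w. \<lambda>i\<in>{..<?n}. if i = k then - w i else w i :: real"
    let ?g = "\<lambda>w. (\<phi> (spike_vector ?n k (1 / sqrt (2 * s)) 0 w) - \<beta>) * spike_vector ?n k (1 / sqrt (2 * s)) 0 w k"
    have gm: "?g \<in> borel_measurable (obs_space ?n)"
    proof -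
      have [measurable]: "spike_vector ?n k (1 / sqrt (2 * s)) 0 \<in> measurable (obs_space ?n) (obs_space ?n)"
        using spike_vector_measurable by (simp add: measurable_cong_sets[OF sets_std_normal_vector refl])
      have [measurable]: "(\<lambda>y. y k) \<in> borel_measurable (obs_space ?n)" unfolding obs_space_def by measurable
      show ?thesis using \<phi>m by measurable
    qed
    have Rm: "?R \<in> measurable ?P (obs_space ?n)"
      unfolding obs_space_def
    proof (rule measurable_restrict)
      fix i assume "i \<in> {..<?n}"
      then have "(\<lambda>w. w i) \<in> measurable ?P (normal_law 0 1)" by (rule measurable_component_singleton)
      then have "(\<lambda>w. w i) \<in> borel_measurable ?P"
        by (simp only: measurable_cong_sets[OF refl sets_normal_law])
      then show "(\<lambda>w. if i = k then - w i else w i) \<in> borel_measurable ?P" by (cases "i = k") auto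
    qed
    have "(\<integral>w. ?g w \<partial>?P) = (\<integral>w. ?g w \<partial>distr ?P (obs_space ?n) ?R)"
      by (simp only: std_normal_vector_reflect[OF lessI])
    also have "\<dots> = (\<integral>w. ?g (?R w) \<partial>?P)" by (rule integral_distr[OF Rm gm])
    also have "\<dots> = (\<integral>w. - ?g w \<partial>?P)"
    proof (intro Bochner_Integration.integral_cong refl)
      fix w
      have "\<phi> (spike_vector ?n k (1 / sqrt (2 * s)) 0 (?R w)) = \<phi> (spike_vector ?n k (1 / sqrt (2 * s)) 0 w)"
        by (simp add: \<phi>_def t_region_def indicator_def spike_vector_def obs_space_def space_PiM)
      then show "?g (?R w) = - ?g w" by (simp add: spike_vector_def)
    qed
    finally have "(\<integral>w. ?g w \<partial>?P) = 0" by simp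
    moreover have "(\<lambda>y. (\<phi> y - \<beta>) * y k) \<in> borel_measurable (obs_space ?n)"
      using \<phi>m unfolding obs_space_def by measurable
    ultimately show ?thesis
      using integral_spike_vector_scale[OF s, of "\<lambda>y. (\<phi> y - \<beta>) * y k" 0] by (simp del: sum.lessThan_Suc)
  qed
  have \<psi>0': "(\<integral>y. (\<psi> y - \<beta>) * exp (- s * ?q y) \<partial>?L) \<le> 0" if s: "0 < s" for s
    using shift[OF \<psi> s, of 0] \<psi>0[of "1 / sqrt (2 * s)"] s spike_const_pos[of "1 / sqrt (2 * s)" ?n 0]
    by (simp add: divide_le_0_iff less_imp_le del: sum.lessThan_Suc)
  have \<psi>1': "0 \<le> (\<integral>y. (\<psi> y - \<beta>) * exp (a * y k) * exp (- s * ?q y) \<partial>?L)" if s: "0 < s" "a \<noteq> 0" for s a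
    using shift[OF \<psi> s(1), of a] \<psi>1[of "1 / sqrt (2 * s)" "a / (2 * s)"] s
      spike_const_pos[of "1 / sqrt (2 * s)" ?n "a / (2 * s)"]
    by (simp add: mult.assoc less_imp_le del: sum.lessThan_Suc)
  have bound: "\<bar>b - \<beta>\<bar> \<le> 1" if "0 \<le> b \<and> b \<le> 1" for b
    using that \<beta> by (auto simp: abs_le_iff)
  have wm: "(\<lambda>y. \<psi> y - \<beta>) \<in> borel_measurable ?L" by measurable
  have B\<psi>: "(\<integral>y. (\<psi> y - \<beta>) * exp (- s * ?q y) \<partial>?L) = 0" "(\<integral>y. (\<psi> y - \<beta>) * y k * exp (- s * ?q y) \<partial>?L) = 0"
    if s: "0 < s" for s
    by (rule unbiased_boundary_conditions[of "\<lambda>y. y k" "\<lambda>y. \<psi> y - \<beta>" 1, OF um uq wm bound[OF \<psi>01] \<psi>0' \<psi>1' s];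
      assumption)+
  have i0: "integrable ?L (\<lambda>y. (f y - \<beta>) * exp (- s * ?q y))"
    and i1: "integrable ?L (\<lambda>y. (f y - \<beta>) * y k * exp (- s * ?q y))"
    if [measurable]: "f \<in> borel_measurable ?L" and f: "\<And>y. y \<in> space ?L \<Longrightarrow> 0 \<le> f y \<and> f y \<le> 1" and s: "0 < s" for f s
  proof -
    show "integrable ?L (\<lambda>y. (f y - \<beta>) * exp (- s * ?q y))"
      by (rule integrable_weight_mult[OF _ s, where K = 1 and c = 0]) (use bound[OF f] in auto)
    show "integrable ?L (\<lambda>y. (f y - \<beta>) * y k * exp (- s * ?q y))"
    proof (rule integrable_weight_mult[OF _ s, where K = 1 and c = 1])
      fix y assume y: "y \<in> space ?L"
      have "\<bar>f y - \<beta>\<bar> * \<bar>y k\<bar> \<le> 1 * exp (sqrt (?q y))"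
        by (intro mult_mono bound f y abs_le_exp_sqrt(1) uq) auto
      then show "\<bar>(f y - \<beta>) * y k\<bar> \<le> 1 * exp (1 * sqrt (?q y))" by (simp add: abs_mult del: sum.lessThan_Suc)
    qed measurable
  qed
  define s where "s = 1 / (2 * \<alpha>\<^sup>2)"
  define a where "a = \<delta> / \<alpha>\<^sup>2"
  have s: "0 < s" using \<alpha> by (simp add: s_def)
  have par: "1 / sqrt (2 * s) = \<alpha>" "a / (2 * s) = \<delta>"
    using \<alpha> by (simp_all add: s_def a_def real_sqrt_divide)
  have opt: "0 \<le> (\<integral>y. (\<phi> y - \<psi> y) * exp (a * y k) * exp (- s * ?q y) \<partial>?L)"
  proof (rule two_sided_test_optimal[OF um uq _ _ _ _ _ cone])
    show "0 < ?c" using t k by (simp add: add_pos_nonneg)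
    fix s :: real assume s: "0 < s"
    have "(\<integral>y. (\<phi> y - \<psi> y) * exp (- s * ?q y) \<partial>?L) =
        (\<integral>y. (\<phi> y - \<beta>) * exp (- s * ?q y) - (\<psi> y - \<beta>) * exp (- s * ?q y) \<partial>?L)"
      by (intro Bochner_Integration.integral_cong refl) (simp add: algebra_simps del: sum.lessThan_Suc)
    also have "\<dots> = 0"
      using i0[OF _ _ s, of \<phi>] i0[OF _ _ s, of \<psi>] \<phi>01 \<psi>01 \<phi>0[OF s] B\<psi>(1)[OF s]
      by (simp del: sum.lessThan_Suc)
    finally show "(\<integral>y. (\<phi> y - \<psi> y) * exp (- s * ?q y) \<partial>?L) = 0" .
    have "(\<integral>y. (\<phi> y - \<psi> y) * y k * exp (- s * ?q y) \<partial>?L) =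
        (\<integral>y. (\<phi> y - \<beta>) * y k * exp (- s * ?q y) - (\<psi> y - \<beta>) * y k * exp (- s * ?q y) \<partial>?L)"
      by (intro Bochner_Integration.integral_cong refl) (simp add: algebra_simps del: sum.lessThan_Suc)
    also have "\<dots> = 0"
      using i1[OF _ _ s, of \<phi>] i1[OF _ _ s, of \<psi>] \<phi>01 \<psi>01 \<phi>1[OF s] B\<psi>(2)[OF s]
      by (simp del: sum.lessThan_Suc)
    finally show "(\<integral>y. (\<phi> y - \<psi> y) * y k * exp (- s * ?q y) \<partial>?L) = 0" .
  qed (use \<phi>01 \<psi>01 s in \<open>auto\<close>)
  have tests: "integrable ?P (\<lambda>w. f (spike_vector ?n k \<alpha> \<delta> w))" if "is_test (obs_space ?n) f" for f
    by (rule integrable_test_spike_vector[OF that])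
  have diff: "(\<lambda>y. \<phi> y - \<psi> y) \<in> borel_measurable (obs_space ?n)" using \<phi>m \<psi>m by measurable
  have "0 \<le> (\<integral>w. \<phi> (spike_vector ?n k \<alpha> \<delta> w) - \<psi> (spike_vector ?n k \<alpha> \<delta> w) \<partial>?P)"
    using opt integral_spike_vector_scale[OF s diff, of a] spike_const_pos[OF \<alpha>, of ?n \<delta>]
    by (simp add: par mult.assoc zero_le_divide_iff del: sum.lessThan_Suc)
  also have "\<dots> = (\<integral>w. \<phi> (spike_vector ?n k \<alpha> \<delta> w) \<partial>?P) - (\<integral>w. \<psi> (spike_vector ?n k \<alpha> \<delta> w) \<partial>?P)"
    by (intro Bochner_Integration.integral_diff tests \<phi>test \<psi>)
  finally show ?thesis by (simp add: \<phi>_def)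
qed

text \<open>The constant test \<beta> satisfies the hypotheses of
  \<open>spike_power_compare\<close>; comparison with it is the unbiasedness of the Student
  test.\<close>

lemma spike_power_t_region_ge:
  assumes "0 < \<alpha>"
  shows "\<beta> \<le> (\<integral>w. indicator (t_region k \<beta>) (spike_vector (Suc k) k \<alpha> \<delta> w) \<partial>std_normal_vector (Suc k))"
proof -
  interpret prob_space "std_normal_vector (Suc k)" by (rule prob_space_std_normal_vector)
  show ?thesis
    using spike_power_compare[of "\<lambda>_. \<beta>", OF _ _ _ assms] \<beta> by (simp add: is_test_def prob_space)
qed

end

section \<open>Transfer to the observed vector\<close>

text \<open>\<open>k\<close> plays two roles: it is the number of degrees of freedom and the index
  of the only whitened coordinate that contains the drift.\<close>

locale whitened_fbm_mixture = fbm_mixture +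
  fixes A E :: "real mat" and k :: nat
  assumes N_eq: "N = Suc k" and A: "A \<in> carrier_mat N N" and E: "E \<in> carrier_mat N N"
    and AE: "A * E = 1\<^sub>m N" and EA: "E * A = 1\<^sub>m N"
    and form: "\<And>x y. x \<in> carrier_vec N \<Longrightarrow> y \<in> carrier_vec N \<Longrightarrow>
      Gamma_form m H h N x y = (A *\<^sub>v x) \<bullet> (A *\<^sub>v y)"
    and AT: "A *\<^sub>v T_vec h N = sqrt (d_N m H h N) \<cdot>\<^sub>v unit_vec N k"
    and white: "A * Gamma_sum m H h N * transpose_mat A = 1\<^sub>m N"
    and d_pos: "0 < d_N m H h N"
begin

abbreviation d :: real where "d \<equiv> d_N m H h N"

lemma k_pos: "0 < k" and k_less: "k < N" "i < k \<Longrightarrow> i < N"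
  using N by (simp_all add: N_eq)

definition unwhiten :: "(nat \<Rightarrow> real) \<Rightarrow> nat \<Rightarrow> real" where
  "unwhiten y = (\<lambda>i\<in>{..<N}. \<Sum>j<N. E $$ (i, j) * y j)"

definition whiten :: "(nat \<Rightarrow> real) \<Rightarrow> nat \<Rightarrow> real" where
  "whiten z = (\<lambda>i\<in>{..<N}. \<Sum>j<N. A $$ (i, j) * z j)"

lemma linear_measurable:
  "(\<lambda>y. \<lambda>i\<in>{..<N}. \<Sum>j<N. C i j * y j :: real) \<in> measurable (obs_space N) (obs_space N)"
  unfolding obs_space_def
  by (intro measurable_restrict borel_measurable_sum borel_measurable_times
      measurable_component_singleton borel_measurable_const) auto

lemma unwhiten_measurable[measurable]: "unwhiten \<in> measurable (obs_space N) (obs_space N)"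
  unfolding unwhiten_def[abs_def] by (rule linear_measurable)

lemma whiten_measurable[measurable]: "whiten \<in> measurable (obs_space N) (obs_space N)"
  unfolding whiten_def[abs_def] by (rule linear_measurable)

lemma vec_unwhiten: "Matrix.vec N (unwhiten y) = E *\<^sub>v Matrix.vec N y"
  using E by (intro eq_vecI) (auto simp: unwhiten_def scalar_prod_def atLeast0LessThan)

lemma vec_whiten: "Matrix.vec N (whiten z) = A *\<^sub>v Matrix.vec N z"
  using A by (intro eq_vecI) (auto simp: whiten_def scalar_prod_def atLeast0LessThan)

lemma whitened_vec: "A *\<^sub>v Matrix.vec N (unwhiten y) = Matrix.vec N y"
proof -
  have "A *\<^sub>v (E *\<^sub>v Matrix.vec N y) = (A * E) *\<^sub>v Matrix.vec N y"
    using A E by (intro assoc_mult_mat_vec[symmetric, of _ N N _ N]) auto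
  then show ?thesis by (simp add: vec_unwhiten AE)
qed

lemma obs_space_eqI:
  assumes "x \<in> space (obs_space N)" "y \<in> space (obs_space N)" "Matrix.vec N x = Matrix.vec N y"
  shows "x = y"
proof
  fix i
  show "x i = y i"
  proof (cases "i < N")
    case True
    then show ?thesis using arg_cong[OF assms(3), of "\<lambda>v. v $ i"] by simp
  next
    case False
    then show ?thesis using assms by (auto simp: obs_space_def space_PiM PiE_iff extensional_def)
  qed
qed

lemma unwhiten_in_space: "unwhiten y \<in> space (obs_space N)"
  by (simp add: unwhiten_def obs_space_def space_PiM)

lemma unwhiten_whiten:
  assumes "z \<in> space (obs_space N)" shows "unwhiten (whiten z) = z"
proof (rule obs_space_eqI[OF unwhiten_in_space assms])
  have "E *\<^sub>v (A *\<^sub>v Matrix.vec N z) = (E * A) *\<^sub>v Matrix.vec N z"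
    using A E by (intro assoc_mult_mat_vec[symmetric, of _ N N _ N]) auto
  then show "Matrix.vec N (unwhiten (whiten z)) = Matrix.vec N z" by (simp add: vec_unwhiten vec_whiten EA)
qed

lemma T_vec_carrier: "T_vec h N \<in> carrier_vec N"
  by (simp add: T_vec_def)

lemma Gamma_form_T_unwhiten: "Gamma_form m H h N (T_vec h N) (Matrix.vec N (unwhiten y)) = sqrt d * y k"
proof -
  have "Gamma_form m H h N (T_vec h N) (Matrix.vec N (unwhiten y)) =
      (sqrt d \<cdot>\<^sub>v unit_vec N k) \<bullet> Matrix.vec N y"
    by (subst form) (auto simp: T_vec_carrier whitened_vec AT)
  then show ?thesis by (simp add: N_eq)
qed

lemma Gamma_form_unwhiten:
  "Gamma_form m H h N (Matrix.vec N (unwhiten y)) (Matrix.vec N (unwhiten y)) = (\<Sum>i<N. (y i)\<^sup>2)"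
  by (subst form) (auto simp: whitened_vec scalar_prod_def atLeast0LessThan power2_eq_square)

lemma theta_hat_unwhiten: "sqrt d * (theta_hat m H h N (unwhiten y) - \<theta>) = y k - \<theta> * sqrt d"
proof -
  have "sqrt d * (sqrt d * y k / d) = y k" using d_pos by (simp add: mult.assoc[symmetric])
  then show ?thesis unfolding theta_hat_def Gamma_form_T_unwhiten by (simp add: right_diff_distrib mult.commute)
qed

text \<open>The subtracted term is exactly \<open>(y k)\<^sup>2\<close>, the squared projection on
  T; the remaining k squares are the residuals.\<close>

lemma alpha2_hat_unwhiten: "real N * alpha2_hat m H h N (unwhiten y) = (\<Sum>i<k. (y i)\<^sup>2)"
proof -
  have "(sqrt d * y k)\<^sup>2 / d = (y k)\<^sup>2" using d_pos by (simp add: power_mult_distrib)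
  then show ?thesis using N unfolding alpha2_hat_def Gamma_form_unwhiten Gamma_form_T_unwhiten by (simp add: N_eq)
qed

lemma alpha_tilde_unwhiten: "alpha_tilde m H h N (unwhiten y) = sqrt ((\<Sum>i<k. (y i)\<^sup>2) / real k)"
proof -
  have "real N - 1 = real k" by (simp add: N_eq)
  then show ?thesis unfolding alpha_tilde_def alpha2_hat_unwhiten[symmetric] by simp
qed

definition shift :: "real \<Rightarrow> (nat \<Rightarrow> real) \<Rightarrow> nat \<Rightarrow> real" where
  "shift c y = (\<lambda>i\<in>{..<N}. y i + (if i = k then c else 0))"

lemma shift_measurable[measurable]: "shift c \<in> measurable (obs_space N) (obs_space N)"
  unfolding shift_def[abs_def] obs_space_def
  by (intro measurable_restrict borel_measurable_add measurable_component_singleton borel_measurable_const) auto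

lemma shift_in_space: "shift c y \<in> space (obs_space N)"
  by (simp add: shift_def obs_space_def space_PiM)

lemma shift_spike_vector: "shift c (spike_vector N k \<alpha> \<delta> w) = spike_vector N k \<alpha> (\<delta> + c) w"
  by (auto simp: shift_def spike_vector_def fun_eq_iff)

lemma unwhiten_in_t_test_region:
  "unwhiten y \<in> t_test_region m H h N \<beta> \<theta> \<longleftrightarrow> shift (- \<theta> * sqrt d) y \<in> t_region k \<beta>"
proof -
  have "N - 1 = k" by (simp add: N_eq)
  moreover have "shift (- \<theta> * sqrt d) y k = y k - \<theta> * sqrt d"
    "(\<Sum>i<k. (shift (- \<theta> * sqrt d) y i)\<^sup>2) = (\<Sum>i<k. (y i)\<^sup>2)"
    by (auto simp: shift_def k_less)
  ultimately show ?thesis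
    using unwhiten_in_space[of y] shift_in_space[of "- \<theta> * sqrt d" y]
    unfolding t_test_region_def t_region_def mem_Collect_eq theta_hat_unwhiten alpha_tilde_unwhiten N_eq[symmetric]
    by simp
qed

text \<open>In whitened coordinates the region is a preimage of \<open>t_region\<close> under
  measurable maps; \<open>unwhiten_whiten\<close> identifies the two descriptions.\<close>

lemma t_test_region_sets[measurable]: "t_test_region m H h N \<beta> \<theta> \<in> sets (obs_space N)"
proof -
  have "t_test_region m H h N \<beta> \<theta> = (\<lambda>z. shift (- \<theta> * sqrt d) (whiten z)) -` t_region k \<beta> \<inter> space (obs_space N)"
  proof -
    have "z \<in> t_test_region m H h N \<beta> \<theta> \<longleftrightarrow> shift (- \<theta> * sqrt d) (whiten z) \<in> t_region k \<beta>"
      if "z \<in> space (obs_space N)" for z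
      using unwhiten_in_t_test_region[of "whiten z" \<beta> \<theta>] unwhiten_whiten[OF that] by simp
    moreover have "t_test_region m H h N \<beta> \<theta> \<subseteq> space (obs_space N)" by (auto simp: t_test_region_def)
    ultimately show ?thesis by blast
  qed
  moreover have "t_region k \<beta> \<in> sets (obs_space N)" unfolding N_eq by (rule t_region_measurable)
  then have "(\<lambda>z. shift (- \<theta> * sqrt d) (whiten z)) -` t_region k \<beta> \<inter> space (obs_space N) \<in> sets (obs_space N)"
    by (intro measurable_sets[of _ _ "obs_space N"]) measurable
  ultimately show ?thesis by simp
qed

lemma chi_square_test_region_sets[measurable]: "chi_square_test_region m H h N \<beta> \<alpha> \<in> sets (obs_space N)"
proof -
  let ?I = "{quantile (chi_square_law k) (\<beta> / 2)..quantile (chi_square_law k) (1 - \<beta> / 2)}"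
  have "chi_square_test_region m H h N \<beta> \<alpha> = {z \<in> space (obs_space N). (\<Sum>i<k. (whiten z i)\<^sup>2) / \<alpha>\<^sup>2 \<notin> ?I}"
  proof -
    have "real N * alpha2_hat m H h N z = (\<Sum>i<k. (whiten z i)\<^sup>2)" if "z \<in> space (obs_space N)" for z
      using alpha2_hat_unwhiten[of "whiten z"] unwhiten_whiten[OF that] by simp
    moreover have "N - 1 = k" by (simp add: N_eq)
    ultimately show ?thesis unfolding chi_square_test_region_def by (intro Collect_cong) auto
  qed
  moreover have "(\<lambda>z. whiten z i) \<in> borel_measurable (obs_space N)" if "i < k" for i
  proof -
    have "(\<lambda>y. y i) \<in> borel_measurable (obs_space N)"
      unfolding obs_space_def using that by (intro measurable_component_singleton) (simp add: N_eq)
    from measurable_compose[OF whiten_measurable this] show ?thesis .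
  qed
  then have "(\<lambda>z. (\<Sum>i<k. (whiten z i)\<^sup>2) / \<alpha>\<^sup>2) \<in> borel_measurable (obs_space N)"
    by (intro borel_measurable_divide borel_measurable_sum borel_measurable_power borel_measurable_const) auto
  then have "{z \<in> space (obs_space N). (\<Sum>i<k. (whiten z i)\<^sup>2) / \<alpha>\<^sup>2 \<notin> ?I} \<in> sets (obs_space N)"
    by measurable
  ultimately show ?thesis by simp
qed

text \<open>A pathwise identity: A maps \<open>\<alpha> X + \<theta> T\<close> to \<alpha> times the
  whitened noise plus \<open>\<theta> * sqrt d\<close> in coordinate k, and E undoes A.\<close>

lemma obs_law_eq:
  assumes \<alpha>: "0 < \<alpha>"
  shows "obs_law M m B h N (\<theta>, \<alpha>\<^sup>2) =
    distr (std_normal_vector N) (obs_space N) (\<lambda>w. unwhiten (spike_vector N k \<alpha> (\<theta> * sqrt d) w))"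
proof -
  let ?W = "\<lambda>\<omega>. \<lambda>i\<in>{..<N}. \<Sum>j<N. A $$ (i, j) * X j \<omega>"
  let ?Z = "\<lambda>\<omega>. \<lambda>i\<in>{..<N}. Z_process m B \<theta> (sqrt (\<alpha>\<^sup>2)) (grid h (Suc i)) \<omega>"
  have W: "?W \<in> measurable M (obs_space N)"
    unfolding obs_space_def by (intro measurable_restrict) measurable
  have U: "(\<lambda>w. unwhiten (spike_vector N k \<alpha> (\<theta> * sqrt d) w)) \<in> measurable (std_normal_vector N) (obs_space N)"
    by measurable
  have "unwhiten (spike_vector N k \<alpha> (\<theta> * sqrt d) (?W \<omega>)) = ?Z \<omega>" for \<omega>
  proof (rule obs_space_eqI[OF unwhiten_in_space])
    show "?Z \<omega> \<in> space (obs_space N)" by (simp add: obs_space_def space_PiM)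
    define v where "v = \<alpha> \<cdot>\<^sub>v Matrix.vec N (\<lambda>i. X i \<omega>) + \<theta> \<cdot>\<^sub>v T_vec h N"
    have v: "v \<in> carrier_vec N" by (simp add: v_def T_vec_def)
    have "Matrix.vec N (spike_vector N k \<alpha> (\<theta> * sqrt d) (?W \<omega>)) =
        \<alpha> \<cdot>\<^sub>v (A *\<^sub>v Matrix.vec N (\<lambda>i. X i \<omega>)) + \<theta> \<cdot>\<^sub>v (A *\<^sub>v T_vec h N)"
      unfolding AT using A
      by (intro eq_vecI) (auto simp: spike_vector_def scalar_prod_def atLeast0LessThan k_less)
    also have "\<dots> = A *\<^sub>v v"
      unfolding v_def using A
      by (simp add: mult_add_distrib_mat_vec[OF A] mult_mat_vec[OF A] T_vec_carrier)
    finally have "Matrix.vec N (unwhiten (spike_vector N k \<alpha> (\<theta> * sqrt d) (?W \<omega>))) = E *\<^sub>v (A *\<^sub>v v)"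
      by (simp add: vec_unwhiten)
    also have "\<dots> = (E * A) *\<^sub>v v"
      using A E v by (intro assoc_mult_mat_vec[symmetric, of _ N N _ N]) auto
    also have "\<dots> = Matrix.vec N (?Z \<omega>)"
      unfolding EA using v \<alpha>
      by (auto simp: v_def T_vec_def Z_process_def X_def)
    finally show "Matrix.vec N (unwhiten (spike_vector N k \<alpha> (\<theta> * sqrt d) (?W \<omega>))) = Matrix.vec N (?Z \<omega>)" .
  qed
  then have "obs_law M m B h N (\<theta>, \<alpha>\<^sup>2) =
      distr M (obs_space N) ((\<lambda>w. unwhiten (spike_vector N k \<alpha> (\<theta> * sqrt d) w)) \<circ> ?W)"
    by (simp add: obs_law_def comp_def)
  also have "\<dots> = distr (distr M (obs_space N) ?W) (obs_space N) (\<lambda>w. unwhiten (spike_vector N k \<alpha> (\<theta> * sqrt d) w))"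
    by (rule distr_distr[symmetric])
      (use U W in \<open>simp_all add: measurable_cong_sets[OF sets_std_normal_vector refl]\<close>)
  finally show ?thesis by (simp only: distr_whitened[OF A white])
qed

lemma power_fn_obs_law:
  assumes "0 < \<alpha>" and f: "f \<in> borel_measurable (obs_space N)"
  shows "power_fn (obs_law M m B h N) f (\<theta>, \<alpha>\<^sup>2) =
    (\<integral>w. f (unwhiten (spike_vector N k \<alpha> (\<theta> * sqrt d) w)) \<partial>std_normal_vector N)"
  unfolding power_fn_def obs_law_eq[OF assms(1)] by (rule integral_distr[OF _ f]) measurable

lemma power_fn_t_test:
  assumes "0 < \<alpha>"
  shows "power_fn (obs_law M m B h N) (indicator (t_test_region m H h N \<beta> \<theta>\<^sub>0)) (\<theta>, \<alpha>\<^sup>2) =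
    (\<integral>w. indicator (t_region k \<beta>) (spike_vector N k \<alpha> ((\<theta> - \<theta>\<^sub>0) * sqrt d) w) \<partial>std_normal_vector N)"
proof -
  have m: "indicator (t_test_region m H h N \<beta> \<theta>\<^sub>0) \<in> borel_measurable (obs_space N)" by measurable
  have "unwhiten (spike_vector N k \<alpha> (\<theta> * sqrt d) w) \<in> t_test_region m H h N \<beta> \<theta>\<^sub>0 \<longleftrightarrow>
      spike_vector N k \<alpha> ((\<theta> - \<theta>\<^sub>0) * sqrt d) w \<in> t_region k \<beta>" for w
    unfolding unwhiten_in_t_test_region shift_spike_vector by (simp add: algebra_simps)
  then show ?thesis unfolding power_fn_obs_law[OF assms m] by (simp add: indicator_def)
qed

lemma measure_t_test_region:
  assumes "0 < \<beta>" "\<beta> < 1" "0 < \<alpha>"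
  shows "measure (obs_law M m B h N (\<theta>\<^sub>0, \<alpha>\<^sup>2)) (t_test_region m H h N \<beta> \<theta>\<^sub>0) = \<beta>"
proof -
  have "measure (obs_law M m B h N (\<theta>\<^sub>0, \<alpha>\<^sup>2)) (t_test_region m H h N \<beta> \<theta>\<^sub>0) =
      power_fn (obs_law M m B h N) (indicator (t_test_region m H h N \<beta> \<theta>\<^sub>0)) (\<theta>\<^sub>0, \<alpha>\<^sup>2)"
    using sets.sets_into_space[OF t_test_region_sets[of \<beta> \<theta>\<^sub>0]]
    by (simp add: power_fn_def obs_law_eq[OF assms(3)] Int_absorb2)
  also have "\<dots> = \<beta>"
    unfolding power_fn_t_test[OF assms(3)] using spike_power_t_region[OF k_pos assms]
    by (simp add: N_eq[symmetric])
  finally show ?thesis .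
qed

text \<open>The statistic uses only the first k whitened coordinates, which are free of \<theta>;
  division by \<open>\<alpha>\<^sup>2\<close> leaves a sum of k squared standard normals.\<close>

lemma measure_chi_square_test_region:
  assumes "0 < \<beta>" "\<beta> < 1" "0 < \<alpha>"
  shows "measure (obs_law M m B h N (\<theta>, \<alpha>\<^sup>2)) (chi_square_test_region m H h N \<beta> \<alpha>) = \<beta>"
proof -
  let ?U = "\<lambda>w. unwhiten (spike_vector N k \<alpha> (\<theta> * sqrt d) w)"
  have "real N * alpha2_hat m H h N (?U w) / \<alpha>\<^sup>2 = (\<Sum>i<k. (w i)\<^sup>2)" for w
  proof -
    have "(\<Sum>i<k. (spike_vector N k \<alpha> (\<theta> * sqrt d) w i)\<^sup>2) = \<alpha>\<^sup>2 * (\<Sum>i<k. (w i)\<^sup>2)"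
      by (simp add: spike_vector_def k_less power_mult_distrib sum_distrib_left)
    then show ?thesis using assms unfolding alpha2_hat_unwhiten by simp
  qed
  moreover have k_eq: "N - 1 = k" by (simp add: N_eq)
  ultimately have "?U -` chi_square_test_region m H h N \<beta> \<alpha> \<inter> space (std_normal_vector N) =
      {w \<in> space (obs_space N). (\<Sum>i<k. (w i)\<^sup>2) \<notin>
        {quantile (chi_square_law k) (\<beta> / 2)..quantile (chi_square_law k) (1 - \<beta> / 2)}}"
    using unwhiten_in_space sets_eq_imp_space_eq[OF sets_std_normal_vector[of N]] k_eq
    by (auto simp: chi_square_test_region_def)
  then have pre: "measure (std_normal_vector N) (?U -` chi_square_test_region m H h N \<beta> \<alpha> \<inter> space (std_normal_vector N)) =
      measure (std_normal_vector N) {w \<in> space (obs_space N). (\<Sum>i<k. (w i)\<^sup>2) \<notin>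
        {quantile (chi_square_law k) (\<beta> / 2)..quantile (chi_square_law k) (1 - \<beta> / 2)}}"
    by (rule arg_cong)
  have "?U \<in> measurable (std_normal_vector N) (obs_space N)" by measurable
  then have "measure (obs_law M m B h N (\<theta>, \<alpha>\<^sup>2)) (chi_square_test_region m H h N \<beta> \<alpha>) =
      measure (std_normal_vector N) {w \<in> space (obs_space N). (\<Sum>i<k. (w i)\<^sup>2) \<notin>
        {quantile (chi_square_law k) (\<beta> / 2)..quantile (chi_square_law k) (1 - \<beta> / 2)}}"
    unfolding obs_law_eq[OF assms(3)] pre[symmetric]
    by (rule measure_distr[OF _ chi_square_test_region_sets])
  also have "\<dots> = \<beta>"
    by (rule chi_square_two_sided[OF k_pos _ assms(1,2)]) (simp add: N_eq)
  finally show ?thesis .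
qed

text \<open>After recentring, the shift \<delta> corresponds to the drift
  \<open>\<theta>\<^sub>0 + \<delta> / sqrt d\<close>. As sqrt d > 0, \<delta> = 0 is the null
  hypothesis and \<delta> \<noteq> 0 the alternative, so the unbiasedness of \<psi> passes to
  \<open>\<psi>'\<close>.\<close>

lemma t_test_optimal:
  assumes \<beta>: "0 < \<beta>" "\<beta> < 1"
    and \<psi>: "unbiased_level_test (obs_space N) (obs_law M m B h N) ({\<theta>\<^sub>0} \<times> {0<..}) ((UNIV - {\<theta>\<^sub>0}) \<times> {0<..}) \<beta> \<psi>"
    and \<alpha>: "0 < \<alpha>"
  shows "power_fn (obs_law M m B h N) \<psi> (\<theta>, \<alpha>\<^sup>2) \<le>
    power_fn (obs_law M m B h N) (indicator (t_test_region m H h N \<beta> \<theta>\<^sub>0)) (\<theta>, \<alpha>\<^sup>2)"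
proof -
  have test: "is_test (obs_space N) \<psi>" using \<psi> by (simp add: unbiased_level_test_def)
  then have [measurable]: "\<psi> \<in> borel_measurable (obs_space N)" by (simp add: is_test_def)
  define \<psi>' where "\<psi>' y = \<psi> (unwhiten (shift (\<theta>\<^sub>0 * sqrt d) y))" for y
  have test': "is_test (obs_space (Suc k)) \<psi>'"
    using test unwhiten_in_space unfolding is_test_def \<psi>'_def N_eq[symmetric] by auto
  have sd: "0 < sqrt d" using d_pos by simp
  have pw: "(\<integral>w. \<psi>' (spike_vector (Suc k) k \<alpha> \<delta> w) \<partial>std_normal_vector (Suc k)) =
      power_fn (obs_law M m B h N) \<psi> (\<theta>\<^sub>0 + \<delta> / sqrt d, \<alpha>\<^sup>2)" if "0 < \<alpha>" for \<alpha> \<delta>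
  proof -
    have "(\<theta>\<^sub>0 + \<delta> / sqrt d) * sqrt d = \<delta> + \<theta>\<^sub>0 * sqrt d" using sd by (simp add: field_simps)
    then show ?thesis
      using that by (subst power_fn_obs_law) (auto simp: \<psi>'_def shift_spike_vector N_eq[symmetric])
  qed
  have "(\<integral>w. \<psi>' (spike_vector (Suc k) k \<alpha> ((\<theta> - \<theta>\<^sub>0) * sqrt d) w) \<partial>std_normal_vector (Suc k)) \<le>
    (\<integral>w. indicator (t_region k \<beta>) (spike_vector (Suc k) k \<alpha> ((\<theta> - \<theta>\<^sub>0) * sqrt d) w) \<partial>std_normal_vector (Suc k))"
  proof (rule spike_power_compare[OF k_pos \<beta> test' _ _ \<alpha>])
    fix \<alpha> :: real assume \<alpha>: "0 < \<alpha>"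
    then show "(\<integral>w. \<psi>' (spike_vector (Suc k) k \<alpha> 0 w) \<partial>std_normal_vector (Suc k)) \<le> \<beta>"
      using \<psi> unfolding pw[OF \<alpha>] by (auto simp: unbiased_level_test_def)
    fix \<delta> :: real assume "\<delta> \<noteq> 0"
    then show "\<beta> \<le> (\<integral>w. \<psi>' (spike_vector (Suc k) k \<alpha> \<delta> w) \<partial>std_normal_vector (Suc k))"
      using \<psi> \<alpha> sd unfolding pw[OF \<alpha>] by (auto simp: unbiased_level_test_def)
  qed
  then show ?thesis
    using sd unfolding pw[OF \<alpha>] power_fn_t_test[OF \<alpha>] by (simp add: N_eq[symmetric])
qed

lemma t_test_unbiased:
  assumes \<beta>: "0 < \<beta>" "\<beta> < 1"
  shows "unbiased_level_test (obs_space N) (obs_law M m B h N) ({\<theta>\<^sub>0} \<times> {0<..}) ((UNIV - {\<theta>\<^sub>0}) \<times> {0<..}) \<beta>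
    (indicator (t_test_region m H h N \<beta> \<theta>\<^sub>0))"
proof -
  let ?\<phi> = "indicator (t_test_region m H h N \<beta> \<theta>\<^sub>0) :: (nat \<Rightarrow> real) \<Rightarrow> real"
  have "is_test (obs_space N) ?\<phi>" by (auto simp: is_test_def indicator_def)
  moreover have "power_fn (obs_law M m B h N) ?\<phi> (\<theta>\<^sub>0, a) \<le> \<beta>" if "0 < a" for a
    using that power_fn_t_test[of "sqrt a" \<beta> \<theta>\<^sub>0 \<theta>\<^sub>0] spike_power_t_region[OF k_pos \<beta>, of "sqrt a"]
    by (simp add: N_eq[symmetric])
  moreover have "\<beta> \<le> power_fn (obs_law M m B h N) ?\<phi> (\<theta>, a)" if "0 < a" for \<theta> a
    using that power_fn_t_test[of "sqrt a" \<beta> \<theta>\<^sub>0 \<theta>] spike_power_t_region_ge[OF k_pos \<beta>, of "sqrt a"]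
    by (simp add: N_eq[symmetric])
  ultimately show ?thesis by (auto simp: unbiased_level_test_def)
qed

lemma t_test_UMP_unbiased:
  assumes \<beta>: "0 < \<beta>" "\<beta> < 1"
  shows "UMP_unbiased (obs_space N) (obs_law M m B h N) ({\<theta>\<^sub>0} \<times> {0<..}) ((UNIV - {\<theta>\<^sub>0}) \<times> {0<..}) \<beta>
    (indicator (t_test_region m H h N \<beta> \<theta>\<^sub>0))"
  unfolding UMP_unbiased_def
proof (intro conjI allI impI ballI t_test_unbiased[OF \<beta>])
  fix \<psi> p
  assume \<psi>: "unbiased_level_test (obs_space N) (obs_law M m B h N) ({\<theta>\<^sub>0} \<times> {0<..}) ((UNIV - {\<theta>\<^sub>0}) \<times> {0<..}) \<beta> \<psi>"
    and "p \<in> (UNIV - {\<theta>\<^sub>0}) \<times> {0::real<..}"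
  then obtain \<theta> a where p: "p = (\<theta>, a)" "0 < a" by auto
  then show "power_fn (obs_law M m B h N) \<psi> p \<le>
      power_fn (obs_law M m B h N) (indicator (t_test_region m H h N \<beta> \<theta>\<^sub>0)) p"
    using t_test_optimal[OF \<beta> \<psi>, of "sqrt a" \<theta>] by simp
qed

end

lemma (in fbm_mixture) whitening_exists: "\<exists>A E. whitened_fbm_mixture M m N H B h A E (N - 1)"
proof -
  have T: "T_vec h N \<in> carrier_vec N" "T_vec h N \<noteq> 0\<^sub>v N"
  proof -
    \<comment> \<open>Coordinate 0 belongs to the time h, which is positive.\<close>
    have "T_vec h N $ 0 \<noteq> 0\<^sub>v N $ 0" using h N by (simp add: T_vec_def grid_def)
    then show "T_vec h N \<noteq> 0\<^sub>v N" by metis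
  qed (simp add: T_vec_def)
  have "0 < N" using N by simp
  from whitening_matrix_exists[OF Gamma_sum_carrier Gamma_sum_symmetric Gamma_sum_pos_def T this]
  obtain A E where "A \<in> carrier_mat N N" "E \<in> carrier_mat N N" "A * E = 1\<^sub>m N" "E * A = 1\<^sub>m N"
    "\<And>x y. x \<in> carrier_vec N \<Longrightarrow> y \<in> carrier_vec N \<Longrightarrow>
      x \<bullet> (the (mat_inverse (Gamma_sum m H h N)) *\<^sub>v y) = (A *\<^sub>v x) \<bullet> (A *\<^sub>v y)"
    "A *\<^sub>v T_vec h N = sqrt (T_vec h N \<bullet> (the (mat_inverse (Gamma_sum m H h N)) *\<^sub>v T_vec h N)) \<cdot>\<^sub>v unit_vec N (N - 1)"
    "A * Gamma_sum m H h N * transpose_mat A = 1\<^sub>m N"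
    "0 < T_vec h N \<bullet> (the (mat_inverse (Gamma_sum m H h N)) *\<^sub>v T_vec h N)"
    by metis
  then have "whitened_fbm_mixture M m N H B h A E (N - 1)"
    using N by unfold_locales (auto simp: d_N_def Gamma_form_def)
  then show ?thesis by blast
qed

theorem corollary3p13:
  fixes M :: "'a measure"
    and m N :: nat
    and H :: "nat \<Rightarrow> real"
    and B :: "nat \<Rightarrow> real \<Rightarrow> 'a \<Rightarrow> real"
    and h \<beta> :: real
  assumes "prob_space M"
    and "h > 0"
    and "m \<ge> 1"
    and "\<forall>r\<in>{1..m}. 1/2 < H r \<and> H r < 1"
    and "\<forall>r\<in>{1..m}. fractional_brownian_motion M (H r) (B r)"
    and "independent_processes M B {1..m}"
    and "0 < \<beta>" and "\<beta> < 1"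
    and "N \<ge> 2"
  shows "(\<forall>\<theta>\<^sub>0::real.
            (\<forall>\<alpha>>0. measure (obs_law M m B h N (\<theta>\<^sub>0, \<alpha>\<^sup>2)) (t_test_region m H h N \<beta> \<theta>\<^sub>0) = \<beta>) \<and>
            UMP_unbiased (obs_space N) (obs_law M m B h N)
              ({\<theta>\<^sub>0} \<times> {0<..}) ((UNIV - {\<theta>\<^sub>0}) \<times> {0<..}) \<beta>
              (indicator (t_test_region m H h N \<beta> \<theta>\<^sub>0)))
       \<and> (\<forall>\<alpha>\<^sub>0>0. \<forall>\<theta>::real.
            measure (obs_law M m B h N (\<theta>, \<alpha>\<^sub>0\<^sup>2)) (chi_square_test_region m H h N \<beta> \<alpha>\<^sub>0) = \<beta>)"
proof -
  interpret fbm_mixture M m N H B h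
    using assms by (simp add: fbm_mixture_def fbm_mixture_axioms_def)
  obtain A E where "whitened_fbm_mixture M m N H B h A E (N - 1)"
    using whitening_exists by blast
  then interpret whitened_fbm_mixture M m N H B h A E "N - 1" .
  show ?thesis
    using measure_t_test_region t_test_UMP_unbiased measure_chi_square_test_region assms(7,8) by blast
qed

end
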